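(* Let $(R,m,u,\Delta,\varepsilon,\xi)$ be a connected pre-bialgebra with cocycle in ${}^H_H\mathcal{YD}$. Let $A:=R\#_\xi H$, let $v:=(\lambda\xi)^{-1}:R\otimes R\to K$ (convolution inverse), and let $v_A:A\otimes A\to K$ be given by $v_A(x\#h\otimes y\#h')=v(x\otimes hy)\varepsilon_H(h')$. Then $$A^{v_A}=R^{v}\#H,$$ where the left side is the twist of $A$ by the gauge transformation $v_A$ and the right side is the bosonization by $H$ of the dual quasi-bialgebra $R^v=(R,m^v,u,\Delta,\varepsilon,\partial_R^2(v))$ in ${}^H_H\mathcal{YD}$, with $m^v=v*m*v^{-1}$.
   Context: $K$ is a field of characteristic $0$; all maps are $K$-linear; the identity map of an object $X$ is written $X$; maps $f:X\to K$, $g:Y\to K$ give $f\otimes g:X\otimes Y\to K$. Ordinary coalgebras: $\Delta(x)=x_{(1)}\otimes x_{(2)}$. $*$ is convolution; for $a,b:C\to K$ and $f:C\to V$ ($V$ a vector space), $a*f*b$ is $c\mapsto a(c_1)f(c_2)b(c_3)$ with $c_1\otimes c_2\otimes c_3$ the iterated coproduct. $H$ is a Hopf algebra over $K$ with antipode $S_H$ having an ad-invariant integral $\lambda\in H^*$: $\lambda$ is a left and right integral ($h_{(1)}\lambda(h_{(2)})=\lambda(h)1_H=\lambda(h_{(1)})h_{(2)}$), $\lambda(1)=1$ and $\lambda(h_{(1)}xS_H(h_{(2)}))=\varepsilon_H(h)\lambda(x)=\lambda(S_H(h_{(1)})xh_{(2)})$. **Yetter-Drinfeld modules.** ${}^H_H\mathcal{YD}$: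 left $H$-modules and left $H$-comodules $V$, $\rho(v)=v_{\langle -1\rangle}\otimes v_{\langle 0\rangle}$, with $\rho(hv)=h_{(1)}v_{\langle -1\rangle}S_H(h_{(3)})\otimes h_{(2)}v_{\langle 0\rangle}$; diagonal action and coaction on tensor products; $K$ trivial; braiding $v\otimes w\mapsto v_{\langle -1\rangle}w\otimes v_{\langle 0\rangle}$. For a coalgebra $C$ in ${}^H_H\mathcal{YD}$, $\Delta(x)=x^{(1)}\otimes x^{(2)}$; $C\otimes D$ is a coalgebra via $\Delta(x\otimes y)=x^{(1)}\otimes x^{(2)}_{\langle -1\rangle}y^{(1)}\otimes x^{(2)}_{\langle 0\rangle}\otimes y^{(2)}$, $\varepsilon_C\otimes\varepsilon_D$ (iterated likewise). Convolutions of maps on $R^{\otimes n}$ use this structure. Coaugmented: given a coalgebra morphism $u:K\to C$ in ${}^H_H\mathcal{YD}$, $1_C=u(1)$; connected: the coradical is $K1_C$. **Pre-bialgebra.** A coaugmented coalgebra $(R,\Delta,\varepsilon,u)$ in ${}^H_H\mathcal{YD}$ with a left $H$-linear map $m:R\otimes R\to R$ that is a coalgebra homomorphism (where $R\otimes R$ has comultiplication $x\otimes y\mapsto x^{(1)}\otimes x^{(2)}_{\langle -1\rangle}y^{(1)}\otimes x^{(2)}_{\langle 0\rangle}\otimes y^{(2)}$ and counit $\varepsilon\otimes\varepsilon$) with $m(R\otimes u)=R=m(u\otimes R)$ ($m$ need not be associative or colinear). **Cocycle.** A map $\xi:R\otimes R\to H$ such that, for $z\in R\otimes R$, $r,s,t\in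 R$, $h\in H$ and with $\Delta_{R\otimes R}(z)=z^{(1)}\otimes z^{(2)}$: (1) $\xi(hz)=h_{(1)}\xi(z)S_H(h_{(2)})$; (2) $\Delta_H\xi(z)=\xi(z^{(1)})z^{(2)}_{\langle -1\rangle}\otimes\xi(z^{(2)}_{\langle 0\rangle})$ and $\varepsilon_H\xi=\varepsilon\otimes\varepsilon$; (3) $m(z^{(1)})_{\langle -1\rangle}\xi(z^{(2)})\otimes m(z^{(1)})_{\langle 0\rangle}=\xi(z^{(1)})z^{(2)}_{\langle -1\rangle}\otimes m(z^{(2)}_{\langle 0\rangle})$; (4) $m(R\otimes m)=m(m\otimes R)\Phi(\xi)$, where $\Phi(\xi)(z\otimes t)=z^{(1)}\otimes\xi(z^{(2)})t$; (5) with $w=s\otimes t$ and $z=r\otimes s$: $\xi(r\otimes m(w^{(1)}))\xi(w^{(2)})=\xi\big(m(z^{(1)})\otimes\xi(z^{(2)})_{(1)}t\big)\xi(z^{(2)})_{(2)}$; (6) $\xi(r\otimes 1_R)=\xi(1_R\otimes r)=\varepsilon(r)1_H$. Then $(R,\xi)$ is a pre-bialgebra with cocycle. **$A=R\#_\xi H$** is the bialgebra on $R\otimes H$ with $\Delta(r\#h)=(r^{(1)}\#r^{(2)}_{\langle -1\rangle}h_{(1)})\otimes(r^{(2)}_{\langle 0\rangle}\#h_{(2)})$, $\varepsilon(r\#h)=\varepsilon(r)\varepsilon_H(h)$, unit $1_R\#1_H$ and $m_A(r\#h\otimes s\#l)=m(r^{(1)}\otimes r^{(2)}_{\langle -1\rangle}h_{(1)}s^{(1)})\#\xi(r^{(2)}_{\langle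 0\rangle}\otimes h_{(2)}s^{(2)})h_{(3)}l$. **$\partial_R^2$.** For a convolution invertible left $H$-linear $w:R\otimes R\to K$ put $w_A(x\#h\otimes y\#h')=w(x\otimes hy)\varepsilon_H(h')$, $\partial_A^2(w_A)=(\varepsilon_A\otimes w_A)*w_A(A\otimes m_A)*w_A^{-1}(m_A\otimes A)*(w_A^{-1}\otimes\varepsilon_A)$, and $\partial_R^2(w)(r\otimes s\otimes t)=\partial_A^2(w_A)(r\#1\otimes s\#1\otimes t\#1)$. **Dual quasi-bialgebras.** $(D,m,u,\Delta,\varepsilon,\alpha)$: a coalgebra $D$ with coalgebra maps $m:D\otimes D\to D$, $u:K\to D$ ($u$ a unit for $m$) and a convolution invertible unital (equal to $\varepsilon$ when some argument is $1_D$) $\alpha:D^{\otimes 3}\to K$ (reassociator) with $\alpha(D\otimes D\otimes m)*\alpha(m\otimes D\otimes D)=(\varepsilon\otimes\alpha)*\alpha(D\otimes m\otimes D)*(\alpha\otimes\varepsilon)$ and $m(D\otimes m)*\alpha=\alpha*m(m\otimes D)$. A bialgebra has trivial reassociator. A gauge transformation is a unital convolution invertible $v:D\otimes D\to K$; $D^v=(D,v*m*v^{-1},u,\Delta,\varepsilon,\alpha_{D^v})$ with $\alpha_{D^v}=(\varepsilon\otimes v)*v(D\otimes m)*\alpha*v^{-1}(m\otimes D)*(v^{-1}\otimes\varepsilon)$. A dual quasi-bialgebra $(Q,m,u,\Delta,\varepsilon,\alpha)$ in ${}^H_H\mathcal{YD}$ is defined by the same axioms with all of $Q,m,u,\Delta,\varepsilon,\alpha$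 in ${}^H_H\mathcal{YD}$ and braided coalgebra structures on $Q^{\otimes n}$. Its bosonization $Q\#H$ is the dual quasi-bialgebra on $B=Q\otimes H$ with $m_B(r\#h\otimes s\#l)=m(r\otimes h_{(1)}s)\#h_{(2)}l$, $1_B=1_Q\#1_H$, $\Delta_B(r\#h)=(r^{(1)}\#r^{(2)}_{\langle -1\rangle}h_{(1)})\otimes(r^{(2)}_{\langle 0\rangle}\#h_{(2)})$, $\varepsilon_B=\varepsilon\otimes\varepsilon_H$, and $\alpha_B(r\#h\otimes s\#l\otimes t\#k)=\alpha(r\otimes h_{(1)}s\otimes h_{(2)}lt)\varepsilon_H(k)$. Equality of dual quasi-bialgebras means all structure maps (including reassociators) coincide on $R\otimes H$. *)

theory Defs
  imports "HOL-Library.Poly_Mapping" Complex_Main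
begin

text \<open>
  Vector spaces over the field \<open>'k\<close> are written in coordinates: a vector space with a basis indexed
  by \<open>'a\<close> is the type \<open>'a \<Rightarrow>\<^sub>0 'k\<close> of finitely supported functions. As \<open>'k\<close> is a field, every
  nonzero vector space is of this form. The tensor product of the spaces with bases \<open>'a\<close> and \<open>'b\<close>
  is the space with basis \<open>'a \<times> 'b\<close>; iterated tensor products are bracketed to the right. The ground
  field itself is just \<open>'k\<close>, with multiplication as scaling; a linear map \<open>u : K \<rightarrow> C\<close> is given by
  the vector \<open>u(1)\<close>.
\<close>

definition scl :: "'k::field \<Rightarrow> ('a \<Rightarrow>\<^sub>0 'k) \<Rightarrow> ('a \<Rightarrow>\<^sub>0 'k)" where
  "scl c x = Poly_Mapping.map (\<lambda>a. c * a) x"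

lemma lookup_scl: "Poly_Mapping.lookup (scl c x) i = c * Poly_Mapping.lookup x i"
  by (simp add: scl_def Poly_Mapping.map.rep_eq when_def)

lemma vector_space_scl: "vector_space (scl :: 'k::field \<Rightarrow> ('a \<Rightarrow>\<^sub>0 'k) \<Rightarrow> _)"
  by unfold_locales (auto intro!: poly_mapping_eqI simp: lookup_scl lookup_add algebra_simps)

abbreviation lin :: "(('a \<Rightarrow>\<^sub>0 'k::field) \<Rightarrow> ('b \<Rightarrow>\<^sub>0 'k)) \<Rightarrow> bool" where
  "lin f \<equiv> Vector_Spaces.linear scl scl f"

abbreviation linK :: "(('a \<Rightarrow>\<^sub>0 'k::field) \<Rightarrow> 'k) \<Rightarrow> bool" where
  "linK f \<equiv> Vector_Spaces.linear scl (*) f"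

definition tens :: "('a \<Rightarrow>\<^sub>0 'k::field) \<Rightarrow> ('b \<Rightarrow>\<^sub>0 'k) \<Rightarrow> ('a \<times> 'b \<Rightarrow>\<^sub>0 'k)" (infixr "\<otimes>" 72) where
  "x \<otimes> y = (\<Sum>a\<in>Poly_Mapping.keys x. \<Sum>b\<in>Poly_Mapping.keys y. Poly_Mapping.single (a, b) (Poly_Mapping.lookup x a * Poly_Mapping.lookup y b))"

text \<open>
  \<open>tens_lift s t F\<close> is the value at the tensor \<open>t\<close> of the linear map induced by the bilinear map \<open>F\<close>
  (\<open>s\<close> is the scaling of the codomain); it is used with bilinear \<open>F\<close> only. It renders Sweedler
  notation: if \<open>t = \<Sum>x\<^sub>i \<otimes> y\<^sub>i\<close> then \<open>tens_lift s t F = \<Sum>F x\<^sub>i y\<^sub>i\<close>.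
\<close>

definition tens_lift ::
  "('k::field \<Rightarrow> 'v::ab_group_add \<Rightarrow> 'v) \<Rightarrow> ('a \<times> 'b \<Rightarrow>\<^sub>0 'k)
     \<Rightarrow> (('a \<Rightarrow>\<^sub>0 'k) \<Rightarrow> ('b \<Rightarrow>\<^sub>0 'k) \<Rightarrow> 'v) \<Rightarrow> 'v" where
  "tens_lift s t F = (\<Sum>(a, b)\<in>Poly_Mapping.keys t.
     s (Poly_Mapping.lookup t (a, b)) (F (Poly_Mapping.single a 1) (Poly_Mapping.single b 1)))"

abbreviation sw ::
  "('a \<times> 'b \<Rightarrow>\<^sub>0 'k::field) \<Rightarrow> (('a \<Rightarrow>\<^sub>0 'k) \<Rightarrow> ('b \<Rightarrow>\<^sub>0 'k) \<Rightarrow> ('c \<Rightarrow>\<^sub>0 'k)) \<Rightarrow> ('c \<Rightarrow>\<^sub>0 'k)" where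
  "sw \<equiv> tens_lift scl"

abbreviation swK ::
  "('a \<times> 'b \<Rightarrow>\<^sub>0 'k::field) \<Rightarrow> (('a \<Rightarrow>\<^sub>0 'k) \<Rightarrow> ('b \<Rightarrow>\<^sub>0 'k) \<Rightarrow> 'k) \<Rightarrow> 'k" where
  "swK \<equiv> tens_lift (*)"

lemma tens_lift_tens:
  fixes F :: "('a \<Rightarrow>\<^sub>0 'k::field) \<Rightarrow> ('b \<Rightarrow>\<^sub>0 'k) \<Rightarrow> 'v::ab_group_add"
    and x :: "'a \<Rightarrow>\<^sub>0 'k" and y :: "'b \<Rightarrow>\<^sub>0 'k"
  assumes s: "vector_space s"
    and l: "\<And>y. Vector_Spaces.linear scl s (\<lambda>x. F x y)" and r: "\<And>x. Vector_Spaces.linear scl s (F x)"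
  shows "tens_lift s (x \<otimes> y) F = F x y"
proof -
  have dec: "z = (\<Sum>a\<in>Poly_Mapping.keys z. scl (Poly_Mapping.lookup z a) (Poly_Mapping.single a 1))" for z :: "'z \<Rightarrow>\<^sub>0 'k"
    by (rule poly_mapping_eqI)
      (auto simp: lookup_sum lookup_scl lookup_single when_def if_distrib not_in_keys_iff_lookup_eq_zero cong: if_cong)
  interpret l: Vector_Spaces.linear scl s "\<lambda>x. F x y'" for y' by (rule l)
  interpret r: Vector_Spaces.linear scl s "F x'" for x' by (rule r)
  have lk: "Poly_Mapping.lookup (x \<otimes> y) (a, b) = Poly_Mapping.lookup x a * Poly_Mapping.lookup y b" for a b
  proof -
    have "Poly_Mapping.lookup (x \<otimes> y) (a, b)
        = (\<Sum>a'\<in>Poly_Mapping.keys x. \<Sum>b'\<in>Poly_Mapping.keys y. if a' = a then if b' = b then Poly_Mapping.lookup x a' * Poly_Mapping.lookup y b' else 0 else 0)"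
      unfolding tens_def lookup_sum lookup_single when_def by (intro sum.cong refl) auto
    also have "\<dots> = (\<Sum>a'\<in>Poly_Mapping.keys x. if a' = a then \<Sum>b'\<in>Poly_Mapping.keys y. if b' = b then Poly_Mapping.lookup x a' * Poly_Mapping.lookup y b' else 0 else 0)"
      by (intro sum.cong refl) auto
    also have "\<dots> = Poly_Mapping.lookup x a * Poly_Mapping.lookup y b"
      by (simp add: not_in_keys_iff_lookup_eq_zero)
    finally show ?thesis .
  qed
  have ks: "Poly_Mapping.keys (x \<otimes> y) = Poly_Mapping.keys x \<times> Poly_Mapping.keys y"
    by (auto simp: lk Poly_Mapping.in_keys_iff)
  have "tens_lift s (x \<otimes> y) F = (\<Sum>a\<in>Poly_Mapping.keys x. \<Sum>b\<in>Poly_Mapping.keys y.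
      s (Poly_Mapping.lookup x a * Poly_Mapping.lookup y b) (F (Poly_Mapping.single a 1) (Poly_Mapping.single b 1)))"
    unfolding tens_lift_def ks by (simp add: lk sum.cartesian_product)
  also have "\<dots> = (\<Sum>a\<in>Poly_Mapping.keys x. s (Poly_Mapping.lookup x a) (F (Poly_Mapping.single a 1) (\<Sum>b\<in>Poly_Mapping.keys y. scl (Poly_Mapping.lookup y b) (Poly_Mapping.single b 1))))"
    by (simp add: r.sum r.scale l.vs2.scale_sum_right)
  also have "\<dots> = (\<Sum>a\<in>Poly_Mapping.keys x. s (Poly_Mapping.lookup x a) (F (Poly_Mapping.single a 1) y))"
    using dec[of y] by simp
  also have "\<dots> = F (\<Sum>a\<in>Poly_Mapping.keys x. scl (Poly_Mapping.lookup x a) (Poly_Mapping.single a 1)) y"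
    by (simp add: l.sum l.scale)
  also have "\<dots> = F x y" using dec[of x] by simp
  finally show ?thesis .
qed


section \<open>Coalgebras and convolution\<close>

definition coalgebra ::
  "(('c \<Rightarrow>\<^sub>0 'k::field) \<Rightarrow> ('c \<times> 'c \<Rightarrow>\<^sub>0 'k)) \<Rightarrow> (('c \<Rightarrow>\<^sub>0 'k) \<Rightarrow> 'k) \<Rightarrow> bool" where
  "coalgebra \<Delta> \<epsilon> \<longleftrightarrow> lin \<Delta> \<and> linK \<epsilon> \<and>
     (\<forall>x. sw (\<Delta> x) (\<lambda>x1 x2. sw (\<Delta> x1) (\<lambda>x11 x12. x11 \<otimes> x12 \<otimes> x2))
        = sw (\<Delta> x) (\<lambda>x1 x2. sw (\<Delta> x2) (\<lambda>x21 x22. x1 \<otimes> x21 \<otimes> x22))) \<and>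
     (\<forall>x. sw (\<Delta> x) (\<lambda>x1 x2. scl (\<epsilon> x1) x2) = x) \<and>
     (\<forall>x. sw (\<Delta> x) (\<lambda>x1 x2. scl (\<epsilon> x2) x1) = x)"

definition convK ::
  "(('c \<Rightarrow>\<^sub>0 'k::field) \<Rightarrow> ('c \<times> 'c \<Rightarrow>\<^sub>0 'k)) \<Rightarrow> (('c \<Rightarrow>\<^sub>0 'k) \<Rightarrow> 'k) \<Rightarrow> (('c \<Rightarrow>\<^sub>0 'k) \<Rightarrow> 'k)
     \<Rightarrow> ('c \<Rightarrow>\<^sub>0 'k) \<Rightarrow> 'k" where
  "convK \<Delta> f g c = swK (\<Delta> c) (\<lambda>c1 c2. f c1 * g c2)"

text \<open>\<open>a * f\<close>, \<open>f * b\<close> and \<open>a * f * b\<close> for scalar-valued \<open>a\<close>, \<open>b\<close> and vector-valued \<open>f\<close>.\<close>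

definition convL ::
  "(('c \<Rightarrow>\<^sub>0 'k::field) \<Rightarrow> ('c \<times> 'c \<Rightarrow>\<^sub>0 'k)) \<Rightarrow> (('c \<Rightarrow>\<^sub>0 'k) \<Rightarrow> 'k) \<Rightarrow> (('c \<Rightarrow>\<^sub>0 'k) \<Rightarrow> ('v \<Rightarrow>\<^sub>0 'k))
     \<Rightarrow> ('c \<Rightarrow>\<^sub>0 'k) \<Rightarrow> ('v \<Rightarrow>\<^sub>0 'k)" where
  "convL \<Delta> a f c = sw (\<Delta> c) (\<lambda>c1 c2. scl (a c1) (f c2))"

definition convR ::
  "(('c \<Rightarrow>\<^sub>0 'k::field) \<Rightarrow> ('c \<times> 'c \<Rightarrow>\<^sub>0 'k)) \<Rightarrow> (('c \<Rightarrow>\<^sub>0 'k) \<Rightarrow> ('v \<Rightarrow>\<^sub>0 'k)) \<Rightarrow> (('c \<Rightarrow>\<^sub>0 'k) \<Rightarrow> 'k)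
     \<Rightarrow> ('c \<Rightarrow>\<^sub>0 'k) \<Rightarrow> ('v \<Rightarrow>\<^sub>0 'k)" where
  "convR \<Delta> f b c = sw (\<Delta> c) (\<lambda>c1 c2. scl (b c2) (f c1))"

definition conv3 ::
  "(('c \<Rightarrow>\<^sub>0 'k::field) \<Rightarrow> ('c \<times> 'c \<Rightarrow>\<^sub>0 'k)) \<Rightarrow> (('c \<Rightarrow>\<^sub>0 'k) \<Rightarrow> 'k) \<Rightarrow> (('c \<Rightarrow>\<^sub>0 'k) \<Rightarrow> ('v \<Rightarrow>\<^sub>0 'k))
     \<Rightarrow> (('c \<Rightarrow>\<^sub>0 'k) \<Rightarrow> 'k) \<Rightarrow> ('c \<Rightarrow>\<^sub>0 'k) \<Rightarrow> ('v \<Rightarrow>\<^sub>0 'k)" where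
  "conv3 \<Delta> a f b c = sw (\<Delta> c) (\<lambda>c1 d. sw (\<Delta> d) (\<lambda>c2 c3. scl (a c1 * b c3) (f c2)))"

definition is_conv_inverse ::
  "(('c \<Rightarrow>\<^sub>0 'k::field) \<Rightarrow> ('c \<times> 'c \<Rightarrow>\<^sub>0 'k)) \<Rightarrow> (('c \<Rightarrow>\<^sub>0 'k) \<Rightarrow> 'k)
     \<Rightarrow> (('c \<Rightarrow>\<^sub>0 'k) \<Rightarrow> 'k) \<Rightarrow> (('c \<Rightarrow>\<^sub>0 'k) \<Rightarrow> 'k) \<Rightarrow> bool" where
  "is_conv_inverse \<Delta> \<epsilon> f g \<longleftrightarrow> linK g \<and> convK \<Delta> f g = \<epsilon> \<and> convK \<Delta> g f = \<epsilon>"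

definition conv_invertible ::
  "(('c \<Rightarrow>\<^sub>0 'k::field) \<Rightarrow> ('c \<times> 'c \<Rightarrow>\<^sub>0 'k)) \<Rightarrow> (('c \<Rightarrow>\<^sub>0 'k) \<Rightarrow> 'k) \<Rightarrow> (('c \<Rightarrow>\<^sub>0 'k) \<Rightarrow> 'k) \<Rightarrow> bool" where
  "conv_invertible \<Delta> \<epsilon> f \<longleftrightarrow> linK f \<and> (\<exists>g. is_conv_inverse \<Delta> \<epsilon> f g)"

definition conv_inv ::
  "(('c \<Rightarrow>\<^sub>0 'k::field) \<Rightarrow> ('c \<times> 'c \<Rightarrow>\<^sub>0 'k)) \<Rightarrow> (('c \<Rightarrow>\<^sub>0 'k) \<Rightarrow> 'k) \<Rightarrow> (('c \<Rightarrow>\<^sub>0 'k) \<Rightarrow> 'k)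
     \<Rightarrow> ('c \<Rightarrow>\<^sub>0 'k) \<Rightarrow> 'k" where
  "conv_inv \<Delta> \<epsilon> f = (THE g. is_conv_inverse \<Delta> \<epsilon> f g)"

definition subcoalgebra ::
  "(('c \<Rightarrow>\<^sub>0 'k::field) \<Rightarrow> ('c \<times> 'c \<Rightarrow>\<^sub>0 'k)) \<Rightarrow> ('c \<Rightarrow>\<^sub>0 'k) set \<Rightarrow> bool" where
  "subcoalgebra \<Delta> D \<longleftrightarrow> module.subspace scl D \<and>
     \<Delta> ` D \<subseteq> module.span scl {x \<otimes> y |x y. x \<in> D \<and> y \<in> D}"

definition simple_subcoalgebra ::
  "(('c \<Rightarrow>\<^sub>0 'k::field) \<Rightarrow> ('c \<times> 'c \<Rightarrow>\<^sub>0 'k)) \<Rightarrow> ('c \<Rightarrow>\<^sub>0 'k) set \<Rightarrow> bool" where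
  "simple_subcoalgebra \<Delta> D \<longleftrightarrow> subcoalgebra \<Delta> D \<and> D \<noteq> {0} \<and>
     (\<forall>E. subcoalgebra \<Delta> E \<and> E \<subseteq> D \<longrightarrow> E = {0} \<or> E = D)"

definition coradical ::
  "(('c \<Rightarrow>\<^sub>0 'k::field) \<Rightarrow> ('c \<times> 'c \<Rightarrow>\<^sub>0 'k)) \<Rightarrow> ('c \<Rightarrow>\<^sub>0 'k) set" where
  "coradical \<Delta> = module.span scl (\<Union>{D. simple_subcoalgebra \<Delta> D})"


section \<open>Hopf algebras\<close>

record (overloaded) ('h, 'k) hopf =
  mulH :: "('h \<times> 'h \<Rightarrow>\<^sub>0 'k) \<Rightarrow> ('h \<Rightarrow>\<^sub>0 'k)"
  oneH :: "'h \<Rightarrow>\<^sub>0 'k"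
  DeltaH :: "('h \<Rightarrow>\<^sub>0 'k) \<Rightarrow> ('h \<times> 'h \<Rightarrow>\<^sub>0 'k)"
  epsH :: "('h \<Rightarrow>\<^sub>0 'k) \<Rightarrow> 'k"
  antipode :: "('h \<Rightarrow>\<^sub>0 'k) \<Rightarrow> ('h \<Rightarrow>\<^sub>0 'k)"

abbreviation prodH ::
  "('h \<Rightarrow>\<^sub>0 'k::field) \<Rightarrow> ('h, 'k) hopf \<Rightarrow> ('h \<Rightarrow>\<^sub>0 'k) \<Rightarrow> ('h \<Rightarrow>\<^sub>0 'k)"
  ("(_ \<bullet>\<^bsub>_\<^esub>/ _)" [75, 0, 76] 75) where
  "x \<bullet>\<^bsub>H\<^esub> y \<equiv> mulH H (x \<otimes> y)"

definition hopf_algebra :: "('h, 'k::field) hopf \<Rightarrow> bool" where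
  "hopf_algebra H \<longleftrightarrow>
     lin (mulH H) \<and>
     (\<forall>x y z. (x \<bullet>\<^bsub>H\<^esub> y) \<bullet>\<^bsub>H\<^esub> z = x \<bullet>\<^bsub>H\<^esub> (y \<bullet>\<^bsub>H\<^esub> z)) \<and>
     (\<forall>x. oneH H \<bullet>\<^bsub>H\<^esub> x = x \<and> x \<bullet>\<^bsub>H\<^esub> oneH H = x) \<and>
     coalgebra (DeltaH H) (epsH H) \<and>
     (\<forall>x y. DeltaH H (x \<bullet>\<^bsub>H\<^esub> y) =
        sw (DeltaH H x) (\<lambda>x1 x2. sw (DeltaH H y) (\<lambda>y1 y2. (x1 \<bullet>\<^bsub>H\<^esub> y1) \<otimes> (x2 \<bullet>\<^bsub>H\<^esub> y2)))) \<and>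
     DeltaH H (oneH H) = oneH H \<otimes> oneH H \<and>
     (\<forall>x y. epsH H (x \<bullet>\<^bsub>H\<^esub> y) = epsH H x * epsH H y) \<and>
     epsH H (oneH H) = 1 \<and>
     lin (antipode H) \<and>
     (\<forall>x. sw (DeltaH H x) (\<lambda>x1 x2. antipode H x1 \<bullet>\<^bsub>H\<^esub> x2) = scl (epsH H x) (oneH H)) \<and>
     (\<forall>x. sw (DeltaH H x) (\<lambda>x1 x2. x1 \<bullet>\<^bsub>H\<^esub> antipode H x2) = scl (epsH H x) (oneH H))"

definition ad_invariant_integral :: "('h, 'k::field) hopf \<Rightarrow> (('h \<Rightarrow>\<^sub>0 'k) \<Rightarrow> 'k) \<Rightarrow> bool" where
  "ad_invariant_integral H L \<longleftrightarrow>
     linK L \<and>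
     (\<forall>h. sw (DeltaH H h) (\<lambda>h1 h2. scl (L h2) h1) = scl (L h) (oneH H)) \<and>
     (\<forall>h. sw (DeltaH H h) (\<lambda>h1 h2. scl (L h1) h2) = scl (L h) (oneH H)) \<and>
     L (oneH H) = 1 \<and>
     (\<forall>h x. swK (DeltaH H h) (\<lambda>h1 h2. L (h1 \<bullet>\<^bsub>H\<^esub> x \<bullet>\<^bsub>H\<^esub> antipode H h2)) = epsH H h * L x) \<and>
     (\<forall>h x. swK (DeltaH H h) (\<lambda>h1 h2. L (antipode H h1 \<bullet>\<^bsub>H\<^esub> x \<bullet>\<^bsub>H\<^esub> h2)) = epsH H h * L x)"


section \<open>Coalgebras in Yetter-Drinfeld modules\<close>

record (overloaded) ('h, 'c, 'k) ydcoalg =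
  act :: "('h \<times> 'c \<Rightarrow>\<^sub>0 'k) \<Rightarrow> ('c \<Rightarrow>\<^sub>0 'k)"
  coact :: "('c \<Rightarrow>\<^sub>0 'k) \<Rightarrow> ('h \<times> 'c \<Rightarrow>\<^sub>0 'k)"
  comult :: "('c \<Rightarrow>\<^sub>0 'k) \<Rightarrow> ('c \<times> 'c \<Rightarrow>\<^sub>0 'k)"
  counit :: "('c \<Rightarrow>\<^sub>0 'k) \<Rightarrow> 'k"

definition yd_module :: "('h, 'k::field) hopf \<Rightarrow> ('h, 'c, 'k, 'z) ydcoalg_scheme \<Rightarrow> bool" where
  "yd_module H V \<longleftrightarrow>
     lin (act V) \<and> lin (coact V) \<and>
     (\<forall>g h v. act V ((g \<bullet>\<^bsub>H\<^esub> h) \<otimes> v) = act V (g \<otimes> act V (h \<otimes> v))) \<and>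
     (\<forall>v. act V (oneH H \<otimes> v) = v) \<and>
     (\<forall>v. sw (coact V v) (\<lambda>a v0. sw (DeltaH H a) (\<lambda>a1 a2. a1 \<otimes> a2 \<otimes> v0))
        = sw (coact V v) (\<lambda>a v0. sw (coact V v0) (\<lambda>b v00. a \<otimes> b \<otimes> v00))) \<and>
     (\<forall>v. sw (coact V v) (\<lambda>a v0. scl (epsH H a) v0) = v) \<and>
     (\<forall>h v. coact V (act V (h \<otimes> v)) =
        sw (DeltaH H h) (\<lambda>h1 h'. sw (DeltaH H h') (\<lambda>h2 h3. sw (coact V v) (\<lambda>a v0.
          (h1 \<bullet>\<^bsub>H\<^esub> a \<bullet>\<^bsub>H\<^esub> antipode H h3) \<otimes> act V (h2 \<otimes> v0)))))"

definition H_linear ::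
  "('h, 'c, 'k::field, 'z) ydcoalg_scheme \<Rightarrow> ('h, 'd, 'k, 'y) ydcoalg_scheme
     \<Rightarrow> (('c \<Rightarrow>\<^sub>0 'k) \<Rightarrow> ('d \<Rightarrow>\<^sub>0 'k)) \<Rightarrow> bool" where
  "H_linear V W f \<longleftrightarrow> lin f \<and> (\<forall>h v. f (act V (h \<otimes> v)) = act W (h \<otimes> f v))"

definition H_colinear ::
  "('h, 'c, 'k::field, 'z) ydcoalg_scheme \<Rightarrow> ('h, 'd, 'k, 'y) ydcoalg_scheme
     \<Rightarrow> (('c \<Rightarrow>\<^sub>0 'k) \<Rightarrow> ('d \<Rightarrow>\<^sub>0 'k)) \<Rightarrow> bool" where
  "H_colinear V W f \<longleftrightarrow> lin f \<and> (\<forall>v. coact W (f v) = sw (coact V v) (\<lambda>a v0. a \<otimes> f v0))"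

text \<open>The same for maps into the trivial Yetter-Drinfeld module \<open>K\<close>.\<close>

definition H_linearK ::
  "('h, 'k::field) hopf \<Rightarrow> ('h, 'c, 'k, 'z) ydcoalg_scheme \<Rightarrow> (('c \<Rightarrow>\<^sub>0 'k) \<Rightarrow> 'k) \<Rightarrow> bool" where
  "H_linearK H V f \<longleftrightarrow> linK f \<and> (\<forall>h v. f (act V (h \<otimes> v)) = epsH H h * f v)"

definition H_colinearK ::
  "('h, 'k::field) hopf \<Rightarrow> ('h, 'c, 'k, 'z) ydcoalg_scheme \<Rightarrow> (('c \<Rightarrow>\<^sub>0 'k) \<Rightarrow> 'k) \<Rightarrow> bool" where
  "H_colinearK H V f \<longleftrightarrow> linK f \<and>
     (\<forall>v. sw (coact V v) (\<lambda>a v0. scl (f v0) a) = scl (f v) (oneH H))"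

text \<open>
  The braided tensor product \<open>C \<otimes> D\<close>: diagonal action and coaction, and the comultiplication
  twisted by the braiding.
\<close>

definition btens ::
  "('h, 'k::field) hopf \<Rightarrow> ('h, 'c, 'k, 'z) ydcoalg_scheme \<Rightarrow> ('h, 'd, 'k, 'y) ydcoalg_scheme
     \<Rightarrow> ('h, 'c \<times> 'd, 'k) ydcoalg" where
  "btens H C D =
     \<lparr> act = (\<lambda>t. sw t (\<lambda>h z. sw z (\<lambda>x y. sw (DeltaH H h) (\<lambda>h1 h2.
         act C (h1 \<otimes> x) \<otimes> act D (h2 \<otimes> y))))),
       coact = (\<lambda>z. sw z (\<lambda>x y. sw (coact C x) (\<lambda>a x0. sw (coact D y) (\<lambda>b y0.
         (a \<bullet>\<^bsub>H\<^esub> b) \<otimes> x0 \<otimes> y0)))),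
       comult = (\<lambda>z. sw z (\<lambda>x y. sw (comult C x) (\<lambda>x1 x2. sw (comult D y) (\<lambda>y1 y2.
         sw (coact C x2) (\<lambda>a x20. (x1 \<otimes> act D (a \<otimes> y1)) \<otimes> (x20 \<otimes> y2)))))),
       counit = (\<lambda>z. swK z (\<lambda>x y. counit C x * counit D y)) \<rparr>"

definition yd_coalgebra :: "('h, 'k::field) hopf \<Rightarrow> ('h, 'c, 'k, 'z) ydcoalg_scheme \<Rightarrow> bool" where
  "yd_coalgebra H C \<longleftrightarrow>
     yd_module H C \<and> coalgebra (comult C) (counit C) \<and>
     H_linear C (btens H C C) (comult C) \<and> H_colinear C (btens H C C) (comult C) \<and>
     H_linearK H C (counit C) \<and> H_colinearK H C (counit C)"

text \<open>\<open>e = u(1)\<close> for a coalgebra morphism \<open>u : K \<rightarrow> C\<close> of Yetter-Drinfeld modules.\<close>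

definition coaugmentation ::
  "('h, 'k::field) hopf \<Rightarrow> ('h, 'c, 'k, 'z) ydcoalg_scheme \<Rightarrow> ('c \<Rightarrow>\<^sub>0 'k) \<Rightarrow> bool" where
  "coaugmentation H C e \<longleftrightarrow>
     (\<forall>h. act C (h \<otimes> e) = scl (epsH H h) e) \<and> coact C e = oneH H \<otimes> e \<and>
     comult C e = e \<otimes> e \<and> counit C e = 1"

definition coalgebra_hom ::
  "('h, 'c, 'k::field, 'z) ydcoalg_scheme \<Rightarrow> ('h, 'd, 'k, 'y) ydcoalg_scheme
     \<Rightarrow> (('c \<Rightarrow>\<^sub>0 'k) \<Rightarrow> ('d \<Rightarrow>\<^sub>0 'k)) \<Rightarrow> bool" where
  "coalgebra_hom C D f \<longleftrightarrow> lin f \<and>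
     (\<forall>x. comult D (f x) = sw (comult C x) (\<lambda>x1 x2. f x1 \<otimes> f x2)) \<and>
     (\<forall>x. counit D (f x) = counit C x)"

definition connected_coalg :: "('h, 'c, 'k::field, 'z) ydcoalg_scheme \<Rightarrow> ('c \<Rightarrow>\<^sub>0 'k) \<Rightarrow> bool" where
  "connected_coalg C e \<longleftrightarrow> coradical (comult C) = module.span scl {e}"


section \<open>Pre-bialgebras with cocycle\<close>

definition pre_bialgebra ::
  "('h, 'k::field) hopf \<Rightarrow> ('h, 'r, 'k) ydcoalg \<Rightarrow> ('r \<Rightarrow>\<^sub>0 'k)
     \<Rightarrow> (('r \<times> 'r \<Rightarrow>\<^sub>0 'k) \<Rightarrow> ('r \<Rightarrow>\<^sub>0 'k)) \<Rightarrow> bool" where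
  "pre_bialgebra H R e m \<longleftrightarrow>
     yd_coalgebra H R \<and> coaugmentation H R e \<and>
     H_linear (btens H R R) R m \<and> coalgebra_hom (btens H R R) R m \<and>
     (\<forall>r. m (r \<otimes> e) = r \<and> m (e \<otimes> r) = r)"

definition cocycle ::
  "('h, 'k::field) hopf \<Rightarrow> ('h, 'r, 'k) ydcoalg \<Rightarrow> ('r \<Rightarrow>\<^sub>0 'k)
     \<Rightarrow> (('r \<times> 'r \<Rightarrow>\<^sub>0 'k) \<Rightarrow> ('r \<Rightarrow>\<^sub>0 'k)) \<Rightarrow> (('r \<times> 'r \<Rightarrow>\<^sub>0 'k) \<Rightarrow> ('h \<Rightarrow>\<^sub>0 'k)) \<Rightarrow> bool" where
  "cocycle H R e m \<xi> \<longleftrightarrow>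
     (let RR = btens H R R in
     lin \<xi> \<and>
     (\<forall>h z. \<xi> (act RR (h \<otimes> z)) = sw (DeltaH H h) (\<lambda>h1 h2. h1 \<bullet>\<^bsub>H\<^esub> \<xi> z \<bullet>\<^bsub>H\<^esub> antipode H h2)) \<and>
     (\<forall>z. DeltaH H (\<xi> z) =
        sw (comult RR z) (\<lambda>z1 z2. sw (coact RR z2) (\<lambda>a z20. (\<xi> z1 \<bullet>\<^bsub>H\<^esub> a) \<otimes> \<xi> z20))) \<and>
     (\<forall>z. epsH H (\<xi> z) = counit RR z) \<and>
     (\<forall>z. sw (comult RR z) (\<lambda>z1 z2. sw (coact R (m z1)) (\<lambda>a r0. (a \<bullet>\<^bsub>H\<^esub> \<xi> z2) \<otimes> r0))
        = sw (comult RR z) (\<lambda>z1 z2. sw (coact RR z2) (\<lambda>a z20. (\<xi> z1 \<bullet>\<^bsub>H\<^esub> a) \<otimes> m z20))) \<and>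
     (\<forall>r s t. m (r \<otimes> m (s \<otimes> t)) =
        sw (comult RR (r \<otimes> s)) (\<lambda>z1 z2. m (m z1 \<otimes> act R (\<xi> z2 \<otimes> t)))) \<and>
     (\<forall>r s t. sw (comult RR (s \<otimes> t)) (\<lambda>w1 w2. \<xi> (r \<otimes> m w1) \<bullet>\<^bsub>H\<^esub> \<xi> w2) =
        sw (comult RR (r \<otimes> s)) (\<lambda>z1 z2. sw (DeltaH H (\<xi> z2)) (\<lambda>a b.
          \<xi> (m z1 \<otimes> act R (a \<otimes> t)) \<bullet>\<^bsub>H\<^esub> b))) \<and>
     (\<forall>r. \<xi> (r \<otimes> e) = scl (counit R r) (oneH H) \<and> \<xi> (e \<otimes> r) = scl (counit R r) (oneH H)))"

definition pre_bialgebra_with_cocycle ::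
  "('h, 'k::field) hopf \<Rightarrow> ('h, 'r, 'k) ydcoalg \<Rightarrow> ('r \<Rightarrow>\<^sub>0 'k)
     \<Rightarrow> (('r \<times> 'r \<Rightarrow>\<^sub>0 'k) \<Rightarrow> ('r \<Rightarrow>\<^sub>0 'k)) \<Rightarrow> (('r \<times> 'r \<Rightarrow>\<^sub>0 'k) \<Rightarrow> ('h \<Rightarrow>\<^sub>0 'k)) \<Rightarrow> bool" where
  "pre_bialgebra_with_cocycle H R e m \<xi> \<longleftrightarrow> pre_bialgebra H R e m \<and> cocycle H R e m \<xi>"


section \<open>Dual quasi-bialgebras\<close>

record (overloaded) ('d, 'k) dqb =
  multD :: "('d \<times> 'd \<Rightarrow>\<^sub>0 'k) \<Rightarrow> ('d \<Rightarrow>\<^sub>0 'k)"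
  oneD :: "'d \<Rightarrow>\<^sub>0 'k"
  comultD :: "('d \<Rightarrow>\<^sub>0 'k) \<Rightarrow> ('d \<times> 'd \<Rightarrow>\<^sub>0 'k)"
  counitD :: "('d \<Rightarrow>\<^sub>0 'k) \<Rightarrow> 'k"
  reassD :: "('d \<times> 'd \<times> 'd \<Rightarrow>\<^sub>0 'k) \<Rightarrow> 'k"

text \<open>The ordinary (unbraided) tensor product of coalgebras.\<close>

definition tcomult ::
  "(('c \<Rightarrow>\<^sub>0 'k::field) \<Rightarrow> ('c \<times> 'c \<Rightarrow>\<^sub>0 'k)) \<Rightarrow> (('d \<Rightarrow>\<^sub>0 'k) \<Rightarrow> ('d \<times> 'd \<Rightarrow>\<^sub>0 'k))
     \<Rightarrow> ('c \<times> 'd \<Rightarrow>\<^sub>0 'k) \<Rightarrow> (('c \<times> 'd) \<times> ('c \<times> 'd) \<Rightarrow>\<^sub>0 'k)" where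
  "tcomult \<Delta> \<Delta>' t = sw t (\<lambda>x y. sw (\<Delta> x) (\<lambda>x1 x2. sw (\<Delta>' y) (\<lambda>y1 y2. (x1 \<otimes> y1) \<otimes> (x2 \<otimes> y2))))"

abbreviation comultDD where "comultDD D \<equiv> tcomult (comultD D) (comultD D)"
abbreviation comultDDD where "comultDDD D \<equiv> tcomult (comultD D) (comultDD D)"

definition counitDD :: "('d, 'k::field) dqb \<Rightarrow> ('d \<times> 'd \<Rightarrow>\<^sub>0 'k) \<Rightarrow> 'k" where
  "counitDD D t = swK t (\<lambda>x y. counitD D x * counitD D y)"

definition counitDDD :: "('d, 'k::field) dqb \<Rightarrow> ('d \<times> 'd \<times> 'd \<Rightarrow>\<^sub>0 'k) \<Rightarrow> 'k" where
  "counitDDD D t = swK t (\<lambda>x u. counitD D x * counitDD D u)"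

definition gauge_transformation :: "('d, 'k::field) dqb \<Rightarrow> (('d \<times> 'd \<Rightarrow>\<^sub>0 'k) \<Rightarrow> 'k) \<Rightarrow> bool" where
  "gauge_transformation D v \<longleftrightarrow>
     (\<forall>x. v (oneD D \<otimes> x) = counitD D x \<and> v (x \<otimes> oneD D) = counitD D x) \<and>
     conv_invertible (comultDD D) (counitDD D) v"

definition twist :: "('d, 'k::field) dqb \<Rightarrow> (('d \<times> 'd \<Rightarrow>\<^sub>0 'k) \<Rightarrow> 'k) \<Rightarrow> ('d, 'k) dqb" where
  "twist D v =
     (let w = conv_inv (comultDD D) (counitDD D) v; cv = convK (comultDDD D) in
     \<lparr> multD = conv3 (comultDD D) v (multD D) w,
       oneD = oneD D,
       comultD = comultD D,
       counitD = counitD D,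
       reassD =
         cv (\<lambda>t. swK t (\<lambda>x u. counitD D x * v u))
        (cv (\<lambda>t. swK t (\<lambda>x u. v (x \<otimes> multD D u)))
        (cv (reassD D)
        (cv (\<lambda>t. swK t (\<lambda>x u. swK u (\<lambda>y z. w (multD D (x \<otimes> y) \<otimes> z))))
            (\<lambda>t. swK t (\<lambda>x u. swK u (\<lambda>y z. w (x \<otimes> y) * counitD D z)))))) \<rparr>)"

definition smash ::
  "('h, 'k::field) hopf \<Rightarrow> ('h, 'r, 'k) ydcoalg \<Rightarrow> ('r \<Rightarrow>\<^sub>0 'k)
     \<Rightarrow> (('r \<times> 'r \<Rightarrow>\<^sub>0 'k) \<Rightarrow> ('r \<Rightarrow>\<^sub>0 'k)) \<Rightarrow> (('r \<times> 'r \<Rightarrow>\<^sub>0 'k) \<Rightarrow> ('h \<Rightarrow>\<^sub>0 'k))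
     \<Rightarrow> ('r \<times> 'h, 'k) dqb" where
  "smash H R e m \<xi> =
     \<lparr> multD = (\<lambda>t. sw t (\<lambda>p q. sw p (\<lambda>r h. sw q (\<lambda>s l.
         sw (comult R r) (\<lambda>r1 r2. sw (coact R r2) (\<lambda>a r20. sw (comult R s) (\<lambda>s1 s2.
         sw (DeltaH H h) (\<lambda>h1 h'. sw (DeltaH H h') (\<lambda>h2 h3.
           m (r1 \<otimes> act R ((a \<bullet>\<^bsub>H\<^esub> h1) \<otimes> s1)) \<otimes>
           (\<xi> (r20 \<otimes> act R (h2 \<otimes> s2)) \<bullet>\<^bsub>H\<^esub> h3 \<bullet>\<^bsub>H\<^esub> l)))))))))),
       oneD = e \<otimes> oneH H,
       comultD = (\<lambda>p. sw p (\<lambda>r h. sw (comult R r) (\<lambda>r1 r2. sw (DeltaH H h) (\<lambda>h1 h2.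
         sw (coact R r2) (\<lambda>a r20. (r1 \<otimes> (a \<bullet>\<^bsub>H\<^esub> h1)) \<otimes> (r20 \<otimes> h2)))))),
       counitD = (\<lambda>p. swK p (\<lambda>r h. counit R r * epsH H h)),
       reassD = (\<lambda>t. swK t (\<lambda>p u. swK u (\<lambda>q q'.
         swK p (\<lambda>r h. counit R r * epsH H h) * swK q (\<lambda>r h. counit R r * epsH H h) *
         swK q' (\<lambda>r h. counit R r * epsH H h)))) \<rparr>"

text \<open>\<open>w\<^sub>A(x # h \<otimes> y # h') = w(x \<otimes> hy) \<epsilon>\<^sub>H(h')\<close>.\<close>

definition extA ::
  "('h, 'k::field) hopf \<Rightarrow> ('h, 'r, 'k) ydcoalg \<Rightarrow> (('r \<times> 'r \<Rightarrow>\<^sub>0 'k) \<Rightarrow> 'k)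
     \<Rightarrow> (('r \<times> 'h) \<times> ('r \<times> 'h) \<Rightarrow>\<^sub>0 'k) \<Rightarrow> 'k" where
  "extA H R w t = swK t (\<lambda>p q. swK p (\<lambda>x h. swK q (\<lambda>y h'. w (x \<otimes> act R (h \<otimes> y)) * epsH H h')))"

definition partial2A ::
  "('d, 'k::field) dqb \<Rightarrow> (('d \<times> 'd \<Rightarrow>\<^sub>0 'k) \<Rightarrow> 'k) \<Rightarrow> ('d \<times> 'd \<times> 'd \<Rightarrow>\<^sub>0 'k) \<Rightarrow> 'k" where
  "partial2A A w =
     (let w' = conv_inv (comultDD A) (counitDD A) w; cv = convK (comultDDD A) in
         cv (\<lambda>t. swK t (\<lambda>x u. counitD A x * w u))
        (cv (\<lambda>t. swK t (\<lambda>x u. w (x \<otimes> multD A u)))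
        (cv (\<lambda>t. swK t (\<lambda>x u. swK u (\<lambda>y z. w' (multD A (x \<otimes> y) \<otimes> z))))
            (\<lambda>t. swK t (\<lambda>x u. swK u (\<lambda>y z. w' (x \<otimes> y) * counitD A z))))))"

definition partial2R ::
  "('h, 'k::field) hopf \<Rightarrow> ('h, 'r, 'k) ydcoalg \<Rightarrow> ('r \<Rightarrow>\<^sub>0 'k)
     \<Rightarrow> (('r \<times> 'r \<Rightarrow>\<^sub>0 'k) \<Rightarrow> ('r \<Rightarrow>\<^sub>0 'k)) \<Rightarrow> (('r \<times> 'r \<Rightarrow>\<^sub>0 'k) \<Rightarrow> ('h \<Rightarrow>\<^sub>0 'k))
     \<Rightarrow> (('r \<times> 'r \<Rightarrow>\<^sub>0 'k) \<Rightarrow> 'k) \<Rightarrow> ('r \<times> 'r \<times> 'r \<Rightarrow>\<^sub>0 'k) \<Rightarrow> 'k" where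
  "partial2R H R e m \<xi> w t = swK t (\<lambda>r u. swK u (\<lambda>s s'.
     partial2A (smash H R e m \<xi>) (extA H R w)
       ((r \<otimes> oneH H) \<otimes> (s \<otimes> oneH H) \<otimes> (s' \<otimes> oneH H))))"


section \<open>Dual quasi-bialgebras in Yetter-Drinfeld modules and bosonization\<close>

record (overloaded) ('h, 'q, 'k) ydqb = "('h, 'q, 'k) ydcoalg" +
  multQ :: "('q \<times> 'q \<Rightarrow>\<^sub>0 'k) \<Rightarrow> ('q \<Rightarrow>\<^sub>0 'k)"
  oneQ :: "'q \<Rightarrow>\<^sub>0 'k"
  reassQ :: "('q \<times> 'q \<times> 'q \<Rightarrow>\<^sub>0 'k) \<Rightarrow> 'k"

definition dual_quasi_bialgebra_yd :: "('h, 'k::field) hopf \<Rightarrow> ('h, 'q, 'k) ydqb \<Rightarrow> bool" where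
  "dual_quasi_bialgebra_yd H Q \<longleftrightarrow>
     (let m = multQ Q; e = oneQ Q; \<alpha> = reassQ Q; \<epsilon> = counit Q;
          QQ = btens H Q Q; QQQ = btens H Q QQ; QQQQ = btens H Q QQQ in
     yd_coalgebra H Q \<and> coaugmentation H Q e \<and>
     H_linear QQ Q m \<and> H_colinear QQ Q m \<and> coalgebra_hom QQ Q m \<and>
     (\<forall>x. m (e \<otimes> x) = x \<and> m (x \<otimes> e) = x) \<and>
     H_linearK H QQQ \<alpha> \<and> H_colinearK H QQQ \<alpha> \<and>
     conv_invertible (comult QQQ) (counit QQQ) \<alpha> \<and>
     (\<forall>x y. \<alpha> (e \<otimes> x \<otimes> y) = \<epsilon> x * \<epsilon> y \<and> \<alpha> (x \<otimes> e \<otimes> y) = \<epsilon> x * \<epsilon> y \<and>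
            \<alpha> (x \<otimes> y \<otimes> e) = \<epsilon> x * \<epsilon> y) \<and>
     convK (comult QQQQ)
        (\<lambda>t. swK t (\<lambda>x t'. swK t' (\<lambda>y u. \<alpha> (x \<otimes> y \<otimes> m u))))
        (\<lambda>t. swK t (\<lambda>x t'. swK t' (\<lambda>y u. \<alpha> (m (x \<otimes> y) \<otimes> u))))
      = convK (comult QQQQ)
        (\<lambda>t. swK t (\<lambda>x t'. \<epsilon> x * \<alpha> t'))
       (convK (comult QQQQ)
        (\<lambda>t. swK t (\<lambda>x t'. swK t' (\<lambda>y u. swK u (\<lambda>z w. \<alpha> (x \<otimes> m (y \<otimes> z) \<otimes> w)))))
        (\<lambda>t. swK t (\<lambda>x t'. swK t' (\<lambda>y u. swK u (\<lambda>z w. \<alpha> (x \<otimes> y \<otimes> z) * \<epsilon> w))))) \<and>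
     convR (comult QQQ) (\<lambda>t. sw t (\<lambda>x u. m (x \<otimes> m u))) \<alpha>
      = convL (comult QQQ) \<alpha> (\<lambda>t. sw t (\<lambda>x u. sw u (\<lambda>y z. m (m (x \<otimes> y) \<otimes> z)))))"

definition bosonization :: "('h, 'k::field) hopf \<Rightarrow> ('h, 'q, 'k) ydqb \<Rightarrow> ('q \<times> 'h, 'k) dqb" where
  "bosonization H Q =
     \<lparr> multD = (\<lambda>t. sw t (\<lambda>p q. sw p (\<lambda>r h. sw q (\<lambda>s l. sw (DeltaH H h) (\<lambda>h1 h2.
         multQ Q (r \<otimes> act Q (h1 \<otimes> s)) \<otimes> (h2 \<bullet>\<^bsub>H\<^esub> l)))))),
       oneD = oneQ Q \<otimes> oneH H,
       comultD = (\<lambda>p. sw p (\<lambda>r h. sw (comult Q r) (\<lambda>r1 r2. sw (DeltaH H h) (\<lambda>h1 h2.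
         sw (coact Q r2) (\<lambda>a r20. (r1 \<otimes> (a \<bullet>\<^bsub>H\<^esub> h1)) \<otimes> (r20 \<otimes> h2)))))),
       counitD = (\<lambda>p. swK p (\<lambda>r h. counit Q r * epsH H h)),
       reassD = (\<lambda>T. swK T (\<lambda>p u. swK u (\<lambda>q q'. swK p (\<lambda>r h. swK q (\<lambda>s l. swK q' (\<lambda>t k.
         swK (DeltaH H h) (\<lambda>h1 h2.
           reassQ Q (r \<otimes> act Q (h1 \<otimes> s) \<otimes> act Q (h2 \<otimes> act Q (l \<otimes> t))) * epsH H k))))))) \<rparr>"

text \<open>\<open>R\<^sup>v = (R, v * m * v\<^sup>-\<^sup>1, u, \<Delta>, \<epsilon>, \<partial>\<^sup>2\<^sub>R(v))\<close>.\<close>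

definition gauge_twist_yd ::
  "('h, 'k::field) hopf \<Rightarrow> ('h, 'r, 'k) ydcoalg \<Rightarrow> ('r \<Rightarrow>\<^sub>0 'k)
     \<Rightarrow> (('r \<times> 'r \<Rightarrow>\<^sub>0 'k) \<Rightarrow> ('r \<Rightarrow>\<^sub>0 'k)) \<Rightarrow> (('r \<times> 'r \<Rightarrow>\<^sub>0 'k) \<Rightarrow> ('h \<Rightarrow>\<^sub>0 'k))
     \<Rightarrow> (('r \<times> 'r \<Rightarrow>\<^sub>0 'k) \<Rightarrow> 'k) \<Rightarrow> ('h, 'r, 'k) ydqb" where
  "gauge_twist_yd H R e m \<xi> v =
     (let RR = btens H R R in
     \<lparr> act = act R, coact = coact R, comult = comult R, counit = counit R,
       multQ = conv3 (comult RR) v m (conv_inv (comult RR) (counit RR) v),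
       oneQ = e,
       reassQ = partial2R H R e m \<xi> v \<rparr>)"

end

theory Submission imports Defs begin

text \<open>Write g for \<open>lam \<circ> \<xi>\<close>, so that v is the convolution inverse of g.
  Four ideas carry the proof.

  Existence of v. The functional n = \<epsilon> - g vanishes on e \<otimes> R. As the coradical of R
  is K e, the coradical filtration at e exhausts R (\<open>coradical_filtration_exhaustive\<close>),
  and the i-th convolution power of n vanishes on its i-th stage tensored with R. So the geometric
  series in n is finite at every element and inverts g (\<open>geometric_conv_inverse\<close>,
  \<open>conv_inverse_lam_\<xi>\<close>).

  Twisting removes the cocycle. The product of A is (r#h)(s#l) = Mh(r \<otimes> h(s#l)), where Mh(z
  \<otimes> h) = m(z1) \<otimes> \<xi>(z2) h for z in R \<otimes> R. Applying the integral to the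
  coproduct formula of \<xi> gives \<xi>(z1) z2_{-1} g(z2_0) = g(z) 1 (\<open>g_\<xi>\<close>).
  Hence conjugating Mh by v leaves m^v \<otimes> H, with no trace of \<xi>
  (\<open>conv3_RA\<close>), and the product of A^{v_A} is that of the bosonization
  (\<open>mv_tens\<close>).

  Comparison of ordinary and braided convolution. Letting each H-part act on everything to its right
  and applying \<epsilon> to the last one gives maps \<open>Q2\<close>, \<open>Q3\<close>,
  \<open>Q4\<close> from A^n to R^n. They are surjective coalgebra maps from the ordinary to the
  braided tensor power: the coaction that braids factors of R is exactly what the coproduct of A
  puts into its H-leg (\<open>cmap_N\<close>). Pullback along them is therefore an injective
  homomorphism of convolution algebras. One has v_A = v o Q2, and the reassociator of A^{v_A} is aR
  o Q3 with aR = \<partial>_R^2(v) (\<open>\<alpha>_Q3\<close>), which is the reassociator of the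
  bosonization (\<open>twist_eq\<close>).

  Axioms for R^v. For an ordinary bialgebra the axioms of a twist are cancellations in convolution
  algebras (locale \<open>twisted\<close>: \<open>quasi_assoc\<close>, \<open>pentagon\<close>,
  \<open>\<alpha>_unit\<close>). Applied to A, they descend along the Q's to R. H-linearity comes
  from ad-invariance of the integral (\<open>g_act\<close>, \<open>v_act\<close>). Colinearity of
  m^v is read off from the coproduct of A (\<open>mvR_colinear\<close>), that of the reassociator
  from quasi-associativity pushed to H along r#h |-> \<epsilon>(r) h
  (\<open>aR_colinear\<close>).\<close>

section \<open>Multilinear algebra with Sweedler sums\<close>

lemma vector_space_field: "vector_space ((*) :: 'k::field \<Rightarrow> 'k \<Rightarrow> 'k)"
  by unfold_locales (simp_all add: algebra_simps)

lemma linearI: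
  assumes "vector_space s" "\<And>x y. f (x + y) = f x + f y" "\<And>c x. f (scl c x) = s c (f x)"
  shows "Vector_Spaces.linear scl s f"
  using assms vector_space_scl
  by (simp add: Vector_Spaces.linear_def module_hom_def module_hom_axioms_def module_iff_vector_space)

lemma linear_add: "Vector_Spaces.linear s1 s f \<Longrightarrow> f (x + y) = f x + f y"
  by (simp add: Vector_Spaces.linear_def module_hom_def module_hom_axioms_def)

lemma linear_scale: "Vector_Spaces.linear s1 s f \<Longrightarrow> f (s1 c x) = s c (f x)"
  by (simp add: Vector_Spaces.linear_def module_hom_def module_hom_axioms_def)

lemma linear_zero: "Vector_Spaces.linear s1 s f \<Longrightarrow> f 0 = 0"
  using linear_add[of s1 s f 0 0] by simp

lemma linear_sum: "Vector_Spaces.linear s1 s f \<Longrightarrow> f (sum g S) = (\<Sum>i\<in>S. f (g i))"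
  by (induction S rule: infinite_finite_induct) (auto simp: linear_zero linear_add)

context
  fixes s :: "'k::field \<Rightarrow> 'v::ab_group_add \<Rightarrow> 'v"
  assumes s: "vector_space s"
begin

interpretation vector_space s by (rule s)

lemma tens_lift_superset:
  assumes "finite S" "Poly_Mapping.keys t \<subseteq> S"
  shows "tens_lift s t F = (\<Sum>(a, b)\<in>S. s (Poly_Mapping.lookup t (a, b)) (F (Poly_Mapping.single a 1) (Poly_Mapping.single b 1)))"
  unfolding tens_lift_def
  by (rule sum.mono_neutral_left) (use assms in \<open>auto simp: in_keys_iff\<close>)

lemma linear_tens_lift: "Vector_Spaces.linear scl s (\<lambda>t. tens_lift s t F)"
proof (rule linearI[OF s])
  fix t u :: "'a \<times> 'b \<Rightarrow>\<^sub>0 'k" and c :: 'k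
  let ?S = "Poly_Mapping.keys t \<union> Poly_Mapping.keys u"
  show "tens_lift s (t + u) F = tens_lift s t F + tens_lift s u F"
    using Poly_Mapping.keys_add[of t u]
    by (simp add: tens_lift_superset[of ?S] lookup_add scale_left_distrib sum.distrib split_def)
  have "Poly_Mapping.keys (scl c t) \<subseteq> Poly_Mapping.keys t"
    by (auto simp: in_keys_iff lookup_scl)
  then show "tens_lift s (scl c t) F = s c (tens_lift s t F)"
    by (simp add: tens_lift_superset[of "Poly_Mapping.keys t"] lookup_scl scale_sum_right split_def)
qed

lemma linear_tens_lift1: "lin f \<Longrightarrow> Vector_Spaces.linear scl s (\<lambda>x. tens_lift s (f x) F)"
  using Vector_Spaces.linear_compose[OF _ linear_tens_lift, of scl f F] by (simp add: o_def)

lemma linear_tens_lift2: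
  assumes "\<And>a b. Vector_Spaces.linear scl s (\<lambda>x. F x a b)"
  shows "Vector_Spaces.linear scl s (\<lambda>x. tens_lift s t (\<lambda>a b. F x a b))"
  by (rule linearI[OF s])
    (simp_all add: tens_lift_def linear_add[OF assms] linear_scale[OF assms] scale_right_distrib
      sum.distrib split_def scale_sum_right mult.commute)

text \<open>Fubini for two independent Sweedler sums; the reordering rules below are instances of
  it.\<close>

lemma tens_lift_swap:
  "tens_lift s t (\<lambda>a b. tens_lift s u (\<lambda>c d. F a b c d)) = tens_lift s u (\<lambda>c d. tens_lift s t (\<lambda>a b. F a b c d))"
  unfolding tens_lift_def split_def scale_sum_right
  by (subst sum.swap) (simp add: mult.commute)

end

lemma tens_lift_hom:
  assumes "Vector_Spaces.linear s s' f"
  shows "f (tens_lift s t F) = tens_lift s' t (\<lambda>a b. f (F a b))"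
  by (simp add: tens_lift_def linear_sum[OF assms] linear_scale[OF assms] split_def)

lemma tens_lift_tens_lift:
  "vector_space s \<Longrightarrow> tens_lift s (sw t F) G = tens_lift s t (\<lambda>a b. tens_lift s (F a b) G)"
  by (rule tens_lift_hom[OF linear_tens_lift])

lemma single_sum: "(x::'a \<Rightarrow>\<^sub>0 'k::field) = (\<Sum>a\<in>Poly_Mapping.keys x. scl (Poly_Mapping.lookup x a) (Poly_Mapping.single a 1))"
  by (rule poly_mapping_eqI)
      (auto simp: lookup_sum lookup_scl lookup_single when_def if_distrib not_in_keys_iff_lookup_eq_zero cong: if_cong)

lemma single_tens: "Poly_Mapping.single a 1 \<otimes> Poly_Mapping.single b 1 = Poly_Mapping.single (a, b) (1::'k::field)"
  by (simp add: tens_def)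

lemma sw_tens: "sw t (\<lambda>x y. x \<otimes> y) = t" "sw t (\<otimes>) = t"
  using single_sum[of t] by (simp_all add: tens_lift_def single_tens split_def)

lemma lookup_tens: "Poly_Mapping.lookup (x \<otimes> y) (a, b) = Poly_Mapping.lookup x a * Poly_Mapping.lookup y b"
  for x :: "'a \<Rightarrow>\<^sub>0 'k::field" and y :: "'b \<Rightarrow>\<^sub>0 'k"
proof -
    have "Poly_Mapping.lookup (x \<otimes> y) (a, b)
        = (\<Sum>a'\<in>Poly_Mapping.keys x. \<Sum>b'\<in>Poly_Mapping.keys y. if a' = a then if b' = b then Poly_Mapping.lookup x a' * Poly_Mapping.lookup y b' else 0 else 0)"
      unfolding tens_def lookup_sum lookup_single when_def by (intro sum.cong refl) auto
    also have "\<dots> = (\<Sum>a'\<in>Poly_Mapping.keys x. if a' = a then \<Sum>b'\<in>Poly_Mapping.keys y. if b' = b then Poly_Mapping.lookup x a' * Poly_Mapping.lookup y b' else 0 else 0)"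
      by (intro sum.cong refl) auto
    also have "\<dots> = Poly_Mapping.lookup x a * Poly_Mapping.lookup y b"
      by (simp add: not_in_keys_iff_lookup_eq_zero)
    finally show ?thesis .
qed

lemma lin_tens1: "lin f \<Longrightarrow> lin (\<lambda>x. f x \<otimes> y)"
  by (rule linearI[OF vector_space_scl]; rule poly_mapping_eqI)
    (auto simp: lookup_tens lookup_add lookup_scl linear_add linear_scale algebra_simps)

lemma lin_tens2: "lin f \<Longrightarrow> lin (\<lambda>x. y \<otimes> f x)"
  by (rule linearI[OF vector_space_scl]; rule poly_mapping_eqI)
    (auto simp: lookup_tens lookup_add lookup_scl linear_add linear_scale algebra_simps)

lemma linear_ident: "lin (\<lambda>x. x)" by (rule linearI[OF vector_space_scl]) auto

lemma lin_tens2': "lin ((\<otimes>) y)" by (rule lin_tens2[OF linear_ident])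

lemma lin_scl1: "linK f \<Longrightarrow> lin (\<lambda>x. scl (f x) y)"
  by (rule linearI[OF vector_space_scl]; rule poly_mapping_eqI)
    (auto simp: lookup_add lookup_scl linear_add linear_scale algebra_simps)

lemma lin_scl2: "lin f \<Longrightarrow> lin (\<lambda>x. scl c (f x))"
  by (rule linearI[OF vector_space_scl]; rule poly_mapping_eqI)
    (auto simp: lookup_add lookup_scl linear_add linear_scale algebra_simps)

lemma lin_scl2': "lin (scl c)" by (rule lin_scl2[OF linear_ident])

lemma linK_mult1: "linK f \<Longrightarrow> linK (\<lambda>x. f x * c)"
  by (rule linearI[OF vector_space_field]) (auto simp: linear_add linear_scale algebra_simps)

lemma linK_mult2: "linK f \<Longrightarrow> linK (\<lambda>x. c * f x)"
  by (rule linearI[OF vector_space_field]) (auto simp: linear_add linear_scale algebra_simps)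

lemma linear_comp: "Vector_Spaces.linear scl s g \<Longrightarrow> lin f \<Longrightarrow> Vector_Spaces.linear scl s (\<lambda>x. g (f x))"
  using Vector_Spaces.linear_compose[of scl scl f s g] by (simp add: o_def)

lemma linear_o: "Vector_Spaces.linear scl s g \<Longrightarrow> lin f \<Longrightarrow> Vector_Spaces.linear scl s (g o f)"
  using Vector_Spaces.linear_compose[of scl scl f s g] by (simp add: o_def)

lemma lin_sw: "lin (\<lambda>t. sw t F)" by (rule linear_tens_lift[OF vector_space_scl])
lemma linK_swK: "linK (\<lambda>t. swK t F)" by (rule linear_tens_lift[OF vector_space_field])

lemma linear_mult1: "Vector_Spaces.linear (*) (*) (\<lambda>x. x * (y::'k::field))"
  using vector_space_field by (simp add: Vector_Spaces.linear_def module_hom_def module_hom_axioms_def module_iff_vector_space algebra_simps)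
lemma linear_mult2: "Vector_Spaces.linear (*) (*) (\<lambda>x. (y::'k::field) * x)"
  using vector_space_field by (simp add: Vector_Spaces.linear_def module_hom_def module_hom_axioms_def module_iff_vector_space algebra_simps)
lemma linear_scl_left: "Vector_Spaces.linear (*) scl (\<lambda>x. scl x y)"
  using vector_space_field vector_space_scl by (auto simp add: Vector_Spaces.linear_def module_hom_def module_hom_axioms_def module_iff_vector_space
    intro!: poly_mapping_eqI simp: lookup_scl lookup_add algebra_simps)

lemma tens_sw1: "sw t F \<otimes> y = sw t (\<lambda>a b. F a b \<otimes> y)"
  by (rule tens_lift_hom[OF lin_tens1[OF linear_ident]])
lemma tens_sw2: "y \<otimes> sw t F = sw t (\<lambda>a b. y \<otimes> F a b)"
  by (rule tens_lift_hom[OF lin_tens2[OF linear_ident]])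
lemma scl_sw2: "scl c (sw t F) = sw t (\<lambda>a b. scl c (F a b))"
  by (rule tens_lift_hom[OF lin_scl2[OF linear_ident]])
lemma scl_swK: "scl (swK t F) y = sw t (\<lambda>a b. scl (F a b) y)"
  by (rule tens_lift_hom[OF linear_scl_left])
lemma mult_swK1: "swK t F * (y::'k::field) = swK t (\<lambda>a b. F a b * y)"
  by (rule tens_lift_hom[OF linear_mult1])
lemma mult_swK2: "(y::'k::field) * swK t F = swK t (\<lambda>a b. y * F a b)"
  by (rule tens_lift_hom[OF linear_mult2])

lemma scl_scl: "scl a (scl b x) = scl (a * b) x"
  by (rule poly_mapping_eqI) (simp add: lookup_scl)
lemma scl_one: "scl 1 x = x"
  by (rule poly_mapping_eqI) (simp add: lookup_scl)
lemma tens_scl1: "scl c x \<otimes> y = scl c (x \<otimes> y)"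
  by (rule linear_scale[OF lin_tens1[OF linear_ident]])
lemma tens_scl2: "x \<otimes> scl c y = scl c (x \<otimes> y)"
  by (rule linear_scale[OF lin_tens2[OF linear_ident]])
lemma sw_scl: "sw (scl c t) F = scl c (sw t F)"
  by (rule linear_scale[OF lin_sw])
lemma swK_scl: "swK (scl c t) F = c * swK t F"
  by (rule linear_scale[OF linK_swK])

lemma tens_lift_scl_out:
  assumes "vector_space s" shows "tens_lift s t (\<lambda>a b. s c (F a b)) = s c (tens_lift s t F)"
proof -
  interpret vector_space s by fact
  show ?thesis by (simp add: tens_lift_def split_def scale_sum_right mult.commute)
qed

lemma lin_ext_tens:
  assumes "Vector_Spaces.linear scl s f" "Vector_Spaces.linear scl s g" "\<And>x y. f (x \<otimes> y) = g (x \<otimes> y)"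
  shows "f t = g t"
proof -
  have "f t = f (sw t (\<lambda>x y. x \<otimes> y))" by (simp add: sw_tens)
  also have "\<dots> = g (sw t (\<lambda>x y. x \<otimes> y))"
    by (simp only: tens_lift_hom[OF assms(1)] tens_lift_hom[OF assms(2)] assms(3))
  finally show ?thesis by (simp add: sw_tens)
qed

section \<open>Automation for linearity, and the coalgebra axioms in Sweedler form\<close>

named_theorems lins

lemmas [lins] = vector_space_field vector_space_scl linear_ident lin_tens1 lin_tens2 lin_tens2' lin_scl1 lin_scl2 lin_scl2'
  linK_mult1 linK_mult2 linear_tens_lift1 linear_tens_lift2 linear_tens_lift

text \<open>Apply the linear map induced by the trilinear \<open>F\<close> to both sides of
  coassociativity. In this form the axiom rewrites arbitrary expressions in three legs, always
  splitting the last leg.\<close>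

lemma coalg_coassoc:
  assumes "coalgebra \<Delta> \<epsilon>" and s: "vector_space s"
    and l: "\<And>b c. Vector_Spaces.linear scl s (\<lambda>a. F a b c)"
      "\<And>a c. Vector_Spaces.linear scl s (\<lambda>b. F a b c)"
      "\<And>a b. Vector_Spaces.linear scl s (\<lambda>c. F a b c)"
  shows "tens_lift s (\<Delta> x) (\<lambda>x1 x2. tens_lift s (\<Delta> x1) (\<lambda>a b. F a b x2))
       = tens_lift s (\<Delta> x) (\<lambda>x1 x2. tens_lift s (\<Delta> x2) (\<lambda>a b. F x1 a b))"
proof -
  let ?T = "\<lambda>t. tens_lift s t (\<lambda>p q. tens_lift s q (\<lambda>b c. F p b c))"
  have T: "?T (a \<otimes> b \<otimes> c) = F a b c" for a b c
    by (simp add: tens_lift_tens lins s l)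
  have eq: "sw (\<Delta> x) (\<lambda>x1 x2. sw (\<Delta> x1) (\<lambda>x11 x12. x11 \<otimes> x12 \<otimes> x2))
        = sw (\<Delta> x) (\<lambda>x1 x2. sw (\<Delta> x2) (\<lambda>x21 x22. x1 \<otimes> x21 \<otimes> x22))"
    using assms(1) by (simp add: coalgebra_def)
  from arg_cong[OF eq, of ?T] show ?thesis
    by (simp only: tens_lift_tens_lift[OF s] T)
qed

lemma coalg_counit1:
  assumes "coalgebra \<Delta> \<epsilon>" and l: "Vector_Spaces.linear scl s F"
  shows "tens_lift s (\<Delta> x) (\<lambda>x1 x2. s (\<epsilon> x1) (F x2)) = F x"
proof -
  have "F x = F (sw (\<Delta> x) (\<lambda>x1 x2. scl (\<epsilon> x1) x2))"
    using assms(1) by (simp add: coalgebra_def)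
  also have "\<dots> = tens_lift s (\<Delta> x) (\<lambda>x1 x2. s (\<epsilon> x1) (F x2))"
    by (simp add: tens_lift_hom[OF l] linear_scale[OF l])
  finally show ?thesis ..
qed

lemma coalg_counit2:
  assumes "coalgebra \<Delta> \<epsilon>" and l: "Vector_Spaces.linear scl s F"
  shows "tens_lift s (\<Delta> x) (\<lambda>x1 x2. s (\<epsilon> x2) (F x1)) = F x"
proof -
  have "F x = F (sw (\<Delta> x) (\<lambda>x1 x2. scl (\<epsilon> x2) x1))"
    using assms(1) by (simp add: coalgebra_def)
  also have "\<dots> = tens_lift s (\<Delta> x) (\<lambda>x1 x2. s (\<epsilon> x2) (F x1))"
    by (simp add: tens_lift_hom[OF l] linear_scale[OF l])
  finally show ?thesis ..
qed

text \<open>These rules bring nested Sweedler sums into a common order: the splitting of one leg of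
  a coproduct is moved in front of splittings that depend only on the other leg. They are used with
  the structure maps instantiated, which gives each rewriting a direction.\<close>

lemma move_fst1:
  assumes "vector_space s"
  shows "tens_lift s (f x) (\<lambda>p q. tens_lift s (u0 q) (\<lambda>c0 d0. tens_lift s (g p) (\<lambda>a b. F q c0 d0 a b)))
   = tens_lift s (f x) (\<lambda>p q. tens_lift s (g p) (\<lambda>a b. tens_lift s (u0 q) (\<lambda>c0 d0. F q c0 d0 a b)))"
  by (simp only: tens_lift_swap[OF assms, of _ "g p" for p])
lemma move_fst2:
  assumes "vector_space s"
  shows "tens_lift s (f x) (\<lambda>p q. tens_lift s (u0 q) (\<lambda>c0 d0. tens_lift s (u1 q c0 d0) (\<lambda>c1 d1. tens_lift s (g p) (\<lambda>a b. F q c0 d0 c1 d1 a b))))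
   = tens_lift s (f x) (\<lambda>p q. tens_lift s (g p) (\<lambda>a b. tens_lift s (u0 q) (\<lambda>c0 d0. tens_lift s (u1 q c0 d0) (\<lambda>c1 d1. F q c0 d0 c1 d1 a b))))"
  by (simp only: tens_lift_swap[OF assms, of _ "g p" for p])
lemma move_snd2:
  assumes "vector_space s"
  shows "tens_lift s (f x) (\<lambda>p q. tens_lift s (u0 p) (\<lambda>c0 d0. tens_lift s (u1 p c0 d0) (\<lambda>c1 d1. tens_lift s (g q) (\<lambda>a b. F p c0 d0 c1 d1 a b))))
   = tens_lift s (f x) (\<lambda>p q. tens_lift s (g q) (\<lambda>a b. tens_lift s (u0 p) (\<lambda>c0 d0. tens_lift s (u1 p c0 d0) (\<lambda>c1 d1. F p c0 d0 c1 d1 a b))))"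
  by (simp only: tens_lift_swap[OF assms, of _ "g q" for q])
lemma move_snd3:
  assumes "vector_space s"
  shows "tens_lift s (f x) (\<lambda>p q. tens_lift s (u0 p) (\<lambda>c0 d0. tens_lift s (u1 p c0 d0) (\<lambda>c1 d1. tens_lift s (u2 p c0 d0 c1 d1) (\<lambda>c2 d2. tens_lift s (g q) (\<lambda>a b. F p c0 d0 c1 d1 c2 d2 a b)))))
   = tens_lift s (f x) (\<lambda>p q. tens_lift s (g q) (\<lambda>a b. tens_lift s (u0 p) (\<lambda>c0 d0. tens_lift s (u1 p c0 d0) (\<lambda>c1 d1. tens_lift s (u2 p c0 d0 c1 d1) (\<lambda>c2 d2. F p c0 d0 c1 d1 c2 d2 a b)))))"
  by (simp only: tens_lift_swap[OF assms, of _ "g q" for q])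

section \<open>Coalgebras, coalgebra maps and convolution algebras\<close>

type_synonym ('c, 'k) coalg = "(('c \<Rightarrow>\<^sub>0 'k) \<Rightarrow> ('c \<times> 'c \<Rightarrow>\<^sub>0 'k)) \<times> (('c \<Rightarrow>\<^sub>0 'k) \<Rightarrow> 'k)"

definition cog :: "('c, 'k::field) coalg \<Rightarrow> bool" where "cog X \<longleftrightarrow> coalgebra (fst X) (snd X)"

definition tco :: "('c, 'k::field) coalg \<Rightarrow> ('d, 'k) coalg \<Rightarrow> ('c \<times> 'd, 'k) coalg" where
  "tco X Y = (tcomult (fst X) (fst Y), \<lambda>t. swK t (\<lambda>x y. snd X x * snd Y y))"

definition cmap :: "('c, 'k::field) coalg \<Rightarrow> ('d, 'k) coalg \<Rightarrow> (('c \<Rightarrow>\<^sub>0 'k) \<Rightarrow> ('d \<Rightarrow>\<^sub>0 'k)) \<Rightarrow> bool" where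
  "cmap X Y F \<longleftrightarrow> lin F \<and> (\<forall>x. fst Y (F x) = sw (fst X x) (\<lambda>x1 x2. F x1 \<otimes> F x2)) \<and> (\<forall>x. snd Y (F x) = snd X x)"

definition tm :: "(('a \<Rightarrow>\<^sub>0 'k::field) \<Rightarrow> ('c \<Rightarrow>\<^sub>0 'k)) \<Rightarrow> (('b \<Rightarrow>\<^sub>0 'k) \<Rightarrow> ('d \<Rightarrow>\<^sub>0 'k)) \<Rightarrow> ('a \<times> 'b \<Rightarrow>\<^sub>0 'k) \<Rightarrow> ('c \<times> 'd \<Rightarrow>\<^sub>0 'k)" where
  "tm F G t = sw t (\<lambda>x y. F x \<otimes> G y)"

definition epsL :: "(('a \<Rightarrow>\<^sub>0 'k::field) \<Rightarrow> 'k) \<Rightarrow> ('a \<times> 'b \<Rightarrow>\<^sub>0 'k) \<Rightarrow> ('b \<Rightarrow>\<^sub>0 'k)" where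
  "epsL e t = sw t (\<lambda>x y. scl (e x) y)"
definition epsR :: "(('b \<Rightarrow>\<^sub>0 'k::field) \<Rightarrow> 'k) \<Rightarrow> ('a \<times> 'b \<Rightarrow>\<^sub>0 'k) \<Rightarrow> ('a \<Rightarrow>\<^sub>0 'k)" where
  "epsR e t = sw t (\<lambda>x y. scl (e y) x)"
definition asc :: "('a \<times> 'b \<times> 'c \<Rightarrow>\<^sub>0 'k::field) \<Rightarrow> (('a \<times> 'b) \<times> 'c \<Rightarrow>\<^sub>0 'k)" where
  "asc t = sw t (\<lambda>x u. sw u (\<lambda>y z. (x \<otimes> y) \<otimes> z))"

abbreviation cnv :: "('c, 'k::field) coalg \<Rightarrow> (('c \<Rightarrow>\<^sub>0 'k) \<Rightarrow> 'k) \<Rightarrow> (('c \<Rightarrow>\<^sub>0 'k) \<Rightarrow> 'k) \<Rightarrow> ('c \<Rightarrow>\<^sub>0 'k) \<Rightarrow> 'k" where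
  "cnv X \<equiv> convK (fst X)"

lemma cogD: "cog X \<Longrightarrow> lin (fst X)" "cog X \<Longrightarrow> linK (snd X)" "cog X \<Longrightarrow> coalgebra (fst X) (snd X)"
  by (simp_all add: cog_def coalgebra_def)

lemma cmapD: "cmap X Y F \<Longrightarrow> lin F" "cmap X Y F \<Longrightarrow> fst Y (F x) = sw (fst X x) (\<lambda>x1 x2. F x1 \<otimes> F x2)" "cmap X Y F \<Longrightarrow> snd Y (F x) = snd X x"
  by (simp_all add: cmap_def)

lemma cogD': "cog X \<Longrightarrow> lin f \<Longrightarrow> lin (\<lambda>x. fst X (f x))" "cog X \<Longrightarrow> lin f \<Longrightarrow> linK (\<lambda>x. snd X (f x))"
  by (simp_all add: linear_comp cogD)
lemma cmapD': "cmap X Y F \<Longrightarrow> lin f \<Longrightarrow> lin (\<lambda>x. F (f x))"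
  by (simp add: cmapD linear_comp)

lemmas lift_out = tens_lift_scl_out[where s=scl, OF vector_space_scl] tens_lift_scl_out[where s="(*)", OF vector_space_field]
lemmas coalg_counits = coalg_counit1[where s=scl] coalg_counit1[where s="(*)"] coalg_counit2[where s=scl] coalg_counit2[where s="(*)"]
lemmas cog_counits = coalg_counits[OF cogD(3)]
lemmas cog_coassoc = coalg_coassoc[OF cogD(3)]

lemmas pushs = tens_sw1 tens_sw2 scl_sw2 scl_swK mult_swK1 mult_swK2 scl_scl[symmetric] scl_one tens_scl1 tens_scl2 sw_scl swK_scl
  tens_lift_tens_lift tens_lift_tens sw_tens

lemma lin_tm: "lin (tm F G)" unfolding tm_def by (simp add: lins)
lemma lin_epsL: "lin (epsL e)" unfolding epsL_def by (simp add: lins)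
lemma lin_epsR: "lin (epsR e)" unfolding epsR_def by (simp add: lins)
lemma lin_asc: "lin asc" unfolding asc_def by (simp add: lins)
lemmas lin_tms = lin_tm lin_epsL lin_epsR lin_asc lin_tm[THEN linear_comp] lin_epsL[THEN linear_comp] lin_epsR[THEN linear_comp] lin_asc[THEN linear_comp]
lemmas [lins] = lin_tms

lemma tm_tens: "lin F \<Longrightarrow> lin G \<Longrightarrow> tm F G (x \<otimes> y) = F x \<otimes> G y"
  unfolding tm_def by (simp add: tens_lift_tens lins lin_tens1 lin_tens2)
lemma epsL_tens: "linK e \<Longrightarrow> epsL e (x \<otimes> y) = scl (e x) y"
  unfolding epsL_def by (simp add: tens_lift_tens lins)
lemma epsR_tens: "linK e \<Longrightarrow> epsR e (x \<otimes> y) = scl (e y) x"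
  unfolding epsR_def by (simp add: tens_lift_tens lins)
lemma asc_tens: "asc (x \<otimes> y \<otimes> z) = (x \<otimes> y) \<otimes> z"
  unfolding asc_def by (simp add: tens_lift_tens lins)

lemma lin_tcomult: "lin (tcomult D E)" unfolding tcomult_def by (simp add: lins)
lemma lin_tco: "lin (fst (tco X Y))" "linK (snd (tco X Y))" by (simp_all add: tco_def lin_tcomult lins)
lemmas [lins] = lin_tco lin_tco[THEN linear_comp]

lemma tco_tens1:
  "lin (fst X) \<Longrightarrow> lin (fst Y) \<Longrightarrow> fst (tco X Y) (x \<otimes> y) = sw (fst X x) (\<lambda>x1 x2. sw (fst Y y) (\<lambda>y1 y2. (x1 \<otimes> y1) \<otimes> (x2 \<otimes> y2)))"
  by (simp add: tco_def tcomult_def tens_lift_tens lins)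
lemma tco_tens2:
  "linK (snd X) \<Longrightarrow> linK (snd Y) \<Longrightarrow> snd (tco X Y) (x \<otimes> y) = snd X x * snd Y y"
  by (simp add: tco_def tens_lift_tens lins)

lemmas ord_fst = tens_lift_swap[where u="fst Y u" and t="fst X t" for X Y t u]
lemmas mv_fst = move_fst1[where f="fst X" and g="fst X" and ?u0.0="\<lambda>q. fst X (w q)" for X w]
  move_fst2[where f="fst X" and g="fst X" and ?u0.0="\<lambda>q. fst X (w q)" and ?u1.0="\<lambda>q c d. fst X (w1 q c d)" for X w w1]

lemma cog_tco:
  assumes X: "cog X" and Y: "cog Y"
  shows "cog (tco X Y)"
proof -
  note l = cogD[OF X] cogD[OF Y] cogD'[OF X] cogD'[OF Y]
  have h: "fst (tco X Y) (sw t F) = sw t (\<lambda>a b. fst (tco X Y) (F a b))" for t :: "'t \<times> 'u \<Rightarrow>\<^sub>0 'b" and F by (rule tens_lift_hom) (simp add: lins)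
  have h2: "snd (tco X Y) (sw t F) = swK t (\<lambda>a b. snd (tco X Y) (F a b))" for t :: "'t \<times> 'u \<Rightarrow>\<^sub>0 'b" and F by (rule tens_lift_hom) (simp add: lins)
  let ?D = "fst (tco X Y)" and ?e = "snd (tco X Y)"
  show ?thesis unfolding coalgebra_def cog_def
  proof (intro conjI allI)
    fix t
    show "sw (?D t) (\<lambda>x1 x2. sw (?D x1) (\<lambda>x11 x12. x11 \<otimes> x12 \<otimes> x2))
        = sw (?D t) (\<lambda>x1 x2. sw (?D x2) (\<lambda>x21 x22. x1 \<otimes> x21 \<otimes> x22))"
      by (rule lin_ext_tens[where t=t and s=scl]) (simp_all add: lins l pushs tco_tens1 cog_coassoc[OF X] cog_coassoc[OF Y] ord_fst[where Y=Y and X=X] mv_fst)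
    show "sw (?D t) (\<lambda>x1 x2. scl (?e x1) x2) = t"
      apply (rule lin_ext_tens[where t=t and s=scl], simp add: lins l, simp add: lins l)
      apply (simp add: lins l pushs tco_tens1 tco_tens2 ord_fst[where Y=Y and X=X])
      by (simp add: lins l lift_out cog_counits[OF X] cog_counits[OF Y])
    show "sw (?D t) (\<lambda>x1 x2. scl (?e x2) x1) = t"
      apply (rule lin_ext_tens[where t=t and s=scl], simp add: lins l, simp add: lins l)
      apply (simp add: lins l pushs tco_tens1 tco_tens2 ord_fst[where Y=Y and X=X])
      by (simp add: lins l lift_out cog_counits[OF X] cog_counits[OF Y])
  qed (auto simp: lins)
qed

lemma linK_cnv: "cog X \<Longrightarrow> linK (cnv X f g)"
  unfolding convK_def[abs_def] by (simp add: lins cogD)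

lemma cnv_assoc:
  assumes X: "cog X" and f: "linK f" and g: "linK g" and h: "linK h"
  shows "cnv X (cnv X f g) h = cnv X f (cnv X g h)"
proof
  note l = f g h f[THEN linear_comp] g[THEN linear_comp] h[THEN linear_comp] cogD[OF X] cogD'[OF X]
  show "cnv X (cnv X f g) h x = cnv X f (cnv X g h) x" for x
    unfolding convK_def by (simp add: pushs) (simp add: lins l cog_coassoc[OF X] mult.assoc)
qed

lemma cnv_unitL:
  assumes X: "cog X" and f: "linK f"
  shows "cnv X (snd X) f = f"
  unfolding convK_def by (rule ext) (simp add: cog_counits[OF X] f)

lemma cnv_unitR:
  assumes X: "cog X" and f: "linK f"
  shows "cnv X f (snd X) = f"
  unfolding convK_def by (rule ext) (simp add: cog_counits[OF X] f mult.commute[of "f _"])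

text \<open>Pulling back along a coalgebra map is a homomorphism of convolution algebras. Nearly
  every later identity is proved in one convolution algebra and transported by this.\<close>

lemma cnv_pull:
  assumes F: "cmap X Y F" and f: "linK f" and g: "linK g"
  shows "cnv Y f g \<circ> F = cnv X (f \<circ> F) (g \<circ> F)"
  using F by (auto simp: fun_eq_iff convK_def cmapD pushs lins f g linear_comp)

lemma cmap_comp: "cmap X Y F \<Longrightarrow> cmap Y Z G \<Longrightarrow> cmap X Z (G \<circ> F)"
proof -
  assume F: "cmap X Y F" and G: "cmap Y Z G"
  note l = cmapD(1)[OF F] cmapD(1)[OF G] cmapD'[OF F] cmapD'[OF G]
  show ?thesis unfolding cmap_def
    by (auto simp: cmapD(2)[OF F] cmapD(2)[OF G] cmapD(3)[OF F] cmapD(3)[OF G] pushs l lins linear_o)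
qed

lemma cmap_id: "cog X \<Longrightarrow> cmap X X id" "cog X \<Longrightarrow> cmap X X (\<lambda>x. x)"
  by (auto simp: cmap_def sw_tens lins id_def)

lemma cmap_tm:
  assumes F: "cmap X X' F" and G: "cmap Y Y' G" and c: "cog X" "cog Y" "cog X'" "cog Y'"
  shows "cmap (tco X Y) (tco X' Y') (tm F G)"
proof -
  note l = cmapD(1)[OF F] cmapD(1)[OF G] cmapD'[OF F] cmapD'[OF G] cogD[OF c(1)] cogD[OF c(2)] cogD[OF c(3)] cogD[OF c(4)]
  show ?thesis unfolding cmap_def
  proof (intro conjI allI)
    show "fst (tco X' Y') (tm F G t) = sw (fst (tco X Y) t) (\<lambda>x1 x2. tm F G x1 \<otimes> tm F G x2)" for t
      by (rule lin_ext_tens[where t=t and s=scl]) (simp_all add: lins l pushs tm_tens tco_tens1 cmapD(2)[OF F] cmapD(2)[OF G])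
    show "snd (tco X' Y') (tm F G t) = snd (tco X Y) t" for t
      by (rule lin_ext_tens[where t=t and s="(*)"]) (simp_all add: lins l pushs tm_tens tco_tens2 cmapD(3)[OF F] cmapD(3)[OF G])
  qed (simp add: lins)
qed

lemma cmap_epsL:
  assumes c: "cog X" "cog Y"
  shows "cmap (tco X Y) Y (epsL (snd X))"
proof -
  note l = cogD[OF c(1)] cogD[OF c(2)] cogD'[OF c(1)] cogD'[OF c(2)]
  show ?thesis unfolding cmap_def
  proof (intro conjI allI)
    show "fst Y (epsL (snd X) t) = sw (fst (tco X Y) t) (\<lambda>x1 x2. epsL (snd X) x1 \<otimes> epsL (snd X) x2)" for t
      apply (rule lin_ext_tens[where t=t and s=scl], simp add: lins l, simp add: lins l)
      apply (simp add: lins l pushs epsL_tens tco_tens1 linear_scale[OF cogD(1)[OF c(2)]] ord_fst[where X=X and Y=Y])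
      apply (simp add: lins l lift_out cog_counits[OF c(1)] sw_tens)
      done
    show "snd Y (epsL (snd X) t) = snd (tco X Y) t" for t
      by (rule lin_ext_tens[where t=t and s="(*)"]) (simp_all add: lins l pushs epsL_tens tco_tens2 linear_scale[OF cogD(2)[OF c(2)]])
  qed (simp add: lins)
qed

lemma cmap_epsR:
  assumes c: "cog X" "cog Y"
  shows "cmap (tco X Y) X (epsR (snd Y))"
proof -
  note l = cogD[OF c(1)] cogD[OF c(2)] cogD'[OF c(1)] cogD'[OF c(2)]
  show ?thesis unfolding cmap_def
  proof (intro conjI allI)
    show "fst X (epsR (snd Y) t) = sw (fst (tco X Y) t) (\<lambda>x1 x2. epsR (snd Y) x1 \<otimes> epsR (snd Y) x2)" for t
      apply (rule lin_ext_tens[where t=t and s=scl], simp add: lins l, simp add: lins l)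
      apply (simp add: lins l pushs epsR_tens tco_tens1 linear_scale[OF cogD(1)[OF c(1)]])
      apply (simp add: lins l lift_out cog_counits[OF c(2)] sw_tens)
      done
    show "snd X (epsR (snd Y) t) = snd (tco X Y) t" for t
      by (rule lin_ext_tens[where t=t and s="(*)"]) (simp_all add: lins l pushs epsR_tens tco_tens2 linear_scale[OF cogD(2)[OF c(1)]])
  qed (simp add: lins)
qed

lemma ext3:
  assumes "Vector_Spaces.linear scl s f" "Vector_Spaces.linear scl s g" "\<And>x y z. f (x \<otimes> y \<otimes> z) = g (x \<otimes> y \<otimes> z)"
  shows "f t = g t"
proof (rule lin_ext_tens[OF assms(1,2)])
  fix x u
  show "f (x \<otimes> u) = g (x \<otimes> u)"
    by (rule lin_ext_tens[where s=s and t=u]) (simp_all add: assms(3) linear_comp[OF assms(1)] linear_comp[OF assms(2)] lins)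
qed

lemma ext4:
  assumes "Vector_Spaces.linear scl s f" "Vector_Spaces.linear scl s g" "\<And>x y z w. f (x \<otimes> y \<otimes> z \<otimes> w) = g (x \<otimes> y \<otimes> z \<otimes> w)"
  shows "f t = g t"
proof (rule ext3[OF assms(1,2)])
  fix x y u
  show "f (x \<otimes> y \<otimes> u) = g (x \<otimes> y \<otimes> u)"
    by (rule lin_ext_tens[where s=s and t=u]) (simp_all add: assms(3) linear_comp[OF assms(1)] linear_comp[OF assms(2)] lins)
qed

lemma cmap_asc:
  assumes c: "cog X" "cog Y" "cog Z"
  shows "cmap (tco X (tco Y Z)) (tco (tco X Y) Z) asc"
proof -
  note l = cogD[OF c(1)] cogD[OF c(2)] cogD[OF c(3)] cog_tco[OF c(1,2)]
  show ?thesis unfolding cmap_def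
  proof (intro conjI allI)
    show "fst (tco (tco X Y) Z) (asc t) = sw (fst (tco X (tco Y Z)) t) (\<lambda>x1 x2. asc x1 \<otimes> asc x2)" for t
      by (rule ext3[where t=t and s=scl]) (simp_all add: lins l pushs asc_tens tco_tens1)
    show "snd (tco (tco X Y) Z) (asc t) = snd (tco X (tco Y Z)) t" for t
      by (rule ext3[where t=t and s="(*)"]) (simp_all add: lins l pushs asc_tens tco_tens2)
  qed (simp add: lins)
qed

lemma cmap_unitL:
  assumes c: "cog X" "cog Y" and e: "fst X e = e \<otimes> e" "snd X e = 1"
  shows "cmap Y (tco X Y) (\<lambda>y. e \<otimes> y)"
  unfolding cmap_def using e cogD[OF c(1)] cogD[OF c(2)]
  by (simp add: lins tco_tens1 tco_tens2 pushs)

lemma cmap_unitR: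
  assumes c: "cog X" "cog Y" and e: "fst X e = e \<otimes> e" "snd X e = 1"
  shows "cmap Y (tco Y X) (\<lambda>y. y \<otimes> e)"
  unfolding cmap_def using e cogD[OF c(1)] cogD[OF c(2)]
  by (simp add: lins tco_tens1 tco_tens2 pushs)

lemma lin_conv3: "lin (fst X) \<Longrightarrow> lin (conv3 (fst X) v F g)"
  unfolding conv3_def[abs_def] by (simp add: lins)

text \<open>Testing the vector-valued v*F*g against functionals reduces it to a product in the
  scalar convolution algebra, where inverses cancel.\<close>

lemma conv3_comp:
  assumes X: "cog X" and w: "linK w"
  shows "w \<circ> conv3 (fst X) v F g = cnv X v (cnv X (w \<circ> F) g)"
  by (rule ext) (simp add: conv3_def convK_def tens_lift_hom[OF w] linear_scale[OF w] mult_swK2 mult_ac)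

lemma conv3_pull:
  assumes X: "cog X" and Q: "cmap X Y Q" and Y: "cog Y" and l: "linK v" "lin F" "linK g"
  shows "conv3 (fst Y) v F g \<circ> Q = conv3 (fst X) (v \<circ> Q) (F \<circ> Q) (g \<circ> Q)"
proof
  note ll = l linear_comp[OF l(1)] linear_comp[OF l(2)] linear_comp[OF l(3)] cogD[OF X] cogD[OF Y] cogD'[OF Y] cmapD(1)[OF Q]
  show "(conv3 (fst Y) v F g \<circ> Q) x = conv3 (fst X) (v \<circ> Q) (F \<circ> Q) (g \<circ> Q) x" for x
    by (simp add: conv3_def cmapD(2)[OF Q] pushs ll lins)
qed

text \<open>Conjugation in one tensor factor is conjugation on the whole tensor product by a
  functional extended with \<epsilon>; the extra legs are absorbed by the counit laws.\<close>

lemma tm_conv3R: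
  assumes X: "cog X" and Y: "cog Y" and l: "linK v" "lin F" "linK g"
  shows "tm (\<lambda>x. x) (conv3 (fst Y) v F g) = conv3 (fst (tco X Y)) (v \<circ> epsL (snd X)) (tm (\<lambda>x. x) F) (g \<circ> epsL (snd X))"
proof
  note ll = l linear_comp[OF l(1)] linear_comp[OF l(2)] linear_comp[OF l(3)] cogD[OF X] cogD'[OF X] cogD[OF Y] cogD'[OF Y] lin_conv3
    linear_scale[OF l(1)] linear_scale[OF l(3)]
  show "tm (\<lambda>x. x) (conv3 (fst Y) v F g) t = conv3 (fst (tco X Y)) (v \<circ> epsL (snd X)) (tm (\<lambda>x. x) F) (g \<circ> epsL (snd X)) t" for t
    apply (rule lin_ext_tens[where t=t and s=scl], simp add: lins, simp add: lins ll lin_conv3)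
    apply (simp add: tm_tens ll lins)
    apply (simp add: conv3_def tco_tens1 tm_tens epsL_tens pushs ll lins ord_fst[where X=X and Y=Y] scl_scl[symmetric])
    by (simp add: ll lins lift_out cog_counits[OF X] cog_counits[OF Y])
qed

lemma tm_conv3L:
  assumes X: "cog X" and Y: "cog Y" and l: "linK v" "lin F" "linK g"
  shows "tm (conv3 (fst X) v F g) (\<lambda>x. x) = conv3 (fst (tco X Y)) (v \<circ> epsR (snd Y)) (tm F (\<lambda>x. x)) (g \<circ> epsR (snd Y))"
proof
  note ll = l linear_comp[OF l(1)] linear_comp[OF l(2)] linear_comp[OF l(3)] cogD[OF X] cogD'[OF X] cogD[OF Y] cogD'[OF Y] lin_conv3
    linear_scale[OF l(1)] linear_scale[OF l(3)]
  show "tm (conv3 (fst X) v F g) (\<lambda>x. x) t = conv3 (fst (tco X Y)) (v \<circ> epsR (snd Y)) (tm F (\<lambda>x. x)) (g \<circ> epsR (snd Y)) t" for t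
    apply (rule lin_ext_tens[where t=t and s=scl], simp add: lins, simp add: lins ll lin_conv3)
    apply (simp add: tm_tens ll lins)
    apply (simp add: conv3_def tco_tens1 tm_tens epsR_tens pushs ll lins ord_fst[where X=Y and Y=X] scl_scl[symmetric])
    by (simp add: ll lins lift_out cog_counits[OF X] cog_counits[OF Y])
qed

text \<open>Functionals supported on different tensor factors commute, since each sees only the
  counit of the other factor.\<close>

lemma cnv_commute:
  assumes X: "cog X" and Y: "cog Y" and l: "linK a" "linK b"
  shows "cnv (tco X Y) (a \<circ> epsR (snd Y)) (b \<circ> epsL (snd X)) = cnv (tco X Y) (b \<circ> epsL (snd X)) (a \<circ> epsR (snd Y))"
proof
  note ll = l linear_comp[OF l(1)] linear_comp[OF l(2)] cogD[OF X] cogD'[OF X] cogD[OF Y] cogD'[OF Y]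
    linear_scale[OF l(1)] linear_scale[OF l(2)] linK_cnv[OF cog_tco[OF X Y]]
  show "cnv (tco X Y) (a \<circ> epsR (snd Y)) (b \<circ> epsL (snd X)) t = cnv (tco X Y) (b \<circ> epsL (snd X)) (a \<circ> epsR (snd Y)) t" for t
    apply (rule lin_ext_tens[where t=t and s="(*)"], simp add: ll, simp add: ll)
    apply (simp add: convK_def tco_tens1 epsL_tens epsR_tens lins ll pushs)
    by (simp add: mult.assoc mult.left_commute[of "a p" "snd X q" for p q] mult.left_commute[of "b p" "snd Y q" for p q]
       lins ll lift_out cog_counits[OF X] cog_counits[OF Y])
qed

text \<open>Products of coordinate functionals already separate tensors.\<close>

lemma tens_eqI:
  assumes "\<And>p q. linK p \<Longrightarrow> linK q \<Longrightarrow> swK t (\<lambda>x y. p x * q y) = swK u (\<lambda>x y. p x * q y)"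
  shows "t = u"
proof (rule poly_mapping_eqI)
  fix ab :: "'a \<times> 'c"
  obtain a b where ab: "ab = (a, b)" by (cases ab)
  have l: "linK (\<lambda>x. Poly_Mapping.lookup x c)" for c :: 'z
    by (rule linearI[OF vector_space_field]) (simp_all add: lookup_add lookup_scl)
  have eq: "Poly_Mapping.lookup z (a, b) = swK z (\<lambda>x y. Poly_Mapping.lookup x a * Poly_Mapping.lookup y b)" for z
    by (rule lin_ext_tens[where t=z and s="(*)"]) (simp_all add: lins l pushs lookup_tens)
  show "Poly_Mapping.lookup t ab = Poly_Mapping.lookup u ab"
    unfolding ab eq by (rule assms[OF l l])
qed

lemma vec_eqI:
  assumes "\<And>p. linK p \<Longrightarrow> p t = p u"
  shows "t = u"
proof (rule poly_mapping_eqI)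
  fix a
  have l: "linK (\<lambda>x. Poly_Mapping.lookup x c)" for c :: 'z
    by (rule linearI[OF vector_space_field]) (simp_all add: lookup_add lookup_scl)
  show "Poly_Mapping.lookup t a = Poly_Mapping.lookup u a" by (rule assms[OF l])
qed

lemma cnv_cancel:
  assumes "cog Y" "cnv Y a b = snd Y" "linK a" "linK b" "linK c"
  shows "cnv Y a (cnv Y b c) = c"
  using assms by (simp flip: cnv_assoc add: cnv_unitL)

text \<open>Tested against p \<otimes> q, compatibility with the coproduct reads v*(pF)*(qF)*g =
  v*(pF)*g*v*(qF)*g, and g*v in the middle cancels.\<close>

lemma cmap_conv3:
  fixes X :: "('c, 'k::field) coalg" and Y :: "('d, 'k) coalg"
  assumes X: "cog X" and Y: "cog Y" and F: "cmap X Y F" and v: "linK v" "linK g" "cnv X v g = snd X" "cnv X g v = snd X"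
  shows "cmap X Y (conv3 (fst X) v F g)"
  unfolding cmap_def
proof (intro conjI allI)
  let ?F = "conv3 (fst X) v F g"
  note l = v X cogD[OF X] cogD[OF Y] linear_comp[OF v(1)] linear_comp[OF v(2)] cmapD(1)[OF F] linear_o linK_cnv lin_conv3
  show "lin ?F" by (simp add: l)
  have 1: "snd Y \<circ> F = snd X" using cmapD(3)[OF F] by auto
  have "snd Y \<circ> ?F = cnv X v (cnv X (snd Y \<circ> F) g)" by (rule conv3_comp) (simp_all add: l)
  then have "snd Y \<circ> ?F = snd X" unfolding 1 by (simp add: l cnv_unitL)
  then show "snd Y (?F x) = snd X x" for x by (metis comp_apply)
  fix x
  show "fst Y (?F x) = sw (fst X x) (\<lambda>x1 x2. ?F x1 \<otimes> ?F x2)"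
  proof (rule tens_eqI)
    fix p q :: "('d \<Rightarrow>\<^sub>0 'k) \<Rightarrow> 'k" assume p: "linK p" "linK q"
    note p' = p linear_comp[OF p(1)] linear_comp[OF p(2)]
    have "cnv Y p q \<circ> ?F = cnv X v (cnv X (cnv Y p q \<circ> F) g)" by (rule conv3_comp) (simp_all add: l Y)
    also have "\<dots> = cnv X (p \<circ> ?F) (q \<circ> ?F)"
      by (simp add: cnv_pull[OF F p] conv3_comp X p l cnv_assoc cnv_cancel[OF X v(4)])
    finally have "cnv Y p q (?F x) = cnv X (p \<circ> ?F) (q \<circ> ?F) x" by (simp add: fun_eq_iff)
    then show "swK (fst Y (?F x)) (\<lambda>x y. p x * q y) = swK (sw (fst X x) (\<lambda>x1 x2. ?F x1 \<otimes> ?F x2)) (\<lambda>x y. p x * q y)"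
      by (simp add: convK_def pushs p' lins)
  qed
qed

text \<open>Uniqueness of two-sided inverses in a monoid, used to evaluate the definite description
  in \<open>conv_inv\<close>.\<close>

lemma conv_inv_eq:
  assumes X: "cog X" and f: "linK f" "linK g" "cnv X f g = snd X" "cnv X g f = snd X"
  shows "conv_inv (fst X) (snd X) f = g" "conv_invertible (fst X) (snd X) f"
proof -
  have "h = g" if "is_conv_inverse (fst X) (snd X) f h" for h
    using that f cnv_assoc[OF X f(2) f(1), of h] unfolding is_conv_inverse_def by (simp add: cnv_unitL[OF X] cnv_unitR[OF X])
  moreover have *: "is_conv_inverse (fst X) (snd X) f g" using f by (simp add: is_conv_inverse_def)
  ultimately show "conv_inv (fst X) (snd X) f = g" unfolding conv_inv_def by (intro the_equality)
  show "conv_invertible (fst X) (snd X) f" using * f by (auto simp: conv_invertible_def)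
qed

section \<open>Twisting an ordinary bialgebra by a gauge transformation v with inverse g\<close>

locale twisted =
  fixes X :: "('d, 'k::field) coalg" and m e v g
  assumes X: "cog X" and m: "cmap (tco X X) X m"
    and assoc: "\<And>x y z. m (m (x \<otimes> y) \<otimes> z) = m (x \<otimes> m (y \<otimes> z))"
    and one: "\<And>x. m (e \<otimes> x) = x" "\<And>x. m (x \<otimes> e) = x" and e: "fst X e = e \<otimes> e" "snd X e = 1"
    and v: "linK v" "\<And>x. v (e \<otimes> x) = snd X x" "\<And>x. v (x \<otimes> e) = snd X x" and g: "linK g"
    and vg: "cnv (tco X X) v g = snd (tco X X)" and gv: "cnv (tco X X) g v = snd (tco X X)"
begin

abbreviation "XX \<equiv> tco X X"
abbreviation "XXX \<equiv> tco X XX"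
abbreviation "X4 \<equiv> tco X XXX"

lemma cogs: "cog X" "cog XX" "cog XXX" "cog X4" by (simp_all add: X cog_tco)

text \<open>The reassociator of the twist. The trivial reassociator of the bialgebra, being the unit
  for convolution, is left out of the product.\<close>

definition "\<alpha> = cnv XXX (v \<circ> epsL (snd X)) (cnv XXX (v \<circ> tm (\<lambda>x. x) m) (cnv XXX (g \<circ> tm m (\<lambda>x. x) \<circ> asc) (g \<circ> epsR (snd X) \<circ> asc)))"
definition "mv = conv3 (fst XX) v m g"

lemma eps: "cog Y \<Longrightarrow> linK (snd Y)" by (rule cogD)

lemmas ll = X m[THEN cmapD(1)] cogs cogs[THEN eps] v(1) g linear_o[OF v(1)] linear_o[OF g] linear_o
  linear_comp[OF v(1)] linear_comp[OF g] linear_comp[OF m[THEN cmapD(1)]] linK_cnv[OF cogs(2)] linK_cnv[OF cogs(3)] linK_cnv[OF cogs(4)]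

lemma lin\<alpha>: "linK \<alpha>" unfolding \<alpha>_def by (simp add: ll)

lemma inv_pull:
  assumes "cmap Y XX F"
  shows "cnv Y (v \<circ> F) (g \<circ> F) = snd Y" "cnv Y (g \<circ> F) (v \<circ> F) = snd Y"
proof -
  have "snd XX \<circ> F = snd Y" using cmapD(3)[OF assms] by auto
  with cnv_pull[OF assms v(1) g] cnv_pull[OF assms g v(1)]
  show "cnv Y (v \<circ> F) (g \<circ> F) = snd Y" "cnv Y (g \<circ> F) (v \<circ> F) = snd Y"
    by (auto simp: vg gv)
qed

lemma \<alpha>_pull:
  assumes "cmap Y XXX F"
  shows "\<alpha> \<circ> F = cnv Y (v \<circ> epsL (snd X) \<circ> F) (cnv Y (v \<circ> tm (\<lambda>x. x) m \<circ> F) (cnv Y (g \<circ> tm m (\<lambda>x. x) \<circ> asc \<circ> F) (g \<circ> epsR (snd X) \<circ> asc \<circ> F)))"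
  unfolding \<alpha>_def by (simp add: cnv_pull[OF assms] ll lins)

abbreviation "I \<equiv> (\<lambda>x. x)"

lemma c_asc: "cmap XXX (tco XX X) asc" by (rule cmap_asc; rule X)
lemma c_mi: "cmap (tco XX X) XX (tm m I)" by (rule cmap_tm) (simp_all add: m cmap_id ll cog_tco)
lemma c_im: "cmap XXX XX (tm I m)" by (rule cmap_tm) (simp_all add: m cmap_id ll cog_tco)
lemma c_L: "cog Y \<Longrightarrow> cmap (tco X Y) Y (epsL (snd X))" by (rule cmap_epsL) (simp_all add: ll)
lemma c_R: "cog Y \<Longrightarrow> cmap (tco Y X) Y (epsR (snd X))" by (rule cmap_epsR) (simp_all add: ll)

text \<open>Composing with a functional \<open>w\<close> puts the claim into a convolution algebra.
  Both sides collapse, by cancelling v against g, to (\<epsilon> \<otimes> v) * v(id \<otimes> m) *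
  (w of the triple product) * g(m \<otimes> id) * (g \<otimes> \<epsilon>); associativity of m
  identifies the two middle factors.\<close>

lemma quasi_assoc:
  assumes w: "linK w"
  shows "cnv XXX (w \<circ> mv \<circ> tm I mv) \<alpha> = cnv XXX \<alpha> (w \<circ> mv \<circ> tm mv I \<circ> asc)"
proof -
  have a: "w \<circ> mv = cnv XX v (cnv XX (w \<circ> m) g)" unfolding mv_def by (rule conv3_comp) (simp_all add: ll w)
  have b: "u \<circ> tm I mv = cnv XXX (v \<circ> epsL (snd X)) (cnv XXX (u \<circ> tm I m) (g \<circ> epsL (snd X)))" if "linK u" for u
    unfolding mv_def by (subst tm_conv3R[OF X]) (simp_all add: ll conv3_comp that)
  have c: "u \<circ> tm mv I = cnv (tco XX X) (v \<circ> epsR (snd X)) (cnv (tco XX X) (u \<circ> tm m I) (g \<circ> epsR (snd X)))" if "linK u" for u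
    unfolding mv_def by (subst tm_conv3L[OF cogs(2) X]) (simp_all add: ll conv3_comp that cog_tco)
  have e1: "w \<circ> (m \<circ> (tm m I \<circ> asc)) = w \<circ> (m \<circ> tm I m)"
    by (rule ext, rule ext3[where s="(*)"]) (simp_all add: lins ll linear_comp[OF w] tm_tens asc_tens assoc)
  note i = inv_pull[OF c_L[OF cogs(2)]] inv_pull[OF c_im] inv_pull[OF cmap_comp[OF c_asc c_mi]] inv_pull[OF cmap_comp[OF c_asc c_R[OF cogs(2)]]]
  note W = w linear_comp[OF w] linear_o[OF w]
  have l: "w \<circ> mv \<circ> tm I mv = cnv XXX (v \<circ> epsL (snd X)) (cnv XXX (v \<circ> tm I m) (cnv XXX (w \<circ> (m \<circ> tm I m)) (cnv XXX (g \<circ> tm I m) (g \<circ> epsL (snd X)))))"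
    by (simp add: a b ll W cnv_pull[OF c_im] cnv_assoc lins comp_assoc)
  have r: "w \<circ> mv \<circ> tm mv I \<circ> asc = cnv XXX (v \<circ> (epsR (snd X) \<circ> asc)) (cnv XXX (v \<circ> (tm m I \<circ> asc)) (cnv XXX (w \<circ> (m \<circ> tm I m)) (cnv XXX (g \<circ> (tm m I \<circ> asc)) (g \<circ> (epsR (snd X) \<circ> asc)))))"
    by (simp add: a c ll W cnv_pull[OF c_mi] cnv_pull[OF c_asc] cnv_assoc lins comp_assoc e1 cog_tco linK_cnv)
  show ?thesis unfolding l r unfolding \<alpha>_def comp_assoc by (simp add: cnv_assoc cnv_cancel i ll lins W)
qed

text \<open>Each of the five terms is a product of four factors v or g evaluated on partial
  products, the terms containing \<open>mv\<close> being conjugated in addition. After one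
  commutation everything cancels, and both sides become v34 * v2_34 * v1_234 * g123_4 * g12_3 *
  g12.\<close>

lemma pentagon:
  "cnv X4 (\<alpha> \<circ> tm I (tm I mv)) (\<alpha> \<circ> tm mv I \<circ> asc)
   = cnv X4 (\<alpha> \<circ> epsL (snd X)) (cnv X4 (\<alpha> \<circ> tm I (tm mv I \<circ> asc)) (\<alpha> \<circ> tm I (tm I (epsR (snd X)))))"
proof -
  let ?e = "snd X"
  \<comment> \<open>The name gives the arguments: juxtaposed digits are multiplied, an underscore
    separates the two arguments when one of them is a product, and factors that do not occur are
    sent to \<epsilon>. So \<open>v2_34\<close> is \<epsilon>(x1) v(x2 \<otimes> x3 x4), and
    \<open>v34\<close> is \<epsilon>(x1) \<epsilon>(x2) v(x3 \<otimes> x4).\<close>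
  define v34 where "v34 = v \<circ> (epsL ?e \<circ> epsL ?e)"
  define g34 where "g34 = g \<circ> (epsL ?e \<circ> epsL ?e)"
  define v12 where "v12 = v \<circ> epsR (snd XX) \<circ> asc"
  define g12 where "g12 = g \<circ> epsR (snd XX) \<circ> asc"
  define v23 where "v23 = v \<circ> epsL ?e \<circ> tm I (epsR ?e \<circ> asc)"
  define g23 where "g23 = g \<circ> epsL ?e \<circ> tm I (epsR ?e \<circ> asc)"
  define v2_34 where "v2_34 = v \<circ> tm I m \<circ> epsL ?e"
  define v23_4 where "v23_4 = v \<circ> (tm m I \<circ> asc \<circ> epsL ?e)"
  define g23_4 where "g23_4 = g \<circ> (tm m I \<circ> asc \<circ> epsL ?e)"
  define v1_234 where "v1_234 = v \<circ> tm I m \<circ> tm I (tm I m)"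
  define g123_4 where "g123_4 = g \<circ> tm m I \<circ> asc \<circ> (tm m I \<circ> asc)"
  define v12_34 where "v12_34 = v \<circ> (tm m m \<circ> asc)"
  define g12_34 where "g12_34 = g \<circ> (tm m m \<circ> asc)"
  define v1_23 where "v1_23 = v \<circ> (tm I m \<circ> tm I (tm I (epsR ?e)))"
  define g1_23 where "g1_23 = g \<circ> (tm I m \<circ> tm I (tm I (epsR ?e)))"
  define g12_3 where "g12_3 = g \<circ> tm m I \<circ> asc \<circ> tm I (tm I (epsR ?e))"
  note defs = v34_def g34_def v12_def g12_def v23_def g23_def v2_34_def v23_4_def g23_4_def v1_234_def g123_4_def v12_34_def g12_34_def v1_23_def g1_23_def g12_3_def
  have linKs: "linK v34" "linK g34" "linK v12" "linK g12" "linK v23" "linK g23" "linK v2_34" "linK v23_4" "linK g23_4" "linK v1_234" "linK g123_4"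
    "linK v12_34" "linK g12_34" "linK v1_23" "linK g1_23" "linK g12_3"
    unfolding defs by (simp_all add: linear_o ll lins)
  have c34: "cmap X4 XX (epsL ?e \<circ> epsL ?e)"
    by (rule cmap_comp[OF c_L[OF cogs(3)] c_L[OF cogs(2)]])
  have c_asc4: "cmap X4 (tco XX XX) asc" by (rule cmap_asc) (simp_all add: ll)
  have c12: "cmap X4 XX (epsR (snd XX) \<circ> asc)"
    by (rule cmap_comp[OF c_asc4 cmap_epsR]) (simp_all add: ll)
  have c_r: "cmap XXX XX (epsR ?e \<circ> asc)" by (rule cmap_comp[OF c_asc c_R]) (simp add: ll)
  have c_r4: "cmap X4 XXX (tm I (epsR ?e \<circ> asc))" by (rule cmap_tm) (simp_all add: c_r cmap_id ll)
  have c23: "cmap X4 XX (epsL ?e \<circ> tm I (epsR ?e \<circ> asc))" by (rule cmap_comp[OF c_r4 c_L]) (simp add: ll)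
  have c_mi': "cmap XXX XX (tm m I \<circ> asc)" by (rule cmap_comp[OF c_asc c_mi])
  have c23_4: "cmap X4 XX (tm m I \<circ> asc \<circ> epsL ?e)" by (rule cmap_comp[OF c_L c_mi']) (simp add: ll)
  have c12_34: "cmap X4 XX (tm m m \<circ> asc)" by (rule cmap_comp[OF c_asc4 cmap_tm]) (simp_all add: ll m)
  have c_iir: "cmap X4 XXX (tm I (tm I (epsR ?e)))"
    by (rule cmap_tm; (rule cmap_tm)?) (simp_all add: cmap_id ll c_R)
  have c1_23: "cmap X4 XX (tm I m \<circ> tm I (tm I (epsR ?e)))" by (rule cmap_comp[OF c_iir c_im])
  have c_imi: "cmap X4 XXX (tm I (tm m I \<circ> asc))" by (rule cmap_tm) (simp_all add: cmap_id ll c_mi')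
  have c_iim: "cmap X4 XXX (tm I (tm I m))" by (rule cmap_tm) (simp_all add: cmap_id ll c_im)
  have c_mii: "cmap X4 XXX (tm m I \<circ> asc)" by (rule cmap_comp[OF c_asc4 cmap_tm]) (simp_all add: ll m cmap_id)
  have inv: "cnv X4 v34 g34 = snd X4" "cnv X4 g34 v34 = snd X4"
    "cnv X4 g12 v12 = snd X4" "cnv X4 v12 g12 = snd X4" "cnv X4 v23 g23 = snd X4" "cnv X4 g23 v23 = snd X4"
    "cnv X4 g23_4 v23_4 = snd X4" "cnv X4 g12_34 v12_34 = snd X4" "cnv X4 g1_23 v1_23 = snd X4"
    unfolding defs comp_assoc[symmetric] using inv_pull[OF c34] inv_pull[OF c12] inv_pull[OF c23] inv_pull[OF c23_4] inv_pull[OF c12_34] inv_pull[OF c1_23]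
    by (simp_all add: comp_assoc)
  note can = inv[THEN cnv_cancel[OF cogs(4)]]
  \<comment> \<open>The only commutation needed: these two factors involve disjoint pairs of
    arguments.\<close>
  have comm: "cnv X4 g34 v12 = cnv X4 v12 g34"
  proof -
    have eq: "g34 = g \<circ> epsL (snd XX) \<circ> asc" unfolding g34_def
      by (rule ext, rule ext4[where s="(*)"]) (simp_all add: lins ll epsL_tens asc_tens tco_tens2 linear_scale[OF lin_epsL] linear_scale[OF g] linear_o)
    show ?thesis unfolding eq v12_def using cnv_commute[OF cogs(2,2) v(1) g]
      by (simp add: cnv_pull[OF c_asc4, symmetric] linear_o lins ll)
  qed
  have comm': "cnv X4 g34 (cnv X4 v12 c) = cnv X4 v12 (cnv X4 g34 c)" if "linK c" for c
    using comm that linKs by (simp flip: cnv_assoc add: cogs)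
  note sm = lins ll linear_o epsL_tens epsR_tens asc_tens tm_tens tco_tens2
  note sc = linear_scale[OF eps[OF X]] linear_scale[OF lin_epsL] linear_scale[OF lin_epsR] linear_scale[OF g] linear_scale[OF v(1)] linear_scale[OF lin_tm] linear_scale[OF lin_asc] linear_scale[OF m[THEN cmapD(1)]]
   tens_scl1 tens_scl2 cmapD(3)[OF m]
  have 1: "\<alpha> \<circ> tm I (tm I m) = cnv X4 v2_34 (cnv X4 v1_234 (cnv X4 g12_34 g12))"
  proof -
    have "v \<circ> epsL ?e \<circ> tm I (tm I m) = v2_34" "v \<circ> tm I m \<circ> tm I (tm I m) = v1_234"
      "g \<circ> tm m I \<circ> asc \<circ> tm I (tm I m) = g12_34" "g \<circ> epsR ?e \<circ> asc \<circ> tm I (tm I m) = g12"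
      unfolding defs by (rule ext, rule ext4[where s="(*)"]; simp add: sm; simp add: sm sc)+
    then show ?thesis by (simp only: \<alpha>_pull[OF c_iim])
  qed
  have 2: "\<alpha> \<circ> (tm m I \<circ> asc) = cnv X4 v34 (cnv X4 v12_34 (cnv X4 g123_4 g12_3))"
  proof -
    have "v \<circ> epsL ?e \<circ> (tm m I \<circ> asc) = v34" "v \<circ> tm I m \<circ> (tm m I \<circ> asc) = v12_34"
      "g \<circ> tm m I \<circ> asc \<circ> (tm m I \<circ> asc) = g123_4" "g \<circ> epsR ?e \<circ> asc \<circ> (tm m I \<circ> asc) = g12_3"
      unfolding defs by (rule ext, rule ext4[where s="(*)"]; simp add: sm; simp add: sm sc mult_ac)+
    then show ?thesis by (simp only: \<alpha>_pull[OF c_mii])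
  qed
  have 3: "\<alpha> \<circ> epsL ?e = cnv X4 v34 (cnv X4 v2_34 (cnv X4 g23_4 g23))"
  proof -
    have "v \<circ> epsL ?e \<circ> epsL ?e = v34" "v \<circ> tm I m \<circ> epsL ?e = v2_34"
      "g \<circ> tm m I \<circ> asc \<circ> epsL ?e = g23_4" "g \<circ> epsR ?e \<circ> asc \<circ> epsL ?e = g23"
      unfolding defs by (rule ext, rule ext4[where s="(*)"]; simp add: sm; simp add: sm sc mult_ac)+
    then show ?thesis by (simp only: \<alpha>_pull[OF c_L[OF cogs(3)]])
  qed
  have 4: "\<alpha> \<circ> tm I (tm m I \<circ> asc) = cnv X4 v23_4 (cnv X4 v1_234 (cnv X4 g123_4 g1_23))"
  proof -
    have "v \<circ> epsL ?e \<circ> tm I (tm m I \<circ> asc) = v23_4" "v \<circ> tm I m \<circ> tm I (tm m I \<circ> asc) = v1_234"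
      "g \<circ> tm m I \<circ> asc \<circ> tm I (tm m I \<circ> asc) = g123_4" "g \<circ> epsR ?e \<circ> asc \<circ> tm I (tm m I \<circ> asc) = g1_23"
      unfolding defs by (rule ext, rule ext4[where s="(*)"]; simp add: sm; simp add: sm sc assoc)+
    then show ?thesis by (simp only: \<alpha>_pull[OF c_imi])
  qed
  have 5: "\<alpha> \<circ> tm I (tm I (epsR ?e)) = cnv X4 v23 (cnv X4 v1_23 (cnv X4 g12_3 g12))"
  proof -
    have "v \<circ> epsL ?e \<circ> tm I (tm I (epsR ?e)) = v23" "v \<circ> tm I m \<circ> tm I (tm I (epsR ?e)) = v1_23"
      "g \<circ> tm m I \<circ> asc \<circ> tm I (tm I (epsR ?e)) = g12_3" "g \<circ> epsR ?e \<circ> asc \<circ> tm I (tm I (epsR ?e)) = g12"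
      unfolding defs by (rule ext, rule ext4[where s="(*)"]; simp add: sm; simp add: sm sc mult_ac)+
    then show ?thesis by (simp only: \<alpha>_pull[OF c_iir])
  qed
  have mv1: "tm I (tm I mv) = conv3 (fst X4) (v \<circ> (epsL ?e \<circ> epsL ?e)) (tm I (tm I m)) (g \<circ> (epsL ?e \<circ> epsL ?e))"
    unfolding mv_def by (simp add: tm_conv3R[OF X] ll linear_o lins comp_assoc)
  have mv2: "tm mv I = conv3 (fst (tco XX XX)) (v \<circ> epsR (snd XX)) (tm m I) (g \<circ> epsR (snd XX))"
    unfolding mv_def by (simp add: tm_conv3L[OF cogs(2) cogs(2)] ll linear_o lins comp_assoc)
  have mv3: "tm I (tm mv I \<circ> asc) = conv3 (fst X4) (v \<circ> (epsR ?e \<circ> asc) \<circ> epsL ?e) (tm I (tm m I \<circ> asc)) (g \<circ> (epsR ?e \<circ> asc) \<circ> epsL ?e)"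
  proof -
    have "tm mv I \<circ> asc = conv3 (fst XXX) (v \<circ> (epsR ?e \<circ> asc)) (tm m I \<circ> asc) (g \<circ> (epsR ?e \<circ> asc))"
      unfolding mv_def by (subst tm_conv3L[OF cogs(2) X]) (simp_all add: ll linear_o lins comp_assoc conv3_pull[OF cogs(3) c_asc] cog_tco)
    then show ?thesis by (simp add: tm_conv3R[OF X] ll linear_o lins comp_assoc)
  qed
  have v23': "v \<circ> (epsR ?e \<circ> asc) \<circ> epsL ?e = v23" "g \<circ> (epsR ?e \<circ> asc) \<circ> epsL ?e = g23"
    unfolding defs by (rule ext, rule ext4[where s="(*)"]; simp add: sm; simp add: sm sc mult_ac)+
  have L1: "\<alpha> \<circ> tm I (tm I mv) = cnv X4 v34 (cnv X4 (\<alpha> \<circ> tm I (tm I m)) g34)"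
    unfolding mv1 v34_def g34_def by (rule conv3_comp) (simp_all add: ll lin\<alpha>)
  have L2: "\<alpha> \<circ> tm mv I \<circ> asc = cnv X4 v12 (cnv X4 (\<alpha> \<circ> (tm m I \<circ> asc)) g12)"
    unfolding mv2 v12_def g12_def
    by (subst conv3_comp) (simp_all add: ll lin\<alpha> cog_tco cnv_pull[OF c_asc4] comp_assoc linear_o lins linK_cnv)
  have L3: "\<alpha> \<circ> tm I (tm mv I \<circ> asc) = cnv X4 v23 (cnv X4 (\<alpha> \<circ> tm I (tm m I \<circ> asc)) g23)"
    unfolding mv3 v23'[symmetric] by (rule conv3_comp) (simp_all add: ll lin\<alpha>)
  show ?thesis
    unfolding L1 L2 L3 1 2 3 4 5
    by (simp add: cnv_assoc[OF cogs(4)] linKs linK_cnv cogs can comm')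
qed

text \<open>Restrict the inverse relation to e \<otimes> X and X \<otimes> e, copies of the
  coalgebra X on which v is the convolution unit.\<close>

lemma g_unit: "g (e \<otimes> x) = snd X x" "g (x \<otimes> e) = snd X x"
proof -
  have "v \<circ> (\<lambda>y. e \<otimes> y) = snd X" "v \<circ> (\<lambda>y. y \<otimes> e) = snd X" using v by auto
  with inv_pull[OF cmap_unitL[OF X X e]] inv_pull[OF cmap_unitR[OF X X e]]
  have "g \<circ> (\<lambda>y. e \<otimes> y) = snd X" "g \<circ> (\<lambda>y. y \<otimes> e) = snd X"
    by (simp_all add: cnv_unitL ll lins)
  then show "g (e \<otimes> x) = snd X x" "g (x \<otimes> e) = snd X x" by (simp_all add: fun_eq_iff)
qed

lemma cmap_mv: "cmap XX X mv"
  unfolding mv_def by (rule cmap_conv3) (simp_all add: ll m vg gv)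

lemma conv3_unit: "lin F \<Longrightarrow> conv3 (fst X) (snd X) F (snd X) = F"
  by (rule ext) (simp add: conv3_def scl_scl[symmetric] lift_out cog_counits[OF X] lins ll)

lemma mv_unit: "mv (e \<otimes> x) = x" "mv (x \<otimes> e) = x"
proof -
  have "v \<circ> (\<lambda>y. e \<otimes> y) = snd X" "v \<circ> (\<lambda>y. y \<otimes> e) = snd X" "g \<circ> (\<lambda>y. e \<otimes> y) = snd X" "g \<circ> (\<lambda>y. y \<otimes> e) = snd X"
    "m \<circ> (\<lambda>y. e \<otimes> y) = I" "m \<circ> (\<lambda>y. y \<otimes> e) = I"
    using v g_unit one by auto
  then have "mv \<circ> (\<lambda>y. e \<otimes> y) = I" "mv \<circ> (\<lambda>y. y \<otimes> e) = I"
    unfolding mv_def by (simp_all add: conv3_pull[OF X cmap_unitL[OF X X e]] conv3_pull[OF X cmap_unitR[OF X X e]] ll conv3_unit lins)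
  then show "mv (e \<otimes> x) = x" "mv (x \<otimes> e) = x" by (simp_all add: fun_eq_iff)
qed

lemma \<alpha>_unit: "\<alpha> (e \<otimes> x \<otimes> y) = snd X x * snd X y" "\<alpha> (x \<otimes> e \<otimes> y) = snd X x * snd X y" "\<alpha> (x \<otimes> y \<otimes> e) = snd X x * snd X y"
proof -
  note sm = lins ll linear_o epsL_tens epsR_tens asc_tens tm_tens tco_tens2 v g_unit one e linear_scale[OF v(1)] linear_scale[OF g] mult_ac
  have c1: "cmap XX XXX (\<lambda>t. e \<otimes> t)" by (rule cmap_unitL) (simp_all add: ll e)
  have c2: "cmap XX XXX (tm I (\<lambda>t. e \<otimes> t))" by (rule cmap_tm[OF _ cmap_unitL]) (simp_all add: ll e cmap_id)
  have c3: "cmap XX XXX (tm I (\<lambda>t. t \<otimes> e))" by (rule cmap_tm[OF _ cmap_unitR]) (simp_all add: ll e cmap_id)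
  have 1: "v \<circ> epsL (snd X) \<circ> (\<lambda>t. e \<otimes> t) = v" "v \<circ> tm I m \<circ> (\<lambda>t. e \<otimes> t) = snd XX"
     "g \<circ> tm m I \<circ> asc \<circ> (\<lambda>t. e \<otimes> t) = g" "g \<circ> epsR (snd X) \<circ> asc \<circ> (\<lambda>t. e \<otimes> t) = snd XX"
    by (rule ext, rule lin_ext_tens[where s="(*)"]; simp add: sm cmapD(3)[OF m])+
  have 2: "v \<circ> epsL (snd X) \<circ> (tm I (\<lambda>t. e \<otimes> t)) = snd XX" "v \<circ> tm I m \<circ> (tm I (\<lambda>t. e \<otimes> t)) = v"
     "g \<circ> tm m I \<circ> asc \<circ> (tm I (\<lambda>t. e \<otimes> t)) = g" "g \<circ> epsR (snd X) \<circ> asc \<circ> (tm I (\<lambda>t. e \<otimes> t)) = snd XX"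
    by (rule ext, rule lin_ext_tens[where s="(*)"]; simp add: sm cmapD(3)[OF m])+
  have 3: "v \<circ> epsL (snd X) \<circ> (tm I (\<lambda>t. t \<otimes> e)) = snd XX" "v \<circ> tm I m \<circ> (tm I (\<lambda>t. t \<otimes> e)) = v"
     "g \<circ> tm m I \<circ> asc \<circ> (tm I (\<lambda>t. t \<otimes> e)) = snd XX" "g \<circ> epsR (snd X) \<circ> asc \<circ> (tm I (\<lambda>t. t \<otimes> e)) = g"
    by (rule ext, rule lin_ext_tens[where s="(*)"]; simp add: sm cmapD(3)[OF m])+
  have "\<alpha> \<circ> (\<lambda>t. e \<otimes> t) = snd XX" "\<alpha> \<circ> (tm I (\<lambda>t. e \<otimes> t)) = snd XX" "\<alpha> \<circ> (tm I (\<lambda>t. t \<otimes> e)) = snd XX"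
    unfolding \<alpha>_pull[OF c1] \<alpha>_pull[OF c2] \<alpha>_pull[OF c3] 1 2 3
    by (simp_all add: cnv_unitL cnv_unitR ll vg)
  from fun_cong[OF this(1), of "x \<otimes> y"] fun_cong[OF this(2), of "x \<otimes> y"] fun_cong[OF this(3), of "x \<otimes> y"]
  show "\<alpha> (e \<otimes> x \<otimes> y) = snd X x * snd X y" "\<alpha> (x \<otimes> e \<otimes> y) = snd X x * snd X y" "\<alpha> (x \<otimes> y \<otimes> e) = snd X x * snd X y"
    by (simp_all add: sm)
qed

end

section \<open>Hopf algebras, Yetter-Drinfeld coalgebras and H-module coalgebras\<close>

lemma lin_mulH': "lin (mulH H) \<Longrightarrow> lin f \<Longrightarrow> lin (\<lambda>x. mulH H (f x))" by (rule linear_comp)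
lemma lin_DeltaH': "lin (DeltaH H) \<Longrightarrow> lin f \<Longrightarrow> lin (\<lambda>x. DeltaH H (f x))" by (rule linear_comp)
lemma lin_antipode': "lin (antipode H) \<Longrightarrow> lin f \<Longrightarrow> lin (\<lambda>x. antipode H (f x))" by (rule linear_comp)
lemma lin_epsH': "linK (epsH H) \<Longrightarrow> lin f \<Longrightarrow> linK (\<lambda>x. epsH H (f x))" by (rule linear_comp)
lemma lin_act': "lin (act C) \<Longrightarrow> lin f \<Longrightarrow> lin (\<lambda>x. act C (f x))" by (rule linear_comp)
lemma lin_coact': "lin (coact C) \<Longrightarrow> lin f \<Longrightarrow> lin (\<lambda>x. coact C (f x))" by (rule linear_comp)
lemma lin_comult': "lin (comult C) \<Longrightarrow> lin f \<Longrightarrow> lin (\<lambda>x. comult C (f x))" by (rule linear_comp)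
lemma lin_counit': "linK (counit C) \<Longrightarrow> lin f \<Longrightarrow> linK (\<lambda>x. counit C (f x))" by (rule linear_comp)

lemmas [lins] = lin_mulH' lin_DeltaH' lin_antipode' lin_epsH' lin_act' lin_coact' lin_comult' lin_counit'

named_theorems push

lemma [push]: "lin (mulH H) \<Longrightarrow> mulH H (sw t F) = sw t (\<lambda>a b. mulH H (F a b))" by (rule tens_lift_hom)
lemma [push]: "lin (DeltaH H) \<Longrightarrow> DeltaH H (sw t F) = sw t (\<lambda>a b. DeltaH H (F a b))" by (rule tens_lift_hom)
lemma [push]: "lin (act H) \<Longrightarrow> act H (sw t F) = sw t (\<lambda>a b. act H (F a b))" by (rule tens_lift_hom)
lemma [push]: "lin (coact H) \<Longrightarrow> coact H (sw t F) = sw t (\<lambda>a b. coact H (F a b))" by (rule tens_lift_hom)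
lemma [push]: "lin (comult H) \<Longrightarrow> comult H (sw t F) = sw t (\<lambda>a b. comult H (F a b))" by (rule tens_lift_hom)
lemma [push]: "linK (counit H) \<Longrightarrow> counit H (sw t F) = swK t (\<lambda>a b. counit H (F a b))" by (rule tens_lift_hom)
lemma [push]: "linK (epsH H) \<Longrightarrow> epsH H (sw t F) = swK t (\<lambda>a b. epsH H (F a b))" by (rule tens_lift_hom)
lemma [push]: "lin (mulH H) \<Longrightarrow> mulH H (scl c x) = scl c (mulH H x)" by (rule linear_scale)
lemma [push]: "lin (DeltaH H) \<Longrightarrow> DeltaH H (scl c x) = scl c (DeltaH H x)" by (rule linear_scale)
lemma [push]: "lin (act H) \<Longrightarrow> act H (scl c x) = scl c (act H x)" by (rule linear_scale)
lemma [push]: "lin (coact H) \<Longrightarrow> coact H (scl c x) = scl c (coact H x)" by (rule linear_scale)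
lemma [push]: "lin (comult H) \<Longrightarrow> comult H (scl c x) = scl c (comult H x)" by (rule linear_scale)
lemma [push]: "linK (counit H) \<Longrightarrow> counit H (scl c x) = c * (counit H x)" by (rule linear_scale)
lemma [push]: "linK (epsH H) \<Longrightarrow> epsH H (scl c x) = c * (epsH H x)" by (rule linear_scale)
lemmas [push] = pushs

text \<open>Left H-module coalgebras. The coproduct of \<open>btens H R C\<close> involves the
  coaction of \<open>R\<close> and the action on \<open>C\<close>, so this is the natural class for
  the right factor; it contains both the Yetter-Drinfeld coalgebras and H itself.\<close>

definition hmc :: "('h, 'k::field) hopf \<Rightarrow> ('h, 'c, 'k, 'z) ydcoalg_scheme \<Rightarrow> bool" where
  "hmc H C \<longleftrightarrow> lin (act C) \<and>
     (\<forall>g h v. act C ((g \<bullet>\<^bsub>H\<^esub> h) \<otimes> v) = act C (g \<otimes> act C (h \<otimes> v))) \<and>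
     (\<forall>v. act C (oneH H \<otimes> v) = v) \<and>
     coalgebra (comult C) (counit C) \<and>
     (\<forall>h c. comult C (act C (h \<otimes> c)) =
        sw (DeltaH H h) (\<lambda>h1 h2. sw (comult C c) (\<lambda>c1 c2. act C (h1 \<otimes> c1) \<otimes> act C (h2 \<otimes> c2)))) \<and>
     (\<forall>h c. counit C (act C (h \<otimes> c)) = epsH H h * counit C c)"

lemma comult_btens_tens:
  assumes "lin (comult C)" "lin (comult D)" "lin (coact C)" "lin (act D)"
  shows "comult (btens H C D) (x \<otimes> y) = sw (comult C x) (\<lambda>x1 x2. sw (comult D y) (\<lambda>y1 y2.
         sw (coact C x2) (\<lambda>a x20. (x1 \<otimes> act D (a \<otimes> y1)) \<otimes> (x20 \<otimes> y2))))"
  unfolding btens_def using assms by (simp add: tens_lift_tens lins)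

lemma lin_comult_btens: "lin (comult (btens H C D))"
  unfolding btens_def by (simp add: lins)
lemma lin_act_btens: "lin (act (btens H C D))"
  unfolding btens_def by (simp add: lins)
lemma lin_coact_btens: "lin (coact (btens H C D))"
  unfolding btens_def by (simp add: lins)
lemma lin_counit_btens: "linK (counit (btens H C D))"
  unfolding btens_def by (simp add: lins)
lemmas [lins] = lin_comult_btens lin_act_btens lin_coact_btens lin_counit_btens

lemma coact_btens_tens:
  assumes "lin (mulH H)" "lin (coact C)" "lin (coact D)"
  shows "coact (btens H C D) (x \<otimes> y) = sw (coact C x) (\<lambda>a x0. sw (coact D y) (\<lambda>b y0.
         (a \<bullet>\<^bsub>H\<^esub> b) \<otimes> x0 \<otimes> y0))"
  unfolding btens_def using assms by (simp add: tens_lift_tens lins)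
lemma act_btens_tens:
  assumes "lin (DeltaH H)" "lin (act C)" "lin (act D)"
  shows "act (btens H C D) (h \<otimes> x \<otimes> y) = sw (DeltaH H h) (\<lambda>h1 h2.
         act C (h1 \<otimes> x) \<otimes> act D (h2 \<otimes> y))"
  unfolding btens_def using assms by (simp add: tens_lift_tens lins)
lemma counit_btens_tens:
  assumes "linK (counit C)" "linK (counit D)"
  shows "counit (btens H C D) (x \<otimes> y) = counit C x * counit D y"
  unfolding btens_def using assms by (simp add: tens_lift_tens lins)

locale hopf_alg =
  fixes H :: "('h, 'k::field) hopf"
  assumes H: "hopf_algebra H"
begin

lemma hopf_facts: "lin (mulH H)" "coalgebra (DeltaH H) (epsH H)" "lin (DeltaH H)" "linK (epsH H)" "lin (antipode H)"
  using H by (simp_all add: hopf_algebra_def coalgebra_def)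

lemma mulH_assoc: "(x \<bullet>\<^bsub>H\<^esub> y) \<bullet>\<^bsub>H\<^esub> z = x \<bullet>\<^bsub>H\<^esub> (y \<bullet>\<^bsub>H\<^esub> z)"
  and mulH_one: "oneH H \<bullet>\<^bsub>H\<^esub> x = x" "x \<bullet>\<^bsub>H\<^esub> oneH H = x"
  and DeltaH_mult: "DeltaH H (x \<bullet>\<^bsub>H\<^esub> y) =
        sw (DeltaH H x) (\<lambda>x1 x2. sw (DeltaH H y) (\<lambda>y1 y2. (x1 \<bullet>\<^bsub>H\<^esub> y1) \<otimes> (x2 \<bullet>\<^bsub>H\<^esub> y2)))"
  and DeltaH_one: "DeltaH H (oneH H) = oneH H \<otimes> oneH H"
  and epsH_mult: "epsH H (x \<bullet>\<^bsub>H\<^esub> y) = epsH H x * epsH H y"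
  and epsH_one: "epsH H (oneH H) = 1"
  and antipode1: "sw (DeltaH H x) (\<lambda>x1 x2. antipode H x1 \<bullet>\<^bsub>H\<^esub> x2) = scl (epsH H x) (oneH H)"
  and antipode2: "sw (DeltaH H x) (\<lambda>x1 x2. x1 \<bullet>\<^bsub>H\<^esub> antipode H x2) = scl (epsH H x) (oneH H)"
  using H by (simp_all add: hopf_algebra_def)

lemmas hopf_simps = mulH_assoc mulH_one DeltaH_mult DeltaH_one epsH_mult epsH_one

lemma yd_facts:
  assumes "yd_coalgebra H R"
  shows "lin (act R)" "lin (coact R)" "lin (comult R)" "linK (counit R)"
    "coalgebra (comult R) (counit R)" "yd_module H R"
  using assms by (simp_all add: yd_coalgebra_def yd_module_def coalgebra_def)

lemma comodule_coassoc:
  assumes "yd_module H R" and s: "vector_space s"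
    and l: "\<And>b c. Vector_Spaces.linear scl s (\<lambda>a. F a b c)"
      "\<And>a c. Vector_Spaces.linear scl s (\<lambda>b. F a b c)"
      "\<And>a b. Vector_Spaces.linear scl s (\<lambda>c. F a b c)"
  shows "tens_lift s (coact R x) (\<lambda>a x0. tens_lift s (DeltaH H a) (\<lambda>a1 a2. F a1 a2 x0))
       = tens_lift s (coact R x) (\<lambda>a x0. tens_lift s (coact R x0) (\<lambda>b x00. F a b x00))"
proof -
  let ?T = "\<lambda>t. tens_lift s t (\<lambda>p q. tens_lift s q (\<lambda>b c. F p b c))"
  have T: "?T (a \<otimes> b \<otimes> c) = F a b c" for a b c
    by (simp add: tens_lift_tens lins s l)
  have eq: "sw (coact R v) (\<lambda>a v0. sw (DeltaH H a) (\<lambda>a1 a2. a1 \<otimes> a2 \<otimes> v0))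
        = sw (coact R v) (\<lambda>a v0. sw (coact R v0) (\<lambda>b v00. a \<otimes> b \<otimes> v00))" for v
    using assms(1) by (simp add: yd_module_def)
  from arg_cong[OF eq, of ?T] show ?thesis
    by (simp only: tens_lift_tens_lift[OF s] T)
qed

lemma comodule_counit:
  assumes "yd_module H R" and l: "Vector_Spaces.linear scl s F"
  shows "tens_lift s (coact R x) (\<lambda>x1 x2. s (epsH H x1) (F x2)) = F x"
proof -
  have "F x = F (sw (coact R x) (\<lambda>x1 x2. scl (epsH H x1) x2))"
    using assms(1) by (simp add: yd_module_def)
  also have "\<dots> = tens_lift s (coact R x) (\<lambda>x1 x2. s (epsH H x1) (F x2))"
    by (simp add: tens_lift_hom[OF l] linear_scale[OF l])
  finally show ?thesis ..
qed

lemmas comodule_counits = comodule_counit[where s=scl] comodule_counit[where s="(*)"]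

lemma counit_colinear:
  assumes "yd_coalgebra H R" and l: "Vector_Spaces.linear scl s F"
  shows "tens_lift s (coact R x) (\<lambda>a x0. s (counit R x0) (F a)) = s (counit R x) (F (oneH H))"
proof -
  have "F (sw (coact R x) (\<lambda>a x0. scl (counit R x0) a)) = F (scl (counit R x) (oneH H))"
    using assms(1) by (simp add: yd_coalgebra_def H_colinearK_def)
  then show ?thesis
    by (simp add: tens_lift_hom[OF l] linear_scale[OF l])
qed

lemmas counit_colinears = counit_colinear[where s=scl] counit_colinear[where s="(*)"]

lemma comult_colinear:
  assumes R: "yd_coalgebra H R" and s: "vector_space s"
    and l: "\<And>b c. Vector_Spaces.linear scl s (\<lambda>a. F a b c)"
      "\<And>a c. Vector_Spaces.linear scl s (\<lambda>b. F a b c)"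
      "\<And>a b. Vector_Spaces.linear scl s (\<lambda>c. F a b c)"
  shows "tens_lift s (coact R x) (\<lambda>a x0. tens_lift s (comult R x0) (\<lambda>u v. F a u v))
       = tens_lift s (comult R x) (\<lambda>x1 x2. tens_lift s (coact R x1) (\<lambda>a u. tens_lift s (coact R x2) (\<lambda>b v. F (a \<bullet>\<^bsub>H\<^esub> b) u v)))"
proof -
  let ?T = "\<lambda>t. tens_lift s t (\<lambda>p q. tens_lift s q (\<lambda>b c. F p b c))"
  have T: "?T (a \<otimes> b \<otimes> c) = F a b c" for a b c
    by (simp add: tens_lift_tens lins s l)
  have "coact (btens H R R) (comult R x) = sw (coact R x) (\<lambda>a x0. a \<otimes> comult R x0)"
    using R by (simp add: yd_coalgebra_def H_colinear_def)
  then have eq: "sw (coact R x) (\<lambda>a x0. sw (comult R x0) (\<lambda>u v. a \<otimes> u \<otimes> v))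
    = sw (comult R x) (\<lambda>x1 x2. sw (coact R x1) (\<lambda>a u. sw (coact R x2) (\<lambda>b v. (a \<bullet>\<^bsub>H\<^esub> b) \<otimes> u \<otimes> v)))"
    unfolding btens_def by (simp flip: tens_sw2 add: sw_tens)
  from arg_cong[OF eq, of ?T] show ?thesis
    by (simp only: tens_lift_tens_lift[OF s] T)
qed

lemmas ord_DeltaH = tens_lift_swap[where u="DeltaH HH u" and t="comult C t" for HH C t u] tens_lift_swap[where u="DeltaH HH u" and t="coact C t" for HH C t u]
lemmas ord_coact = tens_lift_swap[where u="comult D u" and t="coact C t" for D C t u]
lemmas ord_comult = tens_lift_swap[where u="comult D u" and t="comult C t" for D C t u]
lemmas mv_DeltaH = move_fst1[where f="DeltaH HH" and g="DeltaH HH" and ?u0.0="\<lambda>q. DeltaH HH (w q)" for HH w]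
  move_fst2[where f="DeltaH HH" and g="DeltaH HH" and ?u0.0="\<lambda>q. DeltaH HH (w q)" and ?u1.0="\<lambda>q c d. DeltaH HH (w1 q c d)" for HH w w1]
lemmas mv_comult = move_fst1[where f="comult C" and g="comult C" and ?u0.0="\<lambda>q. comult C (w q)" for C w]
  move_fst2[where f="comult C" and g="comult C" and ?u0.0="\<lambda>q. comult C (w q)" and ?u1.0="\<lambda>q c d. comult C (w1 q c d)" for C w w1]
lemmas mv_coact = tens_lift_swap[where t="comult D t" and u="coact C u" for D C t u]
  move_fst1[where f="comult D" and g="coact C" and ?u0.0="\<lambda>q. coact E (w q)" for C D E w]
  move_fst2[where f="comult D" and g="coact C" and ?u0.0="\<lambda>q. coact E (w q)" and ?u1.0="\<lambda>q c d. coact F (w1 q c d)" for C D E F w w1]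
lemmas mv = ord_DeltaH ord_coact mv_DeltaH mv_comult

text \<open>The smash coproduct. Coassociativity combines colinearity of the coproduct of
  \<open>R\<close>, the comodule axiom, and the compatibility of the action on \<open>C\<close> with
  coproducts; the counit laws use colinearity of the counit of \<open>R\<close>.\<close>

lemma T1_coassoc:
  assumes R: "yd_coalgebra H R" and C: "hmc H C"
  shows "coalgebra (comult (btens H R C)) (counit (btens H R C))"
proof -
  note lf = hopf_facts yd_facts[OF R]
  have C': "lin (act C)" "coalgebra (comult C) (counit C)" "lin (comult C)" "linK (counit C)"
   "\<And>g h v. act C (g \<otimes> act C (h \<otimes> v)) = act C ((g \<bullet>\<^bsub>H\<^esub> h) \<otimes> v)"
   "\<And>h c. comult C (act C (h \<otimes> c)) =
        sw (DeltaH H h) (\<lambda>h1 h2. sw (comult C c) (\<lambda>c1 c2. act C (h1 \<otimes> c1) \<otimes> act C (h2 \<otimes> c2)))"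
    "\<And>h c. counit C (act C (h \<otimes> c)) = epsH H h * counit C c" "\<And>v. act C (oneH H \<otimes> v) = v"
    using C by (simp_all add: hmc_def coalgebra_def)
  let ?D = "comult (btens H R C)" and ?e = "counit (btens H R C)"
  show ?thesis unfolding coalgebra_def
  proof (intro conjI allI)
    fix t
    show "sw (?D t) (\<lambda>x1 x2. sw (?D x1) (\<lambda>x11 x12. x11 \<otimes> x12 \<otimes> x2))
        = sw (?D t) (\<lambda>x1 x2. sw (?D x2) (\<lambda>x21 x22. x1 \<otimes> x21 \<otimes> x22))"
      apply (rule lin_ext_tens[where t=t and s=scl], simp add: lins lf C', simp add: lins lf C')
      apply (simp add: push comult_btens_tens lins lf C' coalg_coassoc[OF lf(10)] coalg_coassoc[OF C'(2)] comodule_coassoc comult_colinear[OF R] ord_comult[where D=C and C=R] mv hopf_simps)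
      by (simp add: lins mv_coact)
    show "sw (?D t) (\<lambda>x1 x2. scl (?e x1) x2) = t"
      apply (rule lin_ext_tens[where t=t and s=scl], simp add: lins lf C', simp add: lins lf C')
      apply (simp add: lins lf C' push comult_btens_tens counit_btens_tens)
      apply (simp add: lins lf C' mv lift_out coalg_counits[OF lf(10)] coalg_counits[OF C'(2)] comodule_counits[OF lf(11)] counit_colinears[OF R])
      done
      show "sw (?D t) (\<lambda>x1 x2. scl (?e x2) x1) = t"
      apply (rule lin_ext_tens[where t=t and s=scl], simp add: lins lf C', simp add: lins lf C')
      apply (simp add: lins lf C' push comult_btens_tens counit_btens_tens)
      apply (simp add: lins lf C' mv lift_out coalg_counits[OF lf(10)] coalg_counits[OF C'(2)] comodule_counits[OF lf(11)] counit_colinears[OF R])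
      done
  qed (auto simp: lins)
qed

end

context hopf_alg
begin

lemmas hf = hopf_facts
lemmas hs = hopf_simps

lemma antipode_cancel:
  assumes "Vector_Spaces.linear scl s G"
  shows "tens_lift s (DeltaH H x) (\<lambda>x1 x2. G (antipode H x1 \<bullet>\<^bsub>H\<^esub> x2)) = s (epsH H x) (G (oneH H))"
    "tens_lift s (DeltaH H x) (\<lambda>x1 x2. G (x1 \<bullet>\<^bsub>H\<^esub> antipode H x2)) = s (epsH H x) (G (oneH H))"
  using arg_cong[OF antipode1, of G x] arg_cong[OF antipode2, of G x]
  by (simp_all add: tens_lift_hom[OF assms] linear_scale[OF assms])

text \<open>The Yetter-Drinfeld condition with the antipode moved away: (h1 v)_{-1} h2 \<otimes> (h1
  v)_0 = h1 v_{-1} \<otimes> h2 v_0. The antipode of the third leg meets the fourth leg and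
  disappears.\<close>

lemma yd_free:
  assumes R: "yd_module H R" and s: "vector_space s"
    and l: "\<And>b. Vector_Spaces.linear scl s (\<lambda>a. F a b)" "\<And>a. Vector_Spaces.linear scl s (\<lambda>b. F a b)"
  shows "tens_lift s (DeltaH H h) (\<lambda>h1 h2. tens_lift s (coact R (act R (h1 \<otimes> v))) (\<lambda>b v0. F (b \<bullet>\<^bsub>H\<^esub> h2) v0))
    = tens_lift s (DeltaH H h) (\<lambda>h1 h2. tens_lift s (coact R v) (\<lambda>a v0. F (h1 \<bullet>\<^bsub>H\<^esub> a) (act R (h2 \<otimes> v0))))"
proof -
  have R': "lin (act R)" "lin (coact R)"
   and yd: "\<And>h v. coact R (act R (h \<otimes> v)) =
        sw (DeltaH H h) (\<lambda>h1 h'. sw (DeltaH H h') (\<lambda>h2 h3. sw (coact R v) (\<lambda>a v0.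
          (h1 \<bullet>\<^bsub>H\<^esub> a \<bullet>\<^bsub>H\<^esub> antipode H h3) \<otimes> act R (h2 \<otimes> v0))))"
    using R by (simp_all add: yd_module_def)
  note lf = R' hf l s
  have l1: "lin f \<Longrightarrow> Vector_Spaces.linear scl s (\<lambda>a. F (f a) b)" for f :: "('x \<Rightarrow>\<^sub>0 'k) \<Rightarrow> _" and b by (rule linear_comp[OF l(1)])
  have l2: "lin f \<Longrightarrow> Vector_Spaces.linear scl s (\<lambda>a. F b (f a))" for f :: "('x \<Rightarrow>\<^sub>0 'k) \<Rightarrow> _" and b by (rule linear_comp[OF l(2)])
  have c: "tens_lift s (DeltaH H u) (\<lambda>h3 h4. tens_lift s (coact R v) (\<lambda>a v0. F (h1 \<bullet>\<^bsub>H\<^esub> (a \<bullet>\<^bsub>H\<^esub> (antipode H h3 \<bullet>\<^bsub>H\<^esub> h4))) (act R (h2 \<otimes> v0))))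
    = s (epsH H u) (tens_lift s (coact R v) (\<lambda>a v0. F (h1 \<bullet>\<^bsub>H\<^esub> a) (act R (h2 \<otimes> v0))))" for u h1 h2
    by (subst antipode_cancel(1)[where G="\<lambda>u. tens_lift s (coact R v) (\<lambda>a v0. F (h1 \<bullet>\<^bsub>H\<^esub> (a \<bullet>\<^bsub>H\<^esub> u)) (act R (h2 \<otimes> v0)))"])
      (simp_all add: lins lf l1 l2 hs)
  have "tens_lift s (DeltaH H h) (\<lambda>h1 h2. tens_lift s (coact R (act R (h1 \<otimes> v))) (\<lambda>b v0. F (b \<bullet>\<^bsub>H\<^esub> h2) v0))
     = tens_lift s (DeltaH H h) (\<lambda>h1 h'. tens_lift s (DeltaH H h') (\<lambda>h2 h''. tens_lift s (DeltaH H h'') (\<lambda>h3 h4.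
       tens_lift s (coact R v) (\<lambda>a v0. F (h1 \<bullet>\<^bsub>H\<^esub> (a \<bullet>\<^bsub>H\<^esub> (antipode H h3 \<bullet>\<^bsub>H\<^esub> h4))) (act R (h2 \<otimes> v0))))))"
    by (simp add: yd push lins lf l1 l2 hs coalg_coassoc[OF hf(2)])
  also have "\<dots> = tens_lift s (DeltaH H h) (\<lambda>h1 h2. tens_lift s (coact R v) (\<lambda>a v0. F (h1 \<bullet>\<^bsub>H\<^esub> a) (act R (h2 \<otimes> v0))))"
    by (simp add: c coalg_counit2[where s=s, OF hf(2)] lins lf l1 l2)
  finally show ?thesis .
qed

lemma yd_free3:
  assumes R: "yd_module H R" and s: "vector_space s"
    and l: "\<And>b c. Vector_Spaces.linear scl s (\<lambda>a. F a b c)" "\<And>a c. Vector_Spaces.linear scl s (\<lambda>b. F a b c)"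
     "\<And>a b. Vector_Spaces.linear scl s (\<lambda>c. F a b c)"
  shows "tens_lift s (DeltaH H h) (\<lambda>h1 h'. tens_lift s (DeltaH H h') (\<lambda>h2 h3. tens_lift s (coact R (act R (h1 \<otimes> v))) (\<lambda>b v0. F (b \<bullet>\<^bsub>H\<^esub> h2) v0 h3)))
    = tens_lift s (DeltaH H h) (\<lambda>h1 h'. tens_lift s (DeltaH H h') (\<lambda>h2 h3. tens_lift s (coact R v) (\<lambda>a v0. F (h1 \<bullet>\<^bsub>H\<^esub> a) (act R (h2 \<otimes> v0)) h3)))"
proof -
  have R': "lin (act R)" "lin (coact R)" using R by (simp_all add: yd_module_def)
  note l' = linear_comp[OF l(1)] linear_comp[OF l(2)] linear_comp[OF l(3)]
  show ?thesis
    by (simp add: coalg_coassoc[OF hf(2), symmetric] s lins hf l l' R') (simp only: yd_free[OF R s l(1) l(2)])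
qed

lemma hmcD:
  assumes C: "hmc H C"
  shows "lin (act C)" "coalgebra (comult C) (counit C)" "lin (comult C)" "linK (counit C)"
   "\<And>g h v. act C (g \<otimes> act C (h \<otimes> v)) = act C ((g \<bullet>\<^bsub>H\<^esub> h) \<otimes> v)"
   "\<And>h c. comult C (act C (h \<otimes> c)) =
        sw (DeltaH H h) (\<lambda>h1 h2. sw (comult C c) (\<lambda>c1 c2. act C (h1 \<otimes> c1) \<otimes> act C (h2 \<otimes> c2)))"
    "\<And>h c. counit C (act C (h \<otimes> c)) = epsH H h * counit C c" "\<And>v. act C (oneH H \<otimes> v) = v"
    using C by (simp_all add: hmc_def coalgebra_def)

lemma yd_hmc:
  assumes R: "yd_coalgebra H R"
  shows "hmc H R"
proof -
  have "comult R (act R (h \<otimes> c)) =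
        sw (DeltaH H h) (\<lambda>h1 h2. sw (comult R c) (\<lambda>c1 c2. act R (h1 \<otimes> c1) \<otimes> act R (h2 \<otimes> c2)))" for h c
  proof -
    have "comult R (act R (h \<otimes> c)) = act (btens H R R) (h \<otimes> comult R c)"
      using R by (simp add: yd_coalgebra_def H_linear_def)
    also have "\<dots> = sw (comult R c) (\<lambda>c1 c2. sw (DeltaH H h) (\<lambda>h1 h2. act R (h1 \<otimes> c1) \<otimes> act R (h2 \<otimes> c2)))"
      unfolding btens_def by (simp add: lins tens_lift_tens yd_facts[OF R] hf)
    finally show ?thesis by (simp add: tens_lift_swap[OF vector_space_scl, of "comult R c"])
  qed
  then show ?thesis using R yd_facts[OF R]
    by (simp add: hmc_def yd_coalgebra_def yd_module_def H_linearK_def)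
qed

lemmas mv_DeltaH_in = tens_lift_swap[where t="DeltaH HH u" and u="comult C t" for HH C t u]

text \<open>The class of module coalgebras is closed under R \<otimes> -, so A, R \<otimes> A and
  all powers of R are obtained by iteration. The essential point is that the diagonal action
  respects the braided coproduct, which is the Yetter-Drinfeld condition in the form
  \<open>yd_free3\<close>.\<close>

lemma T1:
  assumes R: "yd_coalgebra H R" and C: "hmc H C"
  shows "hmc H (btens H R C)"
proof -
  note lf = hf yd_facts[OF R] hmcD[OF C] hmcD[OF yd_hmc[OF R]]
  let ?B = "btens H R C"
  have 1: "act ?B ((g \<bullet>\<^bsub>H\<^esub> h) \<otimes> v) = act ?B (g \<otimes> act ?B (h \<otimes> v))" for g h v
    by (rule lin_ext_tens[where t=v and s=scl]; simp add: lins lf push act_btens_tens hs tens_lift_swap[of scl "DeltaH H g"])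
  have 2: "act ?B (oneH H \<otimes> v) = v" for v
    by (rule lin_ext_tens[where t=v and s=scl]; simp add: lins lf push act_btens_tens hs)
  have 3: "counit ?B (act ?B (h \<otimes> c)) = epsH H h * counit ?B c" for h c
    apply (rule lin_ext_tens[where t=c and s="(*)"], simp add: lins lf, simp add: lins lf)
    apply (simp add: lins lf push act_btens_tens counit_btens_tens)
    by (simp add: mult.assoc lins lf coalg_counits[OF hf(2)])
  have st: "sw (DeltaH H h) (\<lambda>h1 h'. sw (DeltaH H h') (\<lambda>h2 h3. sw (coact R (act R (h1 \<otimes> v))) (\<lambda>b v0.
      (P \<otimes> act C (b \<bullet>\<^bsub>H\<^esub> h2 \<otimes> ac)) \<otimes> v0 \<otimes> act C (h3 \<otimes> ba))))
    = sw (DeltaH H h) (\<lambda>h1 h'. sw (DeltaH H h') (\<lambda>h2 h3. sw (coact R v) (\<lambda>a v0. (P \<otimes> act C (h1 \<bullet>\<^bsub>H\<^esub> a \<otimes> ac)) \<otimes> act R (h2 \<otimes> v0) \<otimes> act C (h3 \<otimes> ba))))" for h v P ac ba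
    by (rule yd_free3[where F="\<lambda>u v0 h3. (P \<otimes> act C (u \<otimes> ac)) \<otimes> v0 \<otimes> act C (h3 \<otimes> ba)"]) (simp_all add: lins lf)
  have 4: "comult ?B (act ?B (h \<otimes> c)) =
        sw (DeltaH H h) (\<lambda>h1 h2. sw (comult ?B c) (\<lambda>c1 c2. act ?B (h1 \<otimes> c1) \<otimes> act ?B (h2 \<otimes> c2)))" for h c
    apply (rule lin_ext_tens[where t=c and s=scl], simp add: lins lf, simp add: lins lf)
    apply (simp add: lins lf push act_btens_tens comult_btens_tens hs mv ord_comult[where D=C and C=R] coalg_coassoc[OF hf(2)])
    by (simp add: st lins mv_DeltaH_in)
  show ?thesis unfolding hmc_def using 1 2 3 4 T1_coassoc[OF R C] by (simp add: lins)
qed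

end

section \<open>Comparing ordinary tensor products over A with braided ones over R\<close>

abbreviation co :: "('h, 'c, 'k::field, 'z) ydcoalg_scheme \<Rightarrow> ('c, 'k) coalg" where
  "co C \<equiv> (comult C, counit C)"

text \<open>H as a module coalgebra under left multiplication; \<open>btens H R (Hreg H)\<close> is
  then the coalgebra underlying A.\<close>

definition Hreg :: "('h, 'k::field) hopf \<Rightarrow> ('h, 'h, 'k) ydcoalg" where
  "Hreg H = \<lparr> act = mulH H, coact = (\<lambda>_. 0), comult = DeltaH H, counit = epsH H \<rparr>"

lemma Hreg_sel: "act (Hreg H) = mulH H" "comult (Hreg H) = DeltaH H" "counit (Hreg H) = epsH H"
  by (simp_all add: Hreg_def)

text \<open>(r#h) \<otimes> c |-> r \<otimes> hc: the H-part of the first factor is spent by acting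
  on what stands to its right.\<close>

definition Nmap :: "('h, 'c, 'k::field, 'z) ydcoalg_scheme \<Rightarrow> (('r \<times> 'h) \<times> 'c \<Rightarrow>\<^sub>0 'k) \<Rightarrow> ('r \<times> 'c \<Rightarrow>\<^sub>0 'k)" where
  "Nmap C t = sw t (\<lambda>p c. sw p (\<lambda>r h. r \<otimes> act C (h \<otimes> c)))"

lemma lin_Nmap: "lin (Nmap C)" unfolding Nmap_def by (simp add: lins)
lemmas [lins] = lin_Nmap lin_Nmap[THEN linear_comp]

lemma Nmap_push[push]: "Nmap C (sw t F) = sw t (\<lambda>a b. Nmap C (F a b))" by (rule tens_lift_hom[OF lin_Nmap])

lemma Nmap_tens: "lin (act C) \<Longrightarrow> Nmap C ((r \<otimes> h) \<otimes> c) = r \<otimes> act C (h \<otimes> c)"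
  unfolding Nmap_def by (simp add: lins tens_lift_tens)

lemma ext2':
  assumes "Vector_Spaces.linear scl s f" "Vector_Spaces.linear scl s g" "\<And>x y z. f ((x \<otimes> y) \<otimes> z) = g ((x \<otimes> y) \<otimes> z)"
  shows "f t = g t"
proof (rule lin_ext_tens[OF assms(1,2)])
  fix u z
  show "f (u \<otimes> z) = g (u \<otimes> z)"
    by (rule lin_ext_tens[where s=s and t=u]) (simp_all add: assms(3) linear_comp[OF assms(1)] linear_comp[OF assms(2)] lins)
qed

context hopf_alg
begin

lemma hmc_Hreg: "hmc H (Hreg H)"
  unfolding hmc_def Hreg_sel by (simp add: hf hs)

lemma cog_co: "hmc H C \<Longrightarrow> cog (co C)" by (simp add: cog_def hmc_def)

text \<open>The coproduct of A multiplies r2_{-1} into the H-leg of its first part. Letting that leg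
  act on c1 produces the braiding, so the ordinary coalgebra A \<otimes> C maps onto the braided
  coalgebra R \<otimes> C.\<close>

lemma cmap_N:
  assumes R: "yd_coalgebra H R" and C: "hmc H C"
  shows "cmap (tco (co (btens H R (Hreg H))) (co C)) (co (btens H R C)) (Nmap C)"
proof -
  note lf = hf yd_facts[OF R] hmcD[OF C]
  note A = hmcD[OF T1[OF R hmc_Hreg]]
  note tens = tco_tens1 tco_tens2 Hreg_sel comult_btens_tens counit_btens_tens Nmap_tens
  show ?thesis unfolding cmap_def
  proof (intro conjI allI)
    show "snd (co (btens H R C)) (Nmap C t) = snd (tco (co (btens H R (Hreg H))) (co C)) t" for t
      by (rule ext2'[where t=t and s="(*)"]) (simp_all add: lins lf tens mult_ac)
    show "fst (co (btens H R C)) (Nmap C t) = sw (fst (tco (co (btens H R (Hreg H))) (co C)) t) (\<lambda>x1 x2. Nmap C x1 \<otimes> Nmap C x2)" for t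
      apply (rule ext2'[where t=t and s=scl], simp add: lins lf, simp add: lins lf)
      by (simp add: lins lf tens push mv ord_comult[where D=C and C=R])
  qed (simp add: lins)
qed

lemma Nmap_natural:
  assumes "lin f" "lin (act C)" "lin (act D)" "\<And>h c. f (act C (h \<otimes> c)) = act D (h \<otimes> f c)"
  shows "Nmap D (tm (\<lambda>x. x) f t) = tm (\<lambda>x. x) f (Nmap C t)"
  by (rule ext2'[where t=t and s=scl]) (simp_all add: lins assms linear_comp[OF assms(1)] Nmap_tens tm_tens)

lemma Nmap_act:
  assumes "lin (act R)" "hmc H C"
  shows "Nmap C (act (btens H R (Hreg H)) (h \<otimes> a) \<otimes> c) = act (btens H R C) (h \<otimes> Nmap C (a \<otimes> c))"
  using assms hmcD[OF assms(2)]
  by - (rule lin_ext_tens[where t=a and s=scl], simp_all add: lins hf Nmap_tens act_btens_tens push Hreg_sel)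

lemma RR_counit:
  assumes R: "yd_coalgebra H R" and l: "Vector_Spaces.linear scl s F"
  shows "tens_lift s (coact (btens H R R) x) (\<lambda>a x0. s (epsH H a) (F x0)) = F x"
proof -
  have 1: "sw (coact (btens H R R) x) (\<lambda>a x0. scl (epsH H a) x0) = x"
    by (rule lin_ext_tens[where t=x and s=scl])
     (simp_all add: lins hf yd_facts[OF R] push hs coact_btens_tens comodule_counits[OF yd_facts(6)[OF R]] lift_out)
  from arg_cong[OF this, of F] show ?thesis by (simp add: tens_lift_hom[OF l] linear_scale[OF l])
qed

text \<open>Colinearity of the braiding v \<otimes> w |-> v_{-1} w \<otimes> v_0: it is
  \<open>yd_free\<close> with h taken to be v_{-1}.\<close>

lemma yd_braid:
  assumes R: "yd_coalgebra H R" and s: "vector_space s"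
    and l: "\<And>b c. Vector_Spaces.linear scl s (\<lambda>a. K a b c)"
      "\<And>a c. Vector_Spaces.linear scl s (\<lambda>b. K a b c)"
      "\<And>a b. Vector_Spaces.linear scl s (\<lambda>c. K a b c)"
  shows "tens_lift s (coact R v) (\<lambda>c v0. tens_lift s (coact R (act R (c \<otimes> w))) (\<lambda>b w0. tens_lift s (coact R v0) (\<lambda>a v00. K (b \<bullet>\<^bsub>H\<^esub> a) w0 v00)))
    = tens_lift s (coact R v) (\<lambda>c v0. tens_lift s (coact R w) (\<lambda>b w0. tens_lift s (coact R v0) (\<lambda>a v00. K (c \<bullet>\<^bsub>H\<^esub> b) (act R (a \<otimes> w0)) v00)))"
proof -
  note lf = hf yd_facts[OF R] l l(1)[THEN linear_comp] l(2)[THEN linear_comp] l(3)[THEN linear_comp] s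
  note cc = comodule_coassoc[OF yd_facts(6)[OF R], symmetric]
  have "tens_lift s (coact R v) (\<lambda>c v0. tens_lift s (coact R (act R (c \<otimes> w))) (\<lambda>b w0. tens_lift s (coact R v0) (\<lambda>a v00. K (b \<bullet>\<^bsub>H\<^esub> a) w0 v00)))
    = tens_lift s (coact R v) (\<lambda>c v0. tens_lift s (coact R v0) (\<lambda>a v00. tens_lift s (coact R (act R (c \<otimes> w))) (\<lambda>b w0. K (b \<bullet>\<^bsub>H\<^esub> a) w0 v00)))"
    by (subst (2) tens_lift_swap[OF s]) (rule refl)
  also have "\<dots> = tens_lift s (coact R v) (\<lambda>c v0. tens_lift s (DeltaH H c) (\<lambda>c a. tens_lift s (coact R (act R (c \<otimes> w))) (\<lambda>b w0. K (b \<bullet>\<^bsub>H\<^esub> a) w0 v0)))"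
    by (rule cc) (simp_all add: lins lf)
  also have "\<dots> = tens_lift s (coact R v) (\<lambda>c v0. tens_lift s (DeltaH H c) (\<lambda>c a. tens_lift s (coact R w) (\<lambda>b w0. K (c \<bullet>\<^bsub>H\<^esub> b) (act R (a \<otimes> w0)) v0)))"
    by (simp only: yd_free[OF yd_facts(6)[OF R] s l(1,2)])
  also have "\<dots> = tens_lift s (coact R v) (\<lambda>c v0. tens_lift s (coact R v0) (\<lambda>a v00. tens_lift s (coact R w) (\<lambda>b w0. K (c \<bullet>\<^bsub>H\<^esub> b) (act R (a \<otimes> w0)) v00)))"
    by (rule cc[symmetric]) (simp_all add: lins lf)
  also have "\<dots> = tens_lift s (coact R v) (\<lambda>c v0. tens_lift s (coact R w) (\<lambda>b w0. tens_lift s (coact R v0) (\<lambda>a v00. K (c \<bullet>\<^bsub>H\<^esub> b) (act R (a \<otimes> w0)) v00)))"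
    by (subst (2) tens_lift_swap[OF s]) (rule refl)
  finally show ?thesis .
qed

text \<open>The braided coproduct of R \<otimes> R is built from the coproduct of R and the
  braiding, which are both colinear.\<close>

lemma RR_colinear:
  assumes R: "yd_coalgebra H R" and s: "vector_space s"
    and l: "\<And>b c. Vector_Spaces.linear scl s (\<lambda>a. F a b c)"
      "\<And>a c. Vector_Spaces.linear scl s (\<lambda>b. F a b c)"
      "\<And>a b. Vector_Spaces.linear scl s (\<lambda>c. F a b c)"
  shows "tens_lift s (coact (btens H R R) x) (\<lambda>a x0. tens_lift s (comult (btens H R R) x0) (\<lambda>u v. F a u v))
       = tens_lift s (comult (btens H R R) x) (\<lambda>x1 x2. tens_lift s (coact (btens H R R) x1) (\<lambda>a u. tens_lift s (coact (btens H R R) x2) (\<lambda>b v. F (a \<bullet>\<^bsub>H\<^esub> b) u v)))"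
proof -
  note lf = hf yd_facts[OF R] l l(1)[THEN linear_comp] l(2)[THEN linear_comp] l(3)[THEN linear_comp] s
  have st: "tens_lift s (coact R v) (\<lambda>c v0. tens_lift s (coact R (act R (c \<otimes> w))) (\<lambda>b w0. tens_lift s (coact R v0) (\<lambda>a v00.
       tens_lift s (coact R q) (\<lambda>ac ba. F (d \<bullet>\<^bsub>H\<^esub> (b \<bullet>\<^bsub>H\<^esub> (a \<bullet>\<^bsub>H\<^esub> ac))) (bb \<otimes> w0) (v00 \<otimes> ba)))))
    = tens_lift s (coact R v) (\<lambda>c v0. tens_lift s (coact R w) (\<lambda>b w0. tens_lift s (coact R v0) (\<lambda>a v00.
       tens_lift s (coact R q) (\<lambda>ac ba. F (d \<bullet>\<^bsub>H\<^esub> (c \<bullet>\<^bsub>H\<^esub> (b \<bullet>\<^bsub>H\<^esub> ac))) (bb \<otimes> act R (a \<otimes> w0)) (v00 \<otimes> ba)))))" for d w bb q v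
    using yd_braid[OF R s, of "\<lambda>u w0 v00. tens_lift s (coact R q) (\<lambda>ac ba. F (d \<bullet>\<^bsub>H\<^esub> (u \<bullet>\<^bsub>H\<^esub> ac)) (bb \<otimes> w0) (v00 \<otimes> ba))" v w]
    by (simp add: lins lf hs)
  show ?thesis
  proof (rule lin_ext_tens[where t=x and s=s], simp add: lins lf, simp add: lins lf)
    fix x y
    show "tens_lift s (coact (btens H R R) (x \<otimes> y)) (\<lambda>a x0. tens_lift s (comult (btens H R R) x0) (\<lambda>u v. F a u v))
       = tens_lift s (comult (btens H R R) (x \<otimes> y)) (\<lambda>x1 x2. tens_lift s (coact (btens H R R) x1) (\<lambda>a u. tens_lift s (coact (btens H R R) x2) (\<lambda>b v. F (a \<bullet>\<^bsub>H\<^esub> b) u v)))"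
      apply (simp add: lins lf push coact_btens_tens comult_btens_tens)
      apply (simp add: lins lf push hs mv comult_colinear[OF R])
      apply (simp add: lins lf mv_coact)
      apply (simp add: lins lf st tens_lift_swap[where t="coact R t" and u="comult R y" for t])
      apply (simp add: lins lf mv_coact)
      by (simp only: move_snd3[OF s, where f="coact R" and g="coact R"] move_snd2[OF s, where f="coact R" and g="coact R"])
  qed
qed

end

section \<open>The product of A and its associativity, with R \<otimes> (R \<otimes> C) read as (R
  \<otimes> R) \<otimes> C\<close>

definition io :: "('a \<times> 'b \<Rightarrow>\<^sub>0 'k::field) \<Rightarrow> ('c \<Rightarrow>\<^sub>0 'k) \<Rightarrow> ('a \<times> 'b \<times> 'c \<Rightarrow>\<^sub>0 'k)" where
  "io z h = sw z (\<lambda>r s. r \<otimes> s \<otimes> h)"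

lemma io_lins[lins]: "lin f \<Longrightarrow> lin (\<lambda>x. io (f x) h)" "lin f2 \<Longrightarrow> lin (\<lambda>x. io z (f2 x))"  "lin (io z)"
  unfolding io_def by (simp_all add: lins)
lemma io_tens: "io (r \<otimes> s) h = r \<otimes> s \<otimes> h" unfolding io_def by (simp add: lins tens_lift_tens)
lemma io_push[push]: "io (sw t F) h = sw t (\<lambda>a b. io (F a b) h)" "io z (sw t2 F2) = sw t2 (\<lambda>a b. io z (F2 a b))"
  by (rule tens_lift_hom, simp add: lins)+

lemma io_ext:
  assumes f: "Vector_Spaces.linear scl s f" and g: "Vector_Spaces.linear scl s g" and "\<And>z h. f (io z h) = g (io z h)"
  shows "f t = g t"
  by (rule ext3[OF f g]) (simp add: assms(3) flip: io_tens)

locale pbc = hopf_alg H for H :: "('h, 'k::field) hopf" +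
  fixes R :: "('h, 'r, 'k) ydcoalg" and e m \<xi>
  assumes pre: "pre_bialgebra H R e m" and coc: "cocycle H R e m \<xi>"
begin

abbreviation "RR \<equiv> btens H R R"
abbreviation "A \<equiv> btens H R (Hreg H)"
abbreviation "RA \<equiv> btens H R A"

lemma R: "yd_coalgebra H R" using pre by (simp add: pre_bialgebra_def)
lemma hRR: "hmc H RR" by (rule T1[OF R yd_hmc[OF R]])
lemma hA: "hmc H A" by (rule T1[OF R hmc_Hreg])
lemma hRA: "hmc H RA" by (rule T1[OF R hA])
lemmas RRc = hmcD[OF hRR]
lemmas Ac = hmcD[OF hA]

lemma lin_m: "lin m" and m_act: "m (act RR (h \<otimes> z)) = act R (h \<otimes> m z)"
  and comult_m: "comult R (m z) = sw (comult RR z) (\<lambda>z1 z2. m z1 \<otimes> m z2)"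
  and counit_m: "counit R (m z) = counit RR z"
  and m_one: "m (r \<otimes> e) = r" "m (e \<otimes> r) = r"
  using pre by (simp_all add: pre_bialgebra_def H_linear_def coalgebra_hom_def)

lemma e_facts: "act R (h \<otimes> e) = scl (epsH H h) e" "coact R e = oneH H \<otimes> e" "comult R e = e \<otimes> e" "counit R e = 1"
  using pre by (simp_all add: pre_bialgebra_def coaugmentation_def)

lemma lin_\<xi>: "lin \<xi>"
  and \<xi>_act: "\<xi> (act RR (h \<otimes> z)) = sw (DeltaH H h) (\<lambda>h1 h2. h1 \<bullet>\<^bsub>H\<^esub> \<xi> z \<bullet>\<^bsub>H\<^esub> antipode H h2)"
  and Delta_\<xi>: "DeltaH H (\<xi> z) =
        sw (comult RR z) (\<lambda>z1 z2. sw (coact RR z2) (\<lambda>a z20. (\<xi> z1 \<bullet>\<^bsub>H\<^esub> a) \<otimes> \<xi> z20))"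
  and eps_\<xi>: "epsH H (\<xi> z) = counit RR z"
  and c3: "sw (comult RR z) (\<lambda>z1 z2. sw (coact R (m z1)) (\<lambda>a r0. (a \<bullet>\<^bsub>H\<^esub> \<xi> z2) \<otimes> r0))
        = sw (comult RR z) (\<lambda>z1 z2. sw (coact RR z2) (\<lambda>a z20. (\<xi> z1 \<bullet>\<^bsub>H\<^esub> a) \<otimes> m z20))"
  and c4: "m (r \<otimes> m (s \<otimes> t)) =
        sw (comult RR (r \<otimes> s)) (\<lambda>z1 z2. m (m z1 \<otimes> act R (\<xi> z2 \<otimes> t)))"
  and c5: "sw (comult RR (s \<otimes> t)) (\<lambda>w1 w2. \<xi> (r \<otimes> m w1) \<bullet>\<^bsub>H\<^esub> \<xi> w2) =
        sw (comult RR (r \<otimes> s)) (\<lambda>z1 z2. sw (DeltaH H (\<xi> z2)) (\<lambda>a b.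
          \<xi> (m z1 \<otimes> act R (a \<otimes> t)) \<bullet>\<^bsub>H\<^esub> b))"
  and \<xi>_one: "\<xi> (r \<otimes> e) = scl (counit R r) (oneH H)" "\<xi> (e \<otimes> r) = scl (counit R r) (oneH H)"
  using coc unfolding cocycle_def Let_def by blast+

lemmas [lins] = lin_m[THEN linear_comp] lin_\<xi>[THEN linear_comp]
lemmas lm = lin_m lin_\<xi>

lemma m_push[push]: "m (sw t F) = sw t (\<lambda>a b. m (F a b))" by (rule tens_lift_hom[OF lin_m])
lemma \<xi>_push[push]: "\<xi> (sw t F) = sw t (\<lambda>a b. \<xi> (F a b))" by (rule tens_lift_hom[OF lin_\<xi>])

lemmas lf = hf yd_facts[OF R] RRc(1,3,4) lin_coact_btens[of H R R] lm vector_space_scl vector_space_field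

text \<open>The equivariance \<open>\<xi>_act\<close> without the antipode: \<xi>(h1 z) h2 = h
  \<xi>(z).\<close>

lemma \<xi>_act_free:
  assumes F: "Vector_Spaces.linear scl s F"
  shows "tens_lift s (DeltaH H h) (\<lambda>h1 h2. F (\<xi> (act RR (h1 \<otimes> z)) \<bullet>\<^bsub>H\<^esub> h2)) = F (h \<bullet>\<^bsub>H\<^esub> \<xi> z)"
proof -
  have "sw (DeltaH H h) (\<lambda>h1 h2. \<xi> (act RR (h1 \<otimes> z)) \<bullet>\<^bsub>H\<^esub> h2)
    = sw (DeltaH H h) (\<lambda>h1 h'. sw (DeltaH H h') (\<lambda>h2 h3. h1 \<bullet>\<^bsub>H\<^esub> (\<xi> z \<bullet>\<^bsub>H\<^esub> (antipode H h2 \<bullet>\<^bsub>H\<^esub> h3))))"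
    by (simp add: \<xi>_act push lins lf hs coalg_coassoc[OF hf(2)])
  also have "\<dots> = sw (DeltaH H h) (\<lambda>h1 h'. scl (epsH H h') (h1 \<bullet>\<^bsub>H\<^esub> (\<xi> z \<bullet>\<^bsub>H\<^esub> oneH H)))"
    by (subst antipode_cancel(1)[where G="\<lambda>u. k \<bullet>\<^bsub>H\<^esub> (\<xi> z \<bullet>\<^bsub>H\<^esub> u)" for k]) (simp_all add: lins lf)
  also have "\<dots> = h \<bullet>\<^bsub>H\<^esub> \<xi> z" by (simp add: hs coalg_counits[OF hf(2)] lins lf)
  finally show ?thesis by (simp flip: tens_lift_hom[OF F])
qed

lemma c3':
  assumes s: "vector_space s" and l: "\<And>b c. Vector_Spaces.linear scl s (\<lambda>a. K a b c)"
      "\<And>a c. Vector_Spaces.linear scl s (\<lambda>b. K a b c)"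
      "\<And>a b. Vector_Spaces.linear scl s (\<lambda>c. K a b c)"
  shows "tens_lift s (comult RR z) (\<lambda>z2 z'. tens_lift s (comult RR z') (\<lambda>z3 z4. tens_lift s (coact R (m z2)) (\<lambda>a r0. K (a \<bullet>\<^bsub>H\<^esub> \<xi> z3) r0 z4)))
   = tens_lift s (comult RR z) (\<lambda>z2 z'. tens_lift s (comult RR z') (\<lambda>z3 z4. tens_lift s (coact RR z3) (\<lambda>b z30. K (\<xi> z2 \<bullet>\<^bsub>H\<^esub> b) (m z30) z4)))"
proof -
  note l' = lf l l[THEN linear_comp] s
  have 1: "tens_lift s (comult RR z) (\<lambda>z1 z2. tens_lift s (coact R (m z1)) (\<lambda>a r0. K (a \<bullet>\<^bsub>H\<^esub> \<xi> z2) r0 w))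
        = tens_lift s (comult RR z) (\<lambda>z1 z2. tens_lift s (coact RR z2) (\<lambda>a z20. K (\<xi> z1 \<bullet>\<^bsub>H\<^esub> a) (m z20) w))" for z w
    using arg_cong[OF c3[of z], of "\<lambda>t. tens_lift s t (\<lambda>a b. K a b w)"] by (simp add: tens_lift_tens_lift tens_lift_tens l' lins)
  show ?thesis
    by (subst (1 2) coalg_coassoc[OF RRc(2), symmetric]) (simp_all add: l' lins 1)
qed

text \<open>z \<otimes> c |-> m(z1) \<otimes> \<xi>(z2) c for z in R \<otimes> R. For C = R it is (m
  \<otimes> R)\<Phi>(\<xi>), the map that replaces m \<otimes> R in the associativity law
  \<open>c4\<close>; for C = H it is the product (r#1)(s#l) of A.\<close>

definition Th :: "('h, 'c, 'k, 'z) ydcoalg_scheme \<Rightarrow> ('r \<times> 'r \<times> 'c \<Rightarrow>\<^sub>0 'k) \<Rightarrow> ('r \<times> 'c \<Rightarrow>\<^sub>0 'k)" where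
  "Th C t = sw t (\<lambda>r p. sw p (\<lambda>s c. sw (comult RR (r \<otimes> s)) (\<lambda>z1 z2. m z1 \<otimes> act C (\<xi> z2 \<otimes> c))))"

lemma lin_Th: "lin (Th C)" unfolding Th_def[abs_def] by (simp add: lins)
lemmas [lins] = lin_Th lin_Th[THEN linear_comp]
lemma Th_push[push]: "Th C (sw t F) = sw t (\<lambda>a b. Th C (F a b))" by (rule tens_lift_hom[OF lin_Th])

lemma Th_io: "lin (act C) \<Longrightarrow> Th C (io z h) = sw (comult RR z) (\<lambda>z1 z2. m z1 \<otimes> act C (\<xi> z2 \<otimes> h))"
  by (rule lin_ext_tens[where t=z and s=scl]) (simp_all add: io_tens Th_def tens_lift_tens lins lf)

lemma RRC_comult:
  assumes C: "hmc H C"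
  shows "comult (btens H R (btens H R C)) (io z c) = sw (comult RR z) (\<lambda>z1 z2. sw (coact RR z2) (\<lambda>a z20. sw (comult C c) (\<lambda>c1 c2. io z1 (act C (a \<otimes> c1)) \<otimes> io z20 c2)))"
proof -
  note lC = lf hmcD[OF C]
  show ?thesis
    apply (rule lin_ext_tens[where t=z and s=scl], simp add: lins lC, simp add: lins lC)
    subgoal for x y
      apply (simp add: io_tens comult_btens_tens coact_btens_tens act_btens_tens lins lC push mv comodule_coassoc[OF yd_facts(6)[OF R]] hs
        tens_lift_swap[where t="comult R x" and u="comult R y"] tens_lift_swap[where t="comult R x" and u="comult C c"] tens_lift_swap[where t="comult R y" and u="comult C c"])
      apply (simp add: lins lC mv_coact)
      by (simp only: move_snd3[OF vector_space_scl, where f="comult R" and g="coact R"])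
    done
qed

lemma RRC_counit: "linK (counit C) \<Longrightarrow> counit (btens H R (btens H R C)) (io z h) = counit RR z * counit C h"
  by (rule lin_ext_tens[where t=z and s="(*)"]) (simp_all add: io_tens counit_btens_tens lins lf mult_ac)

lemma RRC_act:
  assumes C: "hmc H C"
  shows "act (btens H R (btens H R C)) (h \<otimes> io z c) = sw (DeltaH H h) (\<lambda>h1 h2. io (act RR (h1 \<otimes> z)) (act C (h2 \<otimes> c)))"
proof -
  note lC = lf hmcD[OF C]
  show ?thesis
    by (rule lin_ext_tens[where t=z and s=scl]) (simp_all add: io_tens act_btens_tens lins lC push coalg_coassoc[OF hf(2)])
qed

text \<open>Besides m being a coalgebra map, this uses \<open>Delta_\<xi>\<close> to split \<xi>(z2)
  and \<open>c3\<close> to exchange the coaction on m(z1) with the coaction on z.\<close>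

lemma cmap_Th:
  assumes C: "hmc H C"
  shows "cmap (co (btens H R (btens H R C))) (co (btens H R C)) (Th C)"
  unfolding cmap_def
proof (intro conjI allI)
  note lC = lf hmcD[OF C]
  show "lin (Th C)" by (simp add: lins)
  show "snd (co (btens H R C)) (Th C t) = snd (co (btens H R (btens H R C))) t" for t
    apply (rule io_ext[where t=t and s="(*)"], simp add: lins lC, simp add: lins lC)
    apply (simp add: Th_io RRC_counit counit_btens_tens push lins lC counit_m eps_\<xi>)
    by (simp add: lift_out coalg_counits[OF RRc(2)] lins lC)
  \<comment> \<open>The exchange condition \<open>c3\<close>, applied to two consecutive legs of an
    iterated coproduct.\<close>
  have st: "sw (comult RR z) (\<lambda>z2 z'. sw (comult RR z') (\<lambda>z3 z4. sw (coact R (m z2)) (\<lambda>a r0.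
       sw (coact RR z4) (\<lambda>b z40. (P \<otimes> (act C (a \<bullet>\<^bsub>H\<^esub> (\<xi> z3 \<bullet>\<^bsub>H\<^esub> b) \<otimes> h1))) \<otimes> (r0 \<otimes> act C (\<xi> z40 \<otimes> h2))))))
    = sw (comult RR z) (\<lambda>z2 z'. sw (comult RR z') (\<lambda>z3 z4. sw (coact RR z3) (\<lambda>a z30.
       sw (coact RR z4) (\<lambda>b z40. (P \<otimes> act C (\<xi> z2 \<bullet>\<^bsub>H\<^esub> (a \<bullet>\<^bsub>H\<^esub> b) \<otimes> h1)) \<otimes> (m z30 \<otimes> act C (\<xi> z40 \<otimes> h2))))))" for z P h1 h2
    using c3'[OF vector_space_scl, of "\<lambda>u r0 z4. sw (coact RR z4) (\<lambda>b z40. (P \<otimes> act C (u \<bullet>\<^bsub>H\<^esub> b \<otimes> h1)) \<otimes> (r0 \<otimes> (act C (\<xi> z40 \<otimes> h2))))" z]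
    by (simp add: lins lC hs)
  show "fst (co (btens H R C)) (Th C t) = sw (fst (co (btens H R (btens H R C))) t) (\<lambda>x1 x2. Th C x1 \<otimes> Th C x2)" for t
    apply (rule io_ext[where t=t and s=scl], simp add: lins lC, simp add: lins lC)
    subgoal for z c
    apply (simp add: Th_io RRC_comult[OF C] comult_btens_tens push lins lC hs comult_m Delta_\<xi> mv coalg_coassoc[OF RRc(2)] RR_colinear[OF R]
      tens_lift_swap[where t="comult R t" and u="comult C c" for t] tens_lift_swap[where t="comult RR t" and u="comult C c" for t])
    by (simp add: st lins lC tens_lift_swap[where t="coact RR t" and u="coact R u" for t u])
  done
qed

text \<open>H-linearity: m is H-linear, and \<xi>(h2 z2) h3 becomes h2 \<xi>(z2) by
  \<open>\<xi>_act_free\<close>.\<close>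

lemma Th_act:
  assumes C: "hmc H C"
  shows "Th C (act (btens H R (btens H R C)) (h \<otimes> t)) = act (btens H R C) (h \<otimes> Th C t)"
proof -
  note lC = lf hmcD[OF C] hmcD[OF hRR]
  have st: "sw (DeltaH H h) (\<lambda>h1 h'. sw (DeltaH H h') (\<lambda>h2 h3. P h1 \<otimes> act C (\<xi> (act RR (h2 \<otimes> z)) \<bullet>\<^bsub>H\<^esub> h3 \<otimes> c)))
    = sw (DeltaH H h) (\<lambda>h1 h2. P h1 \<otimes> act C (h2 \<bullet>\<^bsub>H\<^esub> \<xi> z \<otimes> c))" for h z c and P :: "_ \<Rightarrow> ('r \<Rightarrow>\<^sub>0 'k)"
    by (subst \<xi>_act_free[where F="\<lambda>u. P h1 \<otimes> act C (u \<otimes> c)" for h1]) (simp_all add: lins lC)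
  show ?thesis
    apply (rule io_ext[where t=t and s=scl], simp add: lins lC, simp add: lins lC)
    apply (simp add: Th_io RRC_act[OF C] act_btens_tens push lins lC hs m_act mv coalg_coassoc[OF hf(2)])
    by (simp add: st lins lC mv_DeltaH_in)
qed

abbreviation "Mh \<equiv> Th (Hreg H)"
text \<open>(r#h)(s#l) = (r#1)(h(s#l)), with h acting diagonally on R \<otimes> H. Written this way
  the product is a composite of two coalgebra maps.\<close>

definition "mA t = Mh (Nmap A t)"

lemma lin_mA: "lin mA" unfolding mA_def[abs_def] by (simp add: lins)
lemmas [lins] = lin_mA lin_mA[THEN linear_comp]

lemma cmap_bt:
  assumes C: "hmc H C" and D: "hmc H D" and f: "cmap (co C) (co D) f" and l: "\<And>h c. f (act C (h \<otimes> c)) = act D (h \<otimes> f c)"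
  shows "cmap (co (btens H R C)) (co (btens H R D)) (tm (\<lambda>x. x) f)"
proof -
  note lC = lf hmcD(1-4)[OF C] hmcD(1-4)[OF D] cmapD(1)[OF f] cmapD'[OF f] cmapD(2)[OF f, unfolded fst_conv] cmapD(3)[OF f, unfolded snd_conv] l
  show ?thesis unfolding cmap_def
  proof (intro conjI allI)
    show "snd (co (btens H R D)) (tm (\<lambda>x. x) f t) = snd (co (btens H R C)) t" for t
      by (rule lin_ext_tens[where t=t and s="(*)"]) (simp_all add: lins lC tm_tens counit_btens_tens)
    show "fst (co (btens H R D)) (tm (\<lambda>x. x) f t) = sw (fst (co (btens H R C)) t) (\<lambda>x1 x2. tm (\<lambda>x. x) f x1 \<otimes> tm (\<lambda>x. x) f x2)" for t
      by (rule lin_ext_tens[where t=t and s="scl"]) (simp_all add: lins lC tm_tens comult_btens_tens push)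
  qed (simp add: lins)
qed

text \<open>\<open>mb\<close> and \<open>xh\<close> are the composites of \<open>Mh\<close> with r#h
  |-> \<epsilon>(h) r and r#h |-> \<epsilon>(r) h.\<close>

definition "mb t = sw t (\<lambda>r p. sw p (\<lambda>s h. scl (epsH H h) (m (r \<otimes> s))))"
definition "xh t = sw t (\<lambda>r p. sw p (\<lambda>s h. \<xi> (r \<otimes> s) \<bullet>\<^bsub>H\<^esub> h))"

lemma lin_mb: "lin mb" "lin xh" unfolding mb_def[abs_def] xh_def[abs_def] by (simp_all add: lins)
lemmas [lins] = lin_mb lin_mb[THEN linear_comp]
lemma mb_push[push]: "mb (sw t F) = sw t (\<lambda>a b. mb (F a b))" "xh (sw t F) = sw t (\<lambda>a b. xh (F a b))" by (rule tens_lift_hom[OF lin_mb(1)], rule tens_lift_hom[OF lin_mb(2)])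
lemma mb_io: "mb (io z h) = scl (epsH H h) (m z)"
  by (rule lin_ext_tens[where t=z and s=scl]) (simp_all add: io_tens mb_def tens_lift_tens lins lf)
lemma xh_io: "xh (io z h) = \<xi> z \<bullet>\<^bsub>H\<^esub> h"
  by (rule lin_ext_tens[where t=z and s=scl]) (simp_all add: io_tens xh_def tens_lift_tens lins lf)

lemma Th_tens: "lin (act C) \<Longrightarrow> Th C (r \<otimes> s \<otimes> c) = sw (comult RR (r \<otimes> s)) (\<lambda>z1 z2. m z1 \<otimes> act C (\<xi> z2 \<otimes> c))"
  using Th_io[of C "r \<otimes> s" c] by (simp add: io_tens)
lemma mb_tens: "mb (r \<otimes> s \<otimes> h) = scl (epsH H h) (m (r \<otimes> s))" "xh (r \<otimes> s \<otimes> h) = \<xi> (r \<otimes> s) \<bullet>\<^bsub>H\<^esub> h"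
  using mb_io[of "r \<otimes> s" h] xh_io[of "r \<otimes> s" h] by (simp_all add: io_tens)

text \<open>An element y of R#H is recovered from its coproduct by applying id \<otimes> \<epsilon>
  to y1 and \<epsilon> \<otimes> id to y2. So a coalgebra map into A is determined by its two
  components.\<close>

lemma Mh_decomp: "Mh t = sw (comult RA t) (\<lambda>u v. mb u \<otimes> xh v)"
  apply (rule io_ext[where t=t and s=scl], simp add: lins lf, simp add: lins lf)
  apply (simp add: Th_io mb_io xh_io RRC_comult[OF hmc_Hreg] Hreg_sel push lins lf hs)
  by (simp add: lins lf coalg_counits[OF hf(2)] RR_counit[where s=scl, OF R] mv_DeltaH_in lift_out)

text \<open>Both sides are \<open>Mh\<close> after a coalgebra map, so by \<open>Mh_decomp\<close>
  it suffices to compare components: the R-component is \<open>c4\<close> and the H-component is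
  \<open>c5\<close>.\<close>

lemma Mh_assoc: "Mh (tm (\<lambda>x. x) Mh t) = Mh (Th A t)"
proof -
  let ?Y = "btens H R RA"
  have c1: "cmap (co ?Y) (co RA) (tm (\<lambda>x. x) Mh)"
    by (rule cmap_bt) (simp_all add: hRA hA cmap_Th hmc_Hreg Th_act)
  have c2: "cmap (co ?Y) (co RA) (Th A)" by (rule cmap_Th[OF hA])
  have d: "Mh (F t) = sw (comult ?Y t) (\<lambda>u v. mb (F u) \<otimes> xh (F v))" if "cmap (co ?Y) (co RA) F" for F
    unfolding Mh_decomp cmapD(2)[OF that, unfolded fst_conv] by (simp add: push lins)
  note t = Th_tens mb_tens tm_tens act_btens_tens Hreg_sel counit_btens_tens
  have 1: "mb (tm (\<lambda>x. x) Mh u) = mb (Th A u)" for u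
    apply (rule ext4[where t=u and s=scl], simp add: lins, simp add: lins)
    apply (simp add: t push lins lf hs Ac(1) eps_\<xi>)
    by (simp add: lift_out coalg_counits[OF RRc(2)] coalg_counits[OF hf(2)] lins lf c4)
  have 2: "xh (tm (\<lambda>x. x) Mh u) = xh (Th A u)" for u
    apply (rule ext4[where t=u and s=scl], simp add: lins, simp add: lins)
    subgoal for r s p k
    using arg_cong[OF c5[of s p r], of "\<lambda>u. u \<bullet>\<^bsub>H\<^esub> k"]
    by (simp add: t push lins lf hs Ac(1))
    done
  show ?thesis unfolding d[OF c1] d[OF c2] 1 2 ..
qed

text \<open>H-linearity of \<open>Mh\<close> moves the H-part of the first factor outside; what is
  left is the case of a first factor r#1, which is \<open>Mh_assoc\<close>.\<close>

lemma mA_assoc: "mA (mA (a \<otimes> b) \<otimes> c) = mA (a \<otimes> mA (b \<otimes> c))"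
proof -
  have *: "Mh (Nmap A (Mh (r \<otimes> b') \<otimes> c)) = Mh (r \<otimes> Mh (Nmap A (b' \<otimes> c)))" for r b'
  proof (rule lin_ext_tens[where t=b' and s=scl], simp add: lins, simp add: lins)
    fix s l
    have "Mh (r \<otimes> Mh (Nmap A ((s \<otimes> l) \<otimes> c))) = Mh (Th A (r \<otimes> s \<otimes> act A (l \<otimes> c)))"
      using Mh_assoc[of "r \<otimes> s \<otimes> act A (l \<otimes> c)"] by (simp add: tm_tens lins Nmap_tens Ac(1))
    then show "Mh (Nmap A (Mh (r \<otimes> (s \<otimes> l)) \<otimes> c)) = Mh (r \<otimes> Mh (Nmap A ((s \<otimes> l) \<otimes> c)))"
      by (simp add: Th_tens Nmap_tens lins lf Ac Hreg_sel push)
  qed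
  show ?thesis
    apply (rule lin_ext_tens[where t=a and s=scl], simp add: lins lf, simp add: lins lf)
    apply (simp add: mA_def Nmap_tens Ac(1) *)
    by (simp add: Th_act[OF hmc_Hreg, symmetric] Nmap_act yd_facts[OF R] hA)
qed

end

section \<open>The unit of A, the projection to R, and the comparison maps\<close>

context pbc begin

lemma lin_selA: "lin (act (Hreg H))" by (simp add: Hreg_sel hf)

lemma cmap_mA: "cmap (tco (co A) (co A)) (co A) mA"
  using cmap_comp[OF cmap_N[OF R hA] cmap_Th[OF hmc_Hreg]] by (simp add: mA_def[abs_def] o_def)

lemma comult_e: "comult RR (e \<otimes> r) = sw (comult R r) (\<lambda>r1 r2. (e \<otimes> r1) \<otimes> (e \<otimes> r2))"
  "comult RR (r \<otimes> e) = sw (comult R r) (\<lambda>r1 r2. (r1 \<otimes> e) \<otimes> (r2 \<otimes> e))"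
  by (simp_all add: comult_btens_tens lins lf e_facts tens_lift_tens hmcD[OF yd_hmc[OF R]] tens_scl1 tens_scl2 comodule_counits[OF yd_facts(6)[OF R]])

lemma mA_one: "mA ((e \<otimes> oneH H) \<otimes> b) = b" "mA (b \<otimes> (e \<otimes> oneH H)) = b"
proof -
  note l = mA_def Nmap_tens lins lf Ac Th_tens lin_selA Hreg_sel comult_e push act_btens_tens e_facts m_one \<xi>_one hs linear_scale[OF lin_Th] linear_scale[OF lin_Nmap]
  note c = coalg_counits[OF yd_facts(5)[OF R]] coalg_counits[OF hf(2)]
  show "mA ((e \<otimes> oneH H) \<otimes> b) = b"
    apply (rule lin_ext_tens[where t=b and s=scl], simp add: lins, simp add: lins)
    apply (simp add: l)
    by (simp add: c lift_out lins lf)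
  show "mA (b \<otimes> (e \<otimes> oneH H)) = b"
    apply (rule lin_ext_tens[where t=b and s=scl], simp add: lins, simp add: lins)
    apply (simp add: l)
    by (simp add: c lift_out lins lf)
qed

lemma one_grouplike: "comult A (e \<otimes> oneH H) = (e \<otimes> oneH H) \<otimes> (e \<otimes> oneH H)" "counit A (e \<otimes> oneH H) = 1"
  by (simp_all add: comult_btens_tens counit_btens_tens lins lf e_facts Hreg_sel hs tens_lift_tens)

definition "\<pi> = (epsR (epsH H) :: ('r \<times> 'h \<Rightarrow>\<^sub>0 'k) \<Rightarrow> _)"
lemma \<pi>_tens: "\<pi> (r \<otimes> h) = scl (epsH H h) r" unfolding \<pi>_def by (simp add: epsR_tens lf)
lemma lin_\<pi>: "lin \<pi>" unfolding \<pi>_def by (simp add: lins)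
lemmas [lins] = lin_\<pi> lin_\<pi>[THEN linear_comp]
lemma \<pi>_push[push]: "\<pi> (sw t F) = sw t (\<lambda>a b. \<pi> (F a b))" by (rule tens_lift_hom[OF lin_\<pi>])

lemma \<pi>_act: "\<pi> (act A (h \<otimes> a)) = act R (h \<otimes> \<pi> a)"
  apply (rule lin_ext_tens[where t=a and s=scl], simp add: lins lf, simp add: lins lf)
  apply (simp add: \<pi>_tens act_btens_tens Hreg_sel lins lf hs push)
  by (simp add: lins lf lift_out coalg_counits[OF hf(2)])

lemma cmap_\<pi>: "cmap (co A) (co R) \<pi>"
  unfolding cmap_def
proof (intro conjI allI)
  show "snd (co R) (\<pi> t) = snd (co A) t" for t
    by (rule lin_ext_tens[where t=t and s="(*)"]) (simp_all add: lins lf \<pi>_tens counit_btens_tens Hreg_sel push)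
  show "fst (co R) (\<pi> t) = sw (fst (co A) t) (\<lambda>x y. \<pi> x \<otimes> \<pi> y)" for t
    apply (rule lin_ext_tens[where t=t and s=scl], simp add: lins lf, simp add: lins lf)
    apply (simp add: lins lf \<pi>_tens comult_btens_tens Hreg_sel push hs mv)
    by (simp add: lins lf lift_out coalg_counits[OF hf(2)] comodule_counits[OF yd_facts(6)[OF R]] sw_tens)
qed (simp add: lins)

abbreviation "RRR \<equiv> btens H R RR"
abbreviation "RRRR \<equiv> btens H R RRR"
text \<open>(r#h) \<otimes> (s#l) |-> r \<otimes> hs \<epsilon>(l), and likewise for three and four
  factors: each H-part acts diagonally on all factors to its right, and the last one goes to its
  counit. In particular w_A = w o Q2.\<close>

definition "Q2 = (Nmap R \<circ> tm (\<lambda>x. x) \<pi> :: (_ \<Rightarrow>\<^sub>0 'k) \<Rightarrow> ('r \<times> 'r \<Rightarrow>\<^sub>0 'k))"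
definition "Q3 = (Nmap RR \<circ> tm (\<lambda>x. x) Q2 :: (_ \<Rightarrow>\<^sub>0 'k) \<Rightarrow> ('r \<times> 'r \<times> 'r \<Rightarrow>\<^sub>0 'k))"
definition "Q4 = (Nmap RRR \<circ> tm (\<lambda>x. x) Q3 :: (_ \<Rightarrow>\<^sub>0 'k) \<Rightarrow> ('r \<times> 'r \<times> 'r \<times> 'r \<Rightarrow>\<^sub>0 'k))"

lemma hR: "hmc H R" by (rule yd_hmc[OF R])
lemma hRRR: "hmc H RRR" by (rule T1[OF R hRR])
lemma hRRRR: "hmc H RRRR" by (rule T1[OF R hRRR])

lemma cogs: "cog (co R)" "cog (co A)" "cog (co RR)" "cog (co RRR)" "cog (co RRRR)" "cog (co RA)"
  "cog (tco (co A) (co A))" "cog (tco (co A) (tco (co A) (co A)))" "cog (tco (co A) (tco (co A) (tco (co A) (co A))))"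
  by (simp_all add: cog_tco cog_co hR hA hRR hRRR hRRRR hRA)

text \<open>By \<open>cmap_N\<close> and the projection to R. Consequently these maps carry braided
  convolution on powers of R to ordinary convolution on powers of A.\<close>

lemma cmap_Q2: "cmap (tco (co A) (co A)) (co RR) Q2"
  unfolding Q2_def by (rule cmap_comp[OF cmap_tm cmap_N]) (simp_all add: cmap_\<pi> cmap_id cogs R hR)
lemma cmap_Q3: "cmap (tco (co A) (tco (co A) (co A))) (co RRR) Q3"
  unfolding Q3_def by (rule cmap_comp[OF cmap_tm cmap_N]) (simp_all add: cmap_Q2 cmap_id cogs R hRR)
lemma cmap_Q4: "cmap (tco (co A) (tco (co A) (tco (co A) (co A)))) (co RRRR) Q4"
  unfolding Q4_def by (rule cmap_comp[OF cmap_tm cmap_N]) (simp_all add: cmap_Q3 cmap_id cogs R hRRR)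
lemmas lin_Q = cmap_Q2[THEN cmapD(1)] cmap_Q3[THEN cmapD(1)] cmap_Q4[THEN cmapD(1)]
lemmas [lins] = lin_Q lin_Q[THEN linear_comp]

end

section \<open>The integral and the functional v, given as an inverse of g = lam o \<xi>\<close>

locale pbcv = pbc H R e m \<xi> for H :: "('h, 'k::field) hopf" and R :: "('h, 'r, 'k) ydcoalg" and e m \<xi> +
  fixes lam v
  assumes lam: "ad_invariant_integral H lam" and lin_v: "linK v"
    and vg: "convK (comult RR) v (lam \<circ> \<xi>) = counit RR" and gv: "convK (comult RR) (lam \<circ> \<xi>) v = counit RR"
begin

definition "g = lam \<circ> \<xi>"
lemma lamD: "linK lam" "sw (DeltaH H h) (\<lambda>h1 h2. scl (lam h2) h1) = scl (lam h) (oneH H)" "lam (oneH H) = 1"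
   "swK (DeltaH H h) (\<lambda>h1 h2. lam (h1 \<bullet>\<^bsub>H\<^esub> x \<bullet>\<^bsub>H\<^esub> antipode H h2)) = epsH H h * lam x"
  using lam unfolding ad_invariant_integral_def by blast+

lemma lin_g: "linK g" unfolding g_def by (rule linear_o[OF lamD(1)]) (simp add: lins lf)
lemmas [lins] = lin_g lin_g[THEN linear_comp] lin_v lin_v[THEN linear_comp]

text \<open>Equivariance of \<xi> for the adjoint action meets ad-invariance of the
  integral.\<close>

lemma g_act: "g (act RR (h \<otimes> z)) = epsH H h * g z"
  by (simp add: g_def \<xi>_act tens_lift_hom[OF lamD(1)] lamD(4))

text \<open>Invariance passes to the inverse. For w(z) = v(hz), invariance of g gives (w*g)(z) =
  v(h1 z1) g(h2 z2) = (v*g)(hz) = \<epsilon>(h) \<epsilon>(z); multiplying by v on the right yields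
  w = \<epsilon>(h) v.\<close>

lemma v_act: "v (act RR (h \<otimes> z)) = epsH H h * v z"
proof -
  define w where "w z = v (act RR (h \<otimes> z))" for z
  have w: "linK w" unfolding w_def[abs_def] by (simp add: lins lf)
  note g1 = lin_g[unfolded g_def]
  have "convK (comult RR) w g z = epsH H h * counit RR z" for z
  proof -
    have "epsH H h * counit RR z = counit RR (act RR (h \<otimes> z))" by (simp add: RRc)
    also have "\<dots> = convK (comult RR) v g (act RR (h \<otimes> z))" by (simp add: vg g_def)
    also have "\<dots> = swK (comult RR z) (\<lambda>z1 z2. swK (DeltaH H h) (\<lambda>h1 h2. epsH H h2 * (v (act RR (h1 \<otimes> z1)) * g z2)))"
      unfolding convK_def RRc(6) by (simp add: lins lf tens_lift_tens_lift tens_lift_tens g_act mv mult_ac)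
    also have "\<dots> = convK (comult RR) w g z"
      by (simp add: coalg_counits[OF hf(2)] lins lf convK_def w_def)
    finally show ?thesis ..
  qed
  then have e: "convK (comult RR) w g = (\<lambda>z. epsH H h * counit RR z)" by auto
  have "w = cnv (co RR) (cnv (co RR) w g) v"
    using cnv_assoc[OF cogs(3) w lin_g lin_v] cnv_unitR[OF cogs(3) w] gv by (simp add: g_def)
  also have "\<dots> = (\<lambda>z. epsH H h * v z)"
    unfolding fst_conv e by (rule ext) (simp add: convK_def mult.assoc lift_out coalg_counits[OF RRc(2)] lin_v)
  finally show ?thesis by (simp add: w_def fun_eq_iff)
qed

text \<open>Apply the integral to the second leg of \<open>Delta_\<xi>\<close> and use that it is an
  integral. This is the identity by which twisting absorbs the cocycle.\<close>

lemma g_\<xi>: "sw (comult RR z) (\<lambda>z1 z2. sw (coact RR z2) (\<lambda>a z20. scl (g z20) (\<xi> z1 \<bullet>\<^bsub>H\<^esub> a))) = scl (g z) (oneH H)"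
  using lamD(2)[of "\<xi> z"] by (simp add: Delta_\<xi> push lins lf g_def linear_comp[OF lamD(1)])

lemma g_one: "g (e \<otimes> r) = counit R r" "g (r \<otimes> e) = counit R r"
  by (simp_all add: g_def \<xi>_one linear_scale[OF lamD(1)] lamD(3))

text \<open>Restrict v*g = \<epsilon> to e \<otimes> R and R \<otimes> e, copies of the coalgebra R
  on which g is the unit.\<close>

lemma v_one: "v (e \<otimes> r) = counit R r" "v (r \<otimes> e) = counit R r"
proof -
  have 1: "cmap (co R) (co RR) (\<lambda>r. e \<otimes> r)" "cmap (co R) (co RR) (\<lambda>r. r \<otimes> e)"
    by (simp_all add: cmap_def lins lf comult_e counit_btens_tens e_facts)
  note l = lin_v lin_g
  have 2: "g \<circ> (\<lambda>r. e \<otimes> r) = counit R" "g \<circ> (\<lambda>r. r \<otimes> e) = counit R" by (auto simp: g_one)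
  have 3: "counit RR \<circ> (\<lambda>r. e \<otimes> r) = counit R" "counit RR \<circ> (\<lambda>r. r \<otimes> e) = counit R"
    by (auto simp: counit_btens_tens e_facts lf)
  have 4: "v \<circ> (\<lambda>r. e \<otimes> r) = counit R" "v \<circ> (\<lambda>r. r \<otimes> e) = counit R"
    using cnv_pull[OF 1(1) lin_v lin_g] cnv_pull[OF 1(2) lin_v lin_g] vg 2 3
      cnv_unitR[OF cogs(1), of "v \<circ> (\<lambda>r. e \<otimes> r)"] cnv_unitR[OF cogs(1), of "v \<circ> (\<lambda>r. r \<otimes> e)"]
    by (simp_all add: g_def[symmetric] linear_o[OF lin_v] lins)
  show "v (e \<otimes> r) = counit R r" "v (r \<otimes> e) = counit R r" using 4 by (simp_all add: fun_eq_iff)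
qed

abbreviation "I \<equiv> (\<lambda>x. x)"
definition "mvR = conv3 (comult RR) v m g"
lemma lin_mvR: "lin mvR" unfolding mvR_def[abs_def] conv3_def[abs_def] by (simp add: lins)
lemmas [lins] = lin_mvR lin_mvR[THEN linear_comp]

text \<open>v o Q2 is v_A, and its inverse is g o Q2 because Q2 is a coalgebra map. The general
  theory of twists now applies to A.\<close>

sublocale tw: twisted "co A" mA "e \<otimes> oneH H" "v \<circ> Q2" "g \<circ> Q2"
proof (rule twisted.intro)
  note p = cnv_pull[OF cmap_Q2]
  have 1: "counit RR \<circ> Q2 = snd (tco (co A) (co A))" using cmapD(3)[OF cmap_Q2] by auto
  show "cnv (tco (co A) (co A)) (v \<circ> Q2) (g \<circ> Q2) = snd (tco (co A) (co A))"
    using p[OF lin_v lin_g] vg 1 by (simp add: g_def)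
  show "cnv (tco (co A) (co A)) (g \<circ> Q2) (v \<circ> Q2) = snd (tco (co A) (co A))"
    using p[OF lin_g lin_v] gv 1 by (simp add: g_def)
  show "(v \<circ> Q2) ((e \<otimes> oneH H) \<otimes> x) = snd (co A) x" "(v \<circ> Q2) (x \<otimes> (e \<otimes> oneH H)) = snd (co A) x" for x
    by (rule lin_ext_tens[where t=x and s="(*)"]; simp add: lins lf Q2_def tm_tens Nmap_tens hmcD[OF hR] \<pi>_tens counit_btens_tens Hreg_sel v_one hs e_facts tens_scl1 tens_scl2
      linear_scale[OF lin_v] linear_scale[OF lin_Nmap] linear_scale[OF yd_facts(1)[OF R]] linear_scale[OF yd_facts(4)[OF R]] mult_ac)+
qed (simp_all add: cogs cmap_mA mA_assoc mA_one one_grouplike lins linear_o[OF lin_v] linear_o[OF lin_g])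

text \<open>H-linearity of the projection allows the action to be taken before projecting. So v_A
  factors through R \<otimes> A by the same map as the product of A, and the conjugation can be
  computed there.\<close>

lemma vbar: "v \<circ> Q2 = v \<circ> tm I \<pi> \<circ> Nmap A" "g \<circ> Q2 = g \<circ> tm I \<pi> \<circ> Nmap A"
proof -
  have "Q2 t = tm I \<pi> (Nmap A t)" for t
    unfolding Q2_def comp_apply by (rule Nmap_natural) (simp_all add: lins lf \<pi>_act)
  then show "v \<circ> Q2 = v \<circ> tm I \<pi> \<circ> Nmap A" "g \<circ> Q2 = g \<circ> tm I \<pi> \<circ> Nmap A" by auto
qed

lemma tm\<pi>_io: "tm I \<pi> (io z h) = scl (epsH H h) z"
  by (rule lin_ext_tens[where t=z and s=scl]) (simp_all add: io_tens tm_tens lins lf \<pi>_tens tens_scl2)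

text \<open>The heart of the matter. On z \<otimes> h the conjugate is v(z1) m(z2) \<otimes>
  \<xi>(z3) z4_{-1} h weighted by g(z4_0), and \<open>g_\<xi>\<close> turns the last two legs of z
  into the scalar g(z3). The H-part is left untouched.\<close>

lemma conv3_RA: "conv3 (comult RA) (v \<circ> tm I \<pi>) Mh (g \<circ> tm I \<pi>) (io z h) = mvR z \<otimes> h"
proof -
  have st: "sw (comult RR z) (\<lambda>z1 z2. sw (coact RR z2) (\<lambda>a z20. scl (g z20) (P \<otimes> (\<xi> z1 \<bullet>\<^bsub>H\<^esub> (a \<bullet>\<^bsub>H\<^esub> k))))) = scl (g z) (P \<otimes> k)" for z k P
    using arg_cong[OF g_\<xi>[of z], of "\<lambda>u. P \<otimes> (u \<bullet>\<^bsub>H\<^esub> k)"] by (simp add: push lins lf hs)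
  show ?thesis
    unfolding conv3_def mvR_def
    apply (simp add: RRC_comult[OF hmc_Hreg] Hreg_sel push lins lf hs tm\<pi>_io Th_io lin_selA linear_scale[OF lin_v] linear_scale[OF lin_g] scl_scl[symmetric] mv)
    apply (simp add: lins lf lift_out coalg_counits[OF hf(2)] RR_counit[where s=scl, OF R] mv_DeltaH_in tens_lift_swap[where t="DeltaH H k" and u="coact RR u" for k u])
    by (simp add: lins lf lift_out coalg_coassoc[OF RRc(2)] st)
qed

end

section \<open>The twisted product on A and on R\<close>

lemma ext22:
  assumes "Vector_Spaces.linear scl s f" "Vector_Spaces.linear scl s g" "\<And>x y z w. f ((x \<otimes> y) \<otimes> (z \<otimes> w)) = g ((x \<otimes> y) \<otimes> (z \<otimes> w))"
  shows "f t = g t"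
proof (rule ext2'[OF assms(1,2)])
  fix x y u
  show "f ((x \<otimes> y) \<otimes> u) = g ((x \<otimes> y) \<otimes> u)"
    by (rule lin_ext_tens[where s=s and t=u]) (simp_all add: assms(3) linear_comp[OF assms(1)] linear_comp[OF assms(2)] lins)
qed

lemma [push]: "epsL e (sw t F) = sw t (\<lambda>a b. epsL e (F a b))" by (rule tens_lift_hom[OF lin_epsL])
lemma [push]: "epsR e (sw t F) = sw t (\<lambda>a b. epsR e (F a b))" by (rule tens_lift_hom[OF lin_epsR])
lemma [push]: "tm f g (sw t F) = sw t (\<lambda>a b. tm f g (F a b))" by (rule tens_lift_hom[OF lin_tm])

context pbcv begin

definition "mvA = tw.mv"
definition "\<alpha>A = tw.\<alpha>"

text \<open>Product, v_A and its inverse all factor through the coalgebra map \<open>Nmap A\<close>,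
  hence so does the conjugated product.\<close>

lemma mv_Nmap: "mvA t = conv3 (comult RA) (v \<circ> tm I \<pi>) Mh (g \<circ> tm I \<pi>) (Nmap A t)"
proof -
  have m: "mA = Mh \<circ> Nmap A" by (auto simp: mA_def)
  have "conv3 (fst (co RA)) (v \<circ> tm I \<pi>) Mh (g \<circ> tm I \<pi>) \<circ> Nmap A = conv3 (fst (tco (co A) (co A))) (v \<circ> tm I \<pi> \<circ> Nmap A) (Mh \<circ> Nmap A) (g \<circ> tm I \<pi> \<circ> Nmap A)"
    by (rule conv3_pull[OF cogs(7) cmap_N[OF R hA] cogs(6)]) (simp_all add: lins linear_o[OF lin_v] linear_o[OF lin_g])
  moreover have "mvA = conv3 (fst (tco (co A) (co A))) (v \<circ> tm I \<pi> \<circ> Nmap A) (Mh \<circ> Nmap A) (g \<circ> tm I \<pi> \<circ> Nmap A)"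
    by (simp only: mvA_def tw.mv_def vbar[symmetric] m[symmetric])
  ultimately have "mvA = conv3 (fst (co RA)) (v \<circ> tm I \<pi>) Mh (g \<circ> tm I \<pi>) \<circ> Nmap A" by simp
  from fun_cong[OF this, of t] show ?thesis unfolding comp_apply[of "conv3 _ _ _ _"] fst_conv .
qed

text \<open>Inserting \<open>conv3_RA\<close> gives the product of the bosonization of (R,
  m^v).\<close>

lemma mv_tens: "mvA ((r \<otimes> h) \<otimes> (s \<otimes> l)) = sw (DeltaH H h) (\<lambda>h1 h2. mvR (r \<otimes> act R (h1 \<otimes> s)) \<otimes> (h2 \<bullet>\<^bsub>H\<^esub> l))"
proof -
  have c: "conv3 (comult RA) (v \<circ> tm I \<pi>) Mh (g \<circ> tm I \<pi>) (x \<otimes> y \<otimes> h) = mvR (x \<otimes> y) \<otimes> h" for x y h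
    using conv3_RA[of "x \<otimes> y" h] by (simp add: io_tens)
  have l: "lin (conv3 (comult RA) (v \<circ> tm I \<pi>) Mh (g \<circ> tm I \<pi>))" unfolding conv3_def[abs_def] by (simp add: lins)
  show ?thesis
    unfolding mv_Nmap Nmap_tens[OF Ac(1)] act_btens_tens[OF hf(3) yd_facts(1)[OF R] lin_selA] Hreg_sel tens_sw2 tens_lift_hom[OF l] c ..
qed

lemma lin_mv: "lin mvA" using cmapD(1)[OF tw.cmap_mv, folded mvA_def] .
lemma lin_\<alpha>: "linK \<alpha>A" unfolding \<alpha>A_def by (rule tw.lin\<alpha>)
lemmas [lins] = lin_mv lin_mv[THEN linear_comp] lin_\<alpha> lin_\<alpha>[THEN linear_comp]
lemma mvR_push[push]: "mvR (sw t F) = sw t (\<lambda>a b. mvR (F a b))" by (rule tens_lift_hom[OF lin_mvR])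

lemma cmap_m: "cmap (co RR) (co R) m"
  by (simp add: cmap_def lin_m comult_m counit_m)
lemma cmap_mvR: "cmap (co RR) (co R) mvR"
  using cmap_conv3[OF cogs(3) cogs(1) cmap_m lin_v lin_g] vg gv by (simp add: mvR_def g_def)
lemma counit_mvR: "counit R (mvR z) = counit RR z" using cmapD(3)[OF cmap_mvR] by simp
lemma mvR_act: "mvR (act RR (h \<otimes> z)) = act R (h \<otimes> mvR z)"
  unfolding mvR_def conv3_def
  apply (simp add: RRc(6) push lins lf m_act g_act v_act mv scl_scl[symmetric])
  by (simp add: lins lf lift_out coalg_counits[OF hf(2)] mv_DeltaH_in)

lemma vg': "convK (comult RR) v g = counit RR" and gv': "convK (comult RR) g v = counit RR"
  using vg gv by (simp_all add: g_def)

lemma invF: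
  assumes "cmap Y (co RR) F"
  shows "cnv Y (v \<circ> F) (g \<circ> F) = snd Y" "cnv Y (g \<circ> F) (v \<circ> F) = snd Y"
proof -
  have "counit RR \<circ> F = snd Y" using cmapD(3)[OF assms] by auto
  with cnv_pull[OF assms lin_v lin_g] cnv_pull[OF assms lin_g lin_v]
  show "cnv Y (v \<circ> F) (g \<circ> F) = snd Y" "cnv Y (g \<circ> F) (v \<circ> F) = snd Y"
    by (simp_all add: vg' gv')
qed

text \<open>The map z \<otimes> h |-> m^v(z) \<otimes> h is a coalgebra map to A, being a conjugate
  of one. Computing the coproduct of m^v(z)#1 directly and through this map, then applying
  \<epsilon> \<otimes> H to the first leg and the projection to R to the second, extracts the
  coaction.\<close>

lemma mvR_colinear: "coact R (mvR z) = sw (coact RR z) (\<lambda>a z0. a \<otimes> mvR z0)"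
proof -
  define M where "M = conv3 (comult RA) (v \<circ> tm I \<pi>) Mh (g \<circ> tm I \<pi>)"
  have \<pi>': "cmap (co RA) (co RR) (tm I \<pi>)"
    by (rule cmap_bt) (simp_all add: hA hR cmap_\<pi> \<pi>_act)
  have c: "cmap (co RA) (co A) M"
    using cmap_conv3[OF cogs(6) cogs(2) cmap_Th[OF hmc_Hreg] _ _ invF[OF \<pi>']]
    by (simp add: M_def linear_o[OF lin_v] linear_o[OF lin_g] lins)
  note M = conv3_RA[folded M_def] cmapD(1)[OF c] cmapD(1)[OF c, THEN linear_comp] tens_lift_hom[OF cmapD(1)[OF c]]
  have 2: "comult A (mvR z \<otimes> oneH H) = sw (comult RR z) (\<lambda>z1 z2. sw (coact RR z2) (\<lambda>a z20. (mvR z1 \<otimes> a) \<otimes> (mvR z20 \<otimes> oneH H)))"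
    using cmapD(2)[OF c, of "io z (oneH H)"]
    by (simp add: M RRC_comult[OF hmc_Hreg] Hreg_sel hs tens_lift_tens lins lf tens_lift_tens_lift)
  show ?thesis
    using arg_cong[OF 2, of "\<lambda>t. sw t (\<lambda>p q. epsL (counit R) p \<otimes> \<pi> q)"]
    apply (simp add: comult_btens_tens Hreg_sel lins lf push epsL_tens \<pi>_tens hs counit_mvR)
    by (simp add: lins lf lift_out coalg_counits[OF yd_facts(5)[OF R]] coalg_counits[OF RRc(2)] sw_tens)
qed

lemma mvR_one: "mvR (e \<otimes> x) = x" "mvR (x \<otimes> e) = x"
proof -
  note l = mv_tens hs tens_lift_tens lins lf push \<pi>_tens hmcD[OF hR]
  show "mvR (e \<otimes> x) = x" "mvR (x \<otimes> e) = x"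
    using arg_cong[OF tw.mv_unit(1)[folded mvA_def, of "x \<otimes> oneH H"], of \<pi>] arg_cong[OF tw.mv_unit(2)[folded mvA_def, of "x \<otimes> oneH H"], of \<pi>]
    by (simp_all add: l)
qed

section \<open>The reassociator of R^v inside the braided convolution algebra of three
  factors\<close>

definition "F1 = (epsL (counit R) :: ('r \<times> 'r \<times> 'r \<Rightarrow>\<^sub>0 'k) \<Rightarrow> ('r \<times> 'r \<Rightarrow>\<^sub>0 'k))"
definition "F2 = (tm I m :: ('r \<times> 'r \<times> 'r \<Rightarrow>\<^sub>0 'k) \<Rightarrow> ('r \<times> 'r \<Rightarrow>\<^sub>0 'k))"
definition "F3 = Th R"
definition "F4 = (tm I (epsR (counit R)) :: ('r \<times> 'r \<times> 'r \<Rightarrow>\<^sub>0 'k) \<Rightarrow> ('r \<times> 'r \<Rightarrow>\<^sub>0 'k))"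
text \<open>This will be identified with \<partial>_R^2(v). The four factors correspond to those of
  \<partial>_A^2(v_A); in the third, \<open>F3\<close> replaces m \<otimes> R because the \<xi>-part
  of a product in A acts on the third factor.\<close>

definition "aR = cnv (co RRR) (v \<circ> F1) (cnv (co RRR) (v \<circ> F2) (cnv (co RRR) (g \<circ> F3) (g \<circ> F4)))"

lemma cmap_epsR': "cmap (co RR) (co R) (epsR (counit R))"
  unfolding cmap_def
proof (intro conjI allI)
  show "snd (co R) (epsR (counit R) t) = snd (co RR) t" for t
    by (rule lin_ext_tens[where t=t and s="(*)"]) (simp_all add: lins lf epsR_tens counit_btens_tens linear_scale[OF yd_facts(4)[OF R]])
  show "fst (co R) (epsR (counit R) t) = sw (fst (co RR) t) (\<lambda>x y. epsR (counit R) x \<otimes> epsR (counit R) y)" for t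
    apply (rule lin_ext_tens[where t=t and s=scl], simp add: lins lf, simp add: lins lf)
    apply (simp add: lins lf epsR_tens comult_btens_tens push hmcD[OF hR] mv)
    by (simp add: lins lf lift_out coalg_counits[OF yd_facts(5)[OF R]] comodule_counits[OF yd_facts(6)[OF R]] sw_tens mv_coact)
qed (simp add: lins)

lemma epsR_act: "epsR (counit R) (act RR (h \<otimes> t)) = act R (h \<otimes> epsR (counit R) t)"
  apply (rule lin_ext_tens[where t=t and s=scl], simp add: lins lf, simp add: lins lf)
  apply (simp add: epsR_tens act_btens_tens lins lf push hmcD[OF hR] scl_scl[symmetric])
  by (simp add: lins lf lift_out coalg_counits[OF hf(2)])

lemma cmap_epsL': "cmap (co RRR) (co RR) (epsL (counit R))"
  unfolding cmap_def
proof (intro conjI allI)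
  show "snd (co RR) (epsL (counit R) t) = snd (co RRR) t" for t
    by (rule lin_ext_tens[where t=t and s="(*)"]) (simp_all add: lins lf epsL_tens counit_btens_tens linear_scale[OF RRc(4)])
  show "fst (co RR) (epsL (counit R) t) = sw (fst (co RRR) t) (\<lambda>x y. epsL (counit R) x \<otimes> epsL (counit R) y)" for t
    apply (rule lin_ext_tens[where t=t and s=scl], simp add: lins lf, simp add: lins lf)
    apply (simp add: lins lf epsL_tens comult_btens_tens push hmcD[OF hRR] mv tens_lift_swap[where t="comult R t" and u="comult RR u" for t u])
    by (simp add: lins lf lift_out coalg_counits[OF yd_facts(5)[OF R]] counit_colinears[OF R] hmcD[OF hRR] sw_tens)
qed (simp add: lins)

lemma epsL_act: "epsL (counit R) (act RRR (h \<otimes> t)) = act RR (h \<otimes> epsL (counit R) t)"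
  apply (rule lin_ext_tens[where t=t and s=scl], simp add: lins lf, simp add: lins lf)
  apply (simp add: epsL_tens act_btens_tens lins lf push hmcD[OF hR] scl_scl[symmetric])
  by (simp add: lins lf lift_out coalg_counits[OF hf(2)])

lemma tm_act:
  assumes "lin f" "\<And>h t. f (act C (h \<otimes> t)) = act D (h \<otimes> f t)" "lin (act C)" "lin (act D)"
  shows "tm I f (act (btens H R C) (h \<otimes> t)) = act (btens H R D) (h \<otimes> tm I f t)"
  by (rule lin_ext_tens[where t=t and s=scl]) (simp_all add: lins lf assms linear_comp[OF assms(1)] act_btens_tens tm_tens push tens_lift_hom[OF lin_tm])

lemma cmapF: "cmap (co RRR) (co RR) F1" "cmap (co RRR) (co RR) F2" "cmap (co RRR) (co RR) F3" "cmap (co RRR) (co RR) F4"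
  unfolding F1_def F2_def F3_def F4_def
  by (simp_all add: cmap_epsL' cmap_bt hR hRR cmap_m m_act cmap_Th cmap_epsR' epsR_act)

lemma F_act: "F1 (act RRR (h \<otimes> t)) = act RR (h \<otimes> F1 t)" "F2 (act RRR (h \<otimes> t)) = act RR (h \<otimes> F2 t)"
  "F3 (act RRR (h \<otimes> t)) = act RR (h \<otimes> F3 t)" "F4 (act RRR (h \<otimes> t)) = act RR (h \<otimes> F4 t)"
  unfolding F1_def F2_def F3_def F4_def
  by (simp_all add: epsL_act tm_act lins lf m_act Th_act hR epsR_act)

lemma cnv_act:
  assumes C: "hmc H C" and l: "linK a" "linK b" and a: "\<And>h t. a (act C (h \<otimes> t)) = epsH H h * a t" and b: "\<And>h t. b (act C (h \<otimes> t)) = epsH H h * b t"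
  shows "convK (comult C) a b (act C (h \<otimes> t)) = epsH H h * convK (comult C) a b t"
  unfolding convK_def
  apply (simp add: hmcD[OF C] lins lf l l[THEN linear_comp] tens_lift_tens_lift tens_lift_tens a b mv)
  by (simp add: mult.assoc lins lf l lift_out coalg_counits[OF hf(2)] mv_DeltaH_in) (simp add: mult.left_commute[of "a _"] lift_out)

lemmas linF = cmapF[THEN cmapD(1)]
lemmas [lins] = linF linF[THEN linear_comp]
lemmas linvg = linear_o[OF lin_v] linear_o[OF lin_g] linK_cnv[OF cogs(4), unfolded fst_conv] cogs

lemma lin_aR: "linK aR" unfolding aR_def by (simp add: linvg)
lemmas [lins] = lin_aR lin_aR[THEN linear_comp]

lemma aR_act: "aR (act RRR (h \<otimes> t)) = epsH H h * aR t"
  unfolding aR_def by (simp add: cnv_act hRRR linvg lins F_act v_act g_act)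

text \<open>Each factor is invertible, as the pullback of v or g along a coalgebra map; the inverses
  are multiplied in reverse order.\<close>

lemma aR_inv: "conv_invertible (comult RRR) (counit RRR) aR"
proof -
  let ?b = "cnv (co RRR) (v \<circ> F4) (cnv (co RRR) (v \<circ> F3) (cnv (co RRR) (g \<circ> F2) (g \<circ> F1)))"
  note i = cmapF[THEN invF(1)] cmapF[THEN invF(2)]
  note i' = i[THEN cnv_cancel[OF cogs(4)]]
  have b: "linK ?b" by (simp add: linvg)
  have "cnv (co RRR) aR ?b = snd (co RRR)" "cnv (co RRR) ?b aR = snd (co RRR)"
    unfolding aR_def by (simp_all add: cnv_assoc[OF cogs(4), unfolded fst_conv] i[unfolded fst_conv snd_conv] i'[unfolded fst_conv snd_conv] linvg lins)
  from conv_inv_eq(2)[OF cogs(4) lin_aR b this] show ?thesis by simp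
qed

lemma Q2_eq: "Q2 t = tm I \<pi> (Nmap A t)"
  unfolding Q2_def comp_apply by (rule Nmap_natural) (simp_all add: lins lf \<pi>_act)

lemma \<pi>_Mh: "\<pi> (Mh u) = m (tm I \<pi> u)"
  apply (rule io_ext[where t=u and s=scl], simp add: lins lf, simp add: lins lf)
  apply (simp add: Th_io lin_selA Hreg_sel tm\<pi>_io push lins lf \<pi>_tens hs eps_\<xi> linear_scale[OF lin_m])
  by (simp add: lift_out coalg_counits[OF RRc(2)] lins lf)

lemma \<pi>_mA: "\<pi> (mA t) = m (Q2 t)"
  unfolding mA_def \<pi>_Mh Q2_eq ..

lemma Q2_tens: "Q2 ((r \<otimes> h) \<otimes> (s \<otimes> l)) = scl (epsH H l) (r \<otimes> act R (h \<otimes> s))"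
  by (simp add: Q2_def tm_tens lins \<pi>_tens Nmap_tens lf linear_scale[OF lin_Nmap] tens_scl2)

lemma \<pi>_mv: "\<pi> (mvA t) = mvR (Q2 t)"
proof (rule ext22[where t=t and s=scl])
  show "lin (\<lambda>t. \<pi> (mvA t))" by (rule lin_\<pi>[THEN linear_comp, OF lin_mv])
  show "lin (\<lambda>t. mvR (Q2 t))" by (simp add: lins)
  fix r h s l
  show "\<pi> (mvA ((r \<otimes> h) \<otimes> (s \<otimes> l))) = mvR (Q2 ((r \<otimes> h) \<otimes> (s \<otimes> l)))"
    unfolding mv_tens Q2_tens
    apply (simp add: lins lf push \<pi>_tens hs linear_scale[OF lin_mvR] scl_scl[symmetric])
    by (simp add: lins lf lift_out coalg_counits[OF hf(2)])
qed

lemma tm_tm: "lin f \<Longrightarrow> lin g' \<Longrightarrow> tm I f (tm I g' t) = tm I (\<lambda>x. f (g' x)) t"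
  by (rule lin_ext_tens[where t=t and s=scl]) (simp_all add: lins tm_tens linear_comp)

text \<open>If \<open>f\<close> on A \<otimes> A lies over an H-linear \<open>f'\<close> on R
  \<otimes> R, then id \<otimes> \<open>f\<close> lies over id \<otimes> \<open>f'\<close>: the
  H-part of the additional factor acts through \<open>f'\<close> by linearity.\<close>

lemma Q2_tm:
  assumes f: "lin f" "lin f'" "\<And>t. \<pi> (f t) = f' (Q2 t)" "\<And>h t. f' (act RR (h \<otimes> t)) = act R (h \<otimes> f' t)"
  shows "Q2 (tm I f t) = tm I f' (Q3 t)"
proof -
  have "Q2 (tm I f t) = Nmap R (tm I (\<lambda>x. \<pi> (f x)) t)"
    unfolding Q2_def comp_apply by (simp add: tm_tm f(1) lins)
  also have "\<dots> = Nmap R (tm I f' (tm I Q2 t))"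
    unfolding f(3) by (simp add: tm_tm f(2) lins)
  also have "\<dots> = tm I f' (Q3 t)"
    unfolding Q3_def comp_apply by (rule Nmap_natural) (simp_all add: f lins lf)
  finally show ?thesis .
qed

end

section \<open>Lifting the structure of R to A, and descent of the axioms\<close>

context pbcv begin

lemma Q2_tens': "Q2 (a \<otimes> b) = Nmap R (a \<otimes> \<pi> b)"
  by (simp add: Q2_def tm_tens lins)
lemma Q3_tens: "Q3 (a \<otimes> u) = Nmap RR (a \<otimes> Q2 u)"
  by (simp add: Q3_def tm_tens lins)
lemma Q4_tens: "Q4 (a \<otimes> t) = Nmap RRR (a \<otimes> Q3 t)"
  by (simp add: Q4_def tm_tens lins)

text \<open>Elements of the form r#1 give a section of each comparison map. Hence the maps are
  surjective and identities may be checked after pullback.\<close>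

lemma Q_hat: "Q2 ((r \<otimes> oneH H) \<otimes> (s \<otimes> oneH H)) = r \<otimes> s"
  "Q3 ((r \<otimes> oneH H) \<otimes> (s \<otimes> oneH H) \<otimes> (t \<otimes> oneH H)) = r \<otimes> s \<otimes> t"
  "Q4 ((r \<otimes> oneH H) \<otimes> (s \<otimes> oneH H) \<otimes> (t \<otimes> oneH H) \<otimes> (u \<otimes> oneH H)) = r \<otimes> s \<otimes> t \<otimes> u"
  by (simp_all add: Q2_tens Q3_tens Q4_tens hs scl_one Nmap_tens hmcD[OF hR] hmcD[OF hRR] hmcD[OF hRRR])

text \<open>The H-part of a product ab contains \<xi>, which then acts on c; so the product of A
  lies over \<open>Th C\<close>.\<close>

lemma Nmap_mA:
  assumes C: "hmc H C"
  shows "Nmap C (mA (a \<otimes> b) \<otimes> c) = Th C (Nmap (btens H R C) (a \<otimes> Nmap C (b \<otimes> c)))"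
proof -
  note lC = lf hmcD(1)[OF C]
  have *: "Nmap C (mA (a \<otimes> (s \<otimes> l)) \<otimes> c) = Th C (Nmap (btens H R C) (a \<otimes> Nmap C ((s \<otimes> l) \<otimes> c)))" for s l
    by (rule lin_ext_tens[where t=a and s=scl], simp add: lins lC, simp add: lins lC)
      (simp add: mA_def Nmap_tens Ac(1) lC lins act_btens_tens lin_selA push Th_tens Hreg_sel hmcD(5)[OF C] hs)
  show ?thesis
    by (rule lin_ext_tens[where t=b and s=scl], simp add: lins lC, simp add: lins lC) (rule *)
qed

text \<open>In the twisted product the H-part is free of \<xi>, so in contrast to
  \<open>Nmap_mA\<close> it lies simply over m^v \<otimes> C.\<close>

lemma Nmap_mv:
  assumes C: "hmc H C"
  shows "Nmap C (mvA (a \<otimes> b) \<otimes> c) = tm mvR I (asc (Nmap (btens H R C) (a \<otimes> Nmap C (b \<otimes> c))))"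
proof -
  note lC = lf hmcD(1)[OF C]
  have *: "Nmap C (mvA (a \<otimes> (s \<otimes> l)) \<otimes> c) = tm mvR I (asc (Nmap (btens H R C) (a \<otimes> Nmap C ((s \<otimes> l) \<otimes> c))))" for s l
  proof (rule lin_ext_tens[where t=a and s=scl], simp add: lins lC, simp add: lins lC)
    fix r h
    show "Nmap C (mvA ((r \<otimes> h) \<otimes> (s \<otimes> l)) \<otimes> c) = tm mvR I (asc (Nmap (btens H R C) ((r \<otimes> h) \<otimes> Nmap C ((s \<otimes> l) \<otimes> c))))"
      unfolding mv_tens
      by (simp add: Nmap_tens lC lins act_btens_tens push tens_lift_hom[OF lin_asc] asc_tens tm_tens hmcD(5)[OF C])
  qed
  show ?thesis
    by (rule lin_ext_tens[where t=b and s=scl], simp add: lins lC, simp add: lins lC) (rule *)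
qed

lemma \<pi>_epsR: "\<pi> (epsR (counit A) t) = epsR (counit R) (Q2 t)"
proof (rule ext22[where t=t and s=scl], simp add: lins, simp add: lins)
  fix r h s l
  show "\<pi> (epsR (counit A) ((r \<otimes> h) \<otimes> (s \<otimes> l))) = epsR (counit R) (Q2 ((r \<otimes> h) \<otimes> (s \<otimes> l)))"
    by (simp add: Q2_tens epsR_tens counit_btens_tens lins lf Hreg_sel \<pi>_tens linear_scale[OF lin_epsR] linear_scale[OF lin_\<pi>] hmcD[OF hR] scl_scl mult_ac)
qed

lemma epsR_asc: "linK p \<Longrightarrow> epsR p (asc t) = tm I (epsR p) t" for p :: "('c \<Rightarrow>\<^sub>0 'k) \<Rightarrow> 'k"
  by (rule ext3[where t=t and s=scl]) (simp_all add: lins asc_tens epsR_tens tm_tens tens_scl2)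

lemma Q2_mA: "Q2 (tm I mA t) = tm I m (Q3 t)"
  by (rule Q2_tm) (simp_all add: lins lf \<pi>_mA m_act)
lemma Q2_mv: "Q2 (tm I mvA t) = tm I mvR (Q3 t)"
  by (rule Q2_tm) (simp_all add: lins lf \<pi>_mv mvR_act)
lemma Q2_eps: "Q2 (tm I (epsR (counit A)) t) = tm I (epsR (counit R)) (Q3 t)"
  by (rule Q2_tm) (simp_all add: lins lf \<pi>_epsR epsR_act)

text \<open>The four factors of \<partial>_A^2(v_A) are matched one by one with pullbacks along
  \<open>Q3\<close>, and pullback is multiplicative.\<close>

lemma \<alpha>_Q3: "\<alpha>A = aR \<circ> Q3"
proof -
  \<comment> \<open>The H-part of the first factor acts on the argument of v; invariance of v
    replaces it by its counit.\<close>
  have 1: "v \<circ> Q2 \<circ> epsL (counit A) = v \<circ> F1 \<circ> Q3"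
  proof
    fix t
    have "v (Q2 (epsL (counit A) t)) = v (F1 (Q3 t))"
      by (rule ext2'[where t=t and s="(*)"], simp add: lins, simp add: lins)
        (simp add: Q3_tens F1_def epsL_tens counit_btens_tens Hreg_sel lins lf Nmap_tens linear_scale[OF lin_v] v_act linear_scale[OF lin_Q(1)] mult_ac)
    then show "(v \<circ> Q2 \<circ> epsL (counit A)) t = (v \<circ> F1 \<circ> Q3) t" by simp
  qed
  have 2: "v \<circ> Q2 \<circ> tm I mA = v \<circ> F2 \<circ> Q3"
    by (rule ext) (simp add: F2_def Q2_mA)
  have 3: "g \<circ> Q2 \<circ> tm mA I \<circ> asc = g \<circ> F3 \<circ> Q3"
  proof
    fix t
    have "Q2 (tm mA I (asc t)) = F3 (Q3 t)"
      by (rule ext3[where t=t and s=scl], simp add: lins, simp add: lins)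
        (simp add: Q2_tens' Q3_tens F3_def asc_tens tm_tens lins Nmap_mA[OF hR])
    then show "(g \<circ> Q2 \<circ> tm mA I \<circ> asc) t = (g \<circ> F3 \<circ> Q3) t" by simp
  qed
  have 4: "g \<circ> Q2 \<circ> epsR (counit A) \<circ> asc = g \<circ> F4 \<circ> Q3"
    by (rule ext) (simp add: F4_def epsR_asc lins Q2_eps lf)
  have "\<alpha>A = cnv tw.XXX (v \<circ> F1 \<circ> Q3) (cnv tw.XXX (v \<circ> F2 \<circ> Q3) (cnv tw.XXX (g \<circ> F3 \<circ> Q3) (g \<circ> F4 \<circ> Q3)))"
    unfolding \<alpha>A_def tw.\<alpha>_def snd_conv 1 2 3 4 ..
  also have "\<dots> = aR \<circ> Q3"
    unfolding aR_def by (simp add: cnv_pull[OF cmap_Q3, unfolded fst_conv] linvg lins)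
  finally show ?thesis .
qed

lemma aR_hat: "aR (r \<otimes> s \<otimes> t) = \<alpha>A ((r \<otimes> oneH H) \<otimes> (s \<otimes> oneH H) \<otimes> (t \<otimes> oneH H))"
  by (simp add: \<alpha>_Q3 Q_hat del: comp_apply) (simp add: Q_hat)

lemma aR_one: "aR (e \<otimes> x \<otimes> y) = counit R x * counit R y" "aR (x \<otimes> e \<otimes> y) = counit R x * counit R y" "aR (x \<otimes> y \<otimes> e) = counit R x * counit R y"
  unfolding aR_hat by (simp_all add: tw.\<alpha>_unit[folded \<alpha>A_def] counit_btens_tens lins lf Hreg_sel hs)

lemma tmvR_act: "tm mvR I (asc (act RRR (h \<otimes> t))) = act RR (h \<otimes> tm mvR I (asc t))"
proof (rule ext3[where t=t and s=scl], simp add: lins lf, simp add: lins lf)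
  fix x y z
  have "mvR (sw (DeltaH H h) (\<lambda>h1 h2. act R (h1 \<otimes> x) \<otimes> act R (h2 \<otimes> y))) = act R (h \<otimes> mvR (x \<otimes> y))" for h
    using mvR_act[of h "x \<otimes> y"] by (simp add: act_btens_tens lins lf)
  from this[symmetric]
  show "tm mvR I (asc (act RRR (h \<otimes> x \<otimes> y \<otimes> z))) = act RR (h \<otimes> tm mvR I (asc (x \<otimes> y \<otimes> z)))"
    apply (simp add: act_btens_tens lins lf push tens_lift_hom[OF lin_asc] asc_tens tm_tens)
    by (simp add: coalg_coassoc[OF hf(2)] lins lf)
qed

lemma Q3_tm: "lin f \<Longrightarrow> lin f' \<Longrightarrow> (\<And>t. Q2 (f t) = f' (Q3 t)) \<Longrightarrow> (\<And>h t. f' (act RRR (h \<otimes> t)) = act RR (h \<otimes> f' t)) \<Longrightarrow> Q3 (tm I f t) = tm I f' (Q4 t)"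
proof -
  assume f: "lin f" "lin f'" "\<And>t. Q2 (f t) = f' (Q3 t)" "\<And>h t. f' (act RRR (h \<otimes> t)) = act RR (h \<otimes> f' t)"
  have "Q3 (tm I f t) = Nmap RR (tm I (\<lambda>x. Q2 (f x)) t)"
    unfolding Q3_def comp_apply by (simp add: tm_tm f(1) lins)
  also have "\<dots> = Nmap RR (tm I f' (tm I Q3 t))"
    unfolding f(3) by (simp add: tm_tm f(2) lins)
  also have "\<dots> = tm I f' (Q4 t)"
    unfolding Q4_def comp_apply by (rule Nmap_natural) (simp_all add: f lins lf)
  finally show ?thesis .
qed

lemma Q2_tmv: "Q2 (tm mvA I (asc t)) = tm mvR I (asc (Q3 t))"
  by (rule ext3[where t=t and s=scl], simp add: lins, simp add: lins)
    (simp add: Q2_tens' Q3_tens asc_tens tm_tens lins Nmap_mv[OF hR])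

lemma Q3_tmv: "Q3 (tm mvA I (asc t)) = tm mvR I (asc (Q4 t))"
  by (rule ext3[where t=t and s=scl], simp add: lins, simp add: lins)
    (simp add: Q3_tens Q4_tens asc_tens tm_tens lins Nmap_mv[OF hRR])

lemma Q4_surj:
  assumes "linK f" "linK f'" "f \<circ> Q4 = f' \<circ> Q4"
  shows "f = f'"
proof
  fix t show "f t = f' t"
  proof (rule ext4[OF assms(1,2)])
    fix x y z w
    show "f (x \<otimes> y \<otimes> z \<otimes> w) = f' (x \<otimes> y \<otimes> z \<otimes> w)"
      using fun_cong[OF assms(3), of "(x \<otimes> oneH H) \<otimes> (y \<otimes> oneH H) \<otimes> (z \<otimes> oneH H) \<otimes> (w \<otimes> oneH H)"] by (simp add: Q_hat)
  qed
qed

text \<open>Every term pulls back along \<open>Q4\<close> to the corresponding term of the pentagon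
  for the twist of A, and pullback along a surjection is injective.\<close>

lemma aR_pentagon:
  "cnv (co RRRR) (aR \<circ> tm I (tm I mvR)) (aR \<circ> (tm mvR I \<circ> asc))
   = cnv (co RRRR) (aR \<circ> epsL (counit R)) (cnv (co RRRR) (aR \<circ> tm I (tm mvR I \<circ> asc)) (aR \<circ> tm I (tm I (epsR (counit R)))))"
proof (rule Q4_surj)
  note l = linear_o[OF lin_aR] linear_o lins linK_cnv[OF cogs(5), unfolded fst_conv]
  show "linK (cnv (co RRRR) (aR \<circ> tm I (tm I mvR)) (aR \<circ> (tm mvR I \<circ> asc)))" by (rule linK_cnv[OF cogs(5)])
  show "linK (cnv (co RRRR) (aR \<circ> epsL (counit R)) (cnv (co RRRR) (aR \<circ> tm I (tm mvR I \<circ> asc)) (aR \<circ> tm I (tm I (epsR (counit R))))))" by (rule linK_cnv[OF cogs(5)])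
  have 1: "aR \<circ> tm I (tm I mvR) \<circ> Q4 = \<alpha>A \<circ> tm I (tm I mvA)"
    unfolding \<alpha>_Q3 by (rule ext) (simp add: Q3_tm[of "tm I mvA" "tm I mvR"] Q2_mv lins mvR_act tm_act lf)
  have 2: "aR \<circ> (tm mvR I \<circ> asc) \<circ> Q4 = \<alpha>A \<circ> tm mvA I \<circ> asc"
    unfolding \<alpha>_Q3 by (rule ext) (simp add: Q3_tmv)
  have 3: "aR \<circ> epsL (counit R) \<circ> Q4 = \<alpha>A \<circ> epsL (counit A)"
  proof
    fix t
    have "aR (epsL (counit R) (Q4 t)) = aR (Q3 (epsL (counit A) t))"
      by (rule ext2'[where t=t and s="(*)"], simp add: lins, simp add: lins)
        (simp add: Q4_tens epsL_tens counit_btens_tens Hreg_sel lins lf Nmap_tens linear_scale[OF lin_aR] aR_act linear_scale[OF lin_Q(2)] mult_ac)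
    then show "(aR \<circ> epsL (counit R) \<circ> Q4) t = (\<alpha>A \<circ> epsL (counit A)) t" by (simp add: \<alpha>_Q3)
  qed
  have 4: "aR \<circ> tm I (tm mvR I \<circ> asc) \<circ> Q4 = \<alpha>A \<circ> tm I (tm mvA I \<circ> asc)"
    unfolding \<alpha>_Q3 by (rule ext) (simp add: Q3_tm[of "tm mvA I \<circ> asc" "tm mvR I \<circ> asc"] lins linear_o Q2_tmv tmvR_act)
  have 5: "aR \<circ> tm I (tm I (epsR (counit R))) \<circ> Q4 = \<alpha>A \<circ> tm I (tm I (epsR (counit A)))"
    unfolding \<alpha>_Q3 by (rule ext) (simp add: Q3_tm[of "tm I (epsR (counit A))" "tm I (epsR (counit R))"] Q2_eps lins epsR_act tm_act lf)
  show "cnv (co RRRR) (aR \<circ> tm I (tm I mvR)) (aR \<circ> (tm mvR I \<circ> asc)) \<circ> Q4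
   = cnv (co RRRR) (aR \<circ> epsL (counit R)) (cnv (co RRRR) (aR \<circ> tm I (tm mvR I \<circ> asc)) (aR \<circ> tm I (tm I (epsR (counit R))))) \<circ> Q4"
    using tw.pentagon[folded mvA_def \<alpha>A_def] by (simp add: cnv_pull[OF cmap_Q4, unfolded fst_conv] l 1 2 3 4 5)
qed

lemma Q3_surj:
  assumes "linK f" "linK f'" "f \<circ> Q3 = f' \<circ> Q3"
  shows "f = f'"
proof
  fix t show "f t = f' t"
  proof (rule ext3[OF assms(1,2)])
    fix x y z
    show "f (x \<otimes> y \<otimes> z) = f' (x \<otimes> y \<otimes> z)"
      using fun_cong[OF assms(3), of "(x \<otimes> oneH H) \<otimes> (y \<otimes> oneH H) \<otimes> (z \<otimes> oneH H)"] by (simp add: Q_hat)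
  qed
qed

text \<open>Descent along \<open>Q3\<close>; a functional \<open>w\<close> on R is tested on A
  through the projection A -> R.\<close>

lemma aR_quasi_assoc:
  assumes w: "linK w"
  shows "cnv (co RRR) (w \<circ> mvR \<circ> tm I mvR) aR = cnv (co RRR) aR (w \<circ> mvR \<circ> (tm mvR I \<circ> asc))"
proof (rule Q3_surj)
  note W = w linear_o[OF w] linear_o[OF lin_aR] linear_o lins
  show "linK (cnv (co RRR) (w \<circ> mvR \<circ> tm I mvR) aR)" "linK (cnv (co RRR) aR (w \<circ> mvR \<circ> (tm mvR I \<circ> asc)))"
    by (rule linK_cnv[OF cogs(4)])+
  have 1: "w \<circ> mvR \<circ> tm I mvR \<circ> Q3 = (w \<circ> \<pi>) \<circ> mvA \<circ> tm I mvA"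
    by (rule ext) (simp add: \<pi>_mv Q2_mv)
  have 2: "w \<circ> mvR \<circ> (tm mvR I \<circ> asc) \<circ> Q3 = (w \<circ> \<pi>) \<circ> mvA \<circ> tm mvA I \<circ> asc"
    by (rule ext) (simp add: \<pi>_mv Q2_tmv)
  show "cnv (co RRR) (w \<circ> mvR \<circ> tm I mvR) aR \<circ> Q3 = cnv (co RRR) aR (w \<circ> mvR \<circ> (tm mvR I \<circ> asc)) \<circ> Q3"
    using tw.quasi_assoc[of "w \<circ> \<pi>", folded mvA_def \<alpha>A_def] by (simp add: cnv_pull[OF cmap_Q3, unfolded fst_conv] W 1 2 \<alpha>_Q3)
qed

end

section \<open>Colinearity of the reassociator\<close>

context pbcv begin

definition "pH = (epsL (counit R) :: ('r \<times> 'h \<Rightarrow>\<^sub>0 'k) \<Rightarrow> ('h \<Rightarrow>\<^sub>0 'k))"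
lemma lin_pH: "lin pH" unfolding pH_def by (simp add: lins)
lemmas [lins] = lin_pH lin_pH[THEN linear_comp]
lemma pH_tens: "pH (r \<otimes> h) = scl (counit R r) h" unfolding pH_def by (simp add: epsL_tens lf)

text \<open>For a bosonization the map r#h |-> \<epsilon>(r) h is multiplicative: m^v preserves the
  counit, and the action on R is absorbed by \<epsilon>.\<close>

lemma pH_mv: "pH (mvA (a \<otimes> b)) = pH a \<bullet>\<^bsub>H\<^esub> pH b"
proof -
  have "pH (mvA t) = sw t (\<lambda>a b. pH a \<bullet>\<^bsub>H\<^esub> pH b)" for t
  proof (rule ext22[where t=t and s=scl], simp add: lins, simp add: lins lf)
    fix r h s l
    show "pH (mvA ((r \<otimes> h) \<otimes> (s \<otimes> l))) = sw ((r \<otimes> h) \<otimes> (s \<otimes> l)) (\<lambda>a b. pH a \<bullet>\<^bsub>H\<^esub> pH b)"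
      unfolding mv_tens
      apply (simp add: tens_lift_hom[OF lin_pH] pH_tens tens_lift_tens lins lf counit_mvR counit_btens_tens hmcD[OF hR] push scl_scl[symmetric])
      by (simp add: lins lf lift_out coalg_counits[OF hf(2)])
  qed
  from this[of "a \<otimes> b"] show ?thesis by (simp add: tens_lift_tens lins lf)
qed

lemma hat_comult: "comult A (r \<otimes> oneH H) = sw (comult R r) (\<lambda>r1 r2. sw (coact R r2) (\<lambda>a r20. (r1 \<otimes> a) \<otimes> (r20 \<otimes> oneH H)))"
  by (simp add: comult_btens_tens Hreg_sel hs lins lf tens_lift_tens)

text \<open>Push quasi-associativity of the twisted A forward to H by \<open>pH\<close> and evaluate
  it on elements x#1. As \<open>pH\<close> is multiplicative and H is associative, both triple
  products become plain products in H.\<close>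

lemma aR_colinear: "sw (coact RRR t) (\<lambda>a t0. scl (aR t0) a) = scl (aR t) (oneH H)"
proof (rule ext3[where t=t and s=scl], simp add: lins lf, simp add: lins lf)
  fix r s t
  let ?K = "\<lambda>x. pH (mvA (tm I mvA x))" and ?K' = "\<lambda>x. pH (mvA (tm mvA I (asc x)))"
  have K: "?K (a \<otimes> b \<otimes> c) = pH a \<bullet>\<^bsub>H\<^esub> (pH b \<bullet>\<^bsub>H\<^esub> pH c)" "?K' (a \<otimes> b \<otimes> c) = pH a \<bullet>\<^bsub>H\<^esub> (pH b \<bullet>\<^bsub>H\<^esub> pH c)" for a b c
    by (simp_all add: tm_tens asc_tens lins pH_mv hs)
  have sl: "scl (aR u) (scl (counit R w) x) = scl (counit R w) (scl (aR u) x)" "scl (\<alpha>A u') (scl (counit R w) x) = scl (counit R w) (scl (\<alpha>A u') x)" for u u' w and x :: "'h \<Rightarrow>\<^sub>0 'k"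
    by (simp_all add: scl_scl mult.commute)
  let ?D = "fst (tco (co A) (tco (co A) (co A)))"
  have eq: "sw (?D x) (\<lambda>y z. scl (\<alpha>A z) (?K y)) = sw (?D x) (\<lambda>y z. scl (\<alpha>A y) (?K' z))" for x
  proof (rule vec_eqI)
    fix p :: "('h \<Rightarrow>\<^sub>0 'k) \<Rightarrow> 'k" assume p: "linK p"
    from fun_cong[OF tw.quasi_assoc[of "p \<circ> pH", folded mvA_def \<alpha>A_def], of x]
    show "p (sw (?D x) (\<lambda>y z. scl (\<alpha>A z) (?K y))) = p (sw (?D x) (\<lambda>y z. scl (\<alpha>A y) (?K' z)))"
      by (simp add: linear_o[OF p] lins convK_def tens_lift_hom[OF p] linear_scale[OF p] mult.commute[of "\<alpha>A _"] linear_comp[OF p] comp_def)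
  qed
  \<comment> \<open>In the coproduct of x#1 the first leg carries the coaction in its H-part and the
    second leg is again of the form x_0#1. So one side of \<open>eq\<close> is the diagonal coaction
    weighted by \<open>aR\<close>.\<close>
  have "sw (coact RRR (r \<otimes> s \<otimes> t)) (\<lambda>a t0. scl (aR t0) a) = sw (?D ((r \<otimes> oneH H) \<otimes> (s \<otimes> oneH H) \<otimes> (t \<otimes> oneH H))) (\<lambda>y z. scl (\<alpha>A z) (?K y))"
    apply (simp add: tco_tens1 hat_comult K lins lf Ac push pH_tens aR_hat[symmetric] coact_btens_tens)
    by (simp add: sl lins lf lift_out coalg_counits[OF yd_facts(5)[OF R]])
  \<comment> \<open>On the other side \<open>pH\<close> reduces the second legs to counits, and
    colinearity of the counit turns the H-parts of the first legs into 1.\<close>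
  also have "\<dots> = scl (aR (r \<otimes> s \<otimes> t)) (oneH H)"
    unfolding eq
    apply (simp add: tco_tens1 hat_comult K lins lf Ac push pH_tens aR_hat coact_btens_tens hs)
    apply (simp add: sl lins lf lift_out coalg_counits[OF yd_facts(5)[OF R]] counit_colinears[OF R])
    done
  finally show "sw (coact RRR (r \<otimes> s \<otimes> t)) (\<lambda>a t0. scl (aR t0) a) = scl (aR (r \<otimes> s \<otimes> t)) (oneH H)" .
qed

section \<open>Identification with the smash product, its twist and the bosonization\<close>

abbreviation "S \<equiv> smash H R e m \<xi>"
abbreviation "AA \<equiv> tco (co A) (co A)"
abbreviation "AAA \<equiv> tco (co A) AA"

lemma mA_tens: "mA ((r \<otimes> h) \<otimes> (s \<otimes> l)) =
  sw (comult R r) (\<lambda>r1 r2. sw (coact R r2) (\<lambda>a r20. sw (comult R s) (\<lambda>s1 s2.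
         sw (DeltaH H h) (\<lambda>h1 h'. sw (DeltaH H h') (\<lambda>h2 h3.
           m (r1 \<otimes> act R ((a \<bullet>\<^bsub>H\<^esub> h1) \<otimes> s1)) \<otimes>
           (\<xi> (r20 \<otimes> act R (h2 \<otimes> s2)) \<bullet>\<^bsub>H\<^esub> h3 \<bullet>\<^bsub>H\<^esub> l))))))"
  apply (simp add: mA_def Nmap_tens Ac(1) act_btens_tens lins lf lin_selA Hreg_sel push Th_tens comult_btens_tens hmcD[OF hR] hs coalg_coassoc[OF hf(2)] mv)
  done

lemma smash_sel: "comultD S = comult A" "counitD S = counit A" "oneD S = e \<otimes> oneH H" "multD S = mA"
  "reassD S = snd AAA"
proof -
  show "comultD S = comult A" "counitD S = counit A" "oneD S = e \<otimes> oneH H"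
    by (simp_all add: smash_def btens_def Hreg_def)
  show "multD S = mA"
    by (rule ext, rule ext22[where s=scl]) (simp_all add: smash_def lins lf mA_tens tens_lift_tens)
  show "reassD S = snd AAA"
    by (rule ext, rule ext3[where s="(*)"])
      (simp_all add: smash_def tco_tens2 lins lf tens_lift_tens Ac btens_def Hreg_def)
qed

lemma smash_co: "comultDD S = fst AA" "comultDDD S = fst AAA" "counitDD S = snd AA" "counitDDD S = snd AAA"
  unfolding counitDD_def[abs_def] counitDDD_def[abs_def] smash_sel by (simp_all add: tco_def)

lemma extA_Q2: "linK w \<Longrightarrow> extA H R w = w \<circ> Q2"
proof (rule ext)
  fix t assume w: "linK w"
  have "extA H R w t = w (Q2 t)"
  proof (rule ext22[where t=t and s="(*)"])
    show "linK (extA H R w)" unfolding extA_def[abs_def] by (simp add: lins)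
    show "linK (\<lambda>t. w (Q2 t))" by (simp add: linear_comp[OF w] lins)
    show "extA H R w ((r \<otimes> h) \<otimes> (s \<otimes> l)) = w (Q2 ((r \<otimes> h) \<otimes> (s \<otimes> l)))" for r h s l
      by (simp add: extA_def Q2_tens linear_scale[OF w] tens_lift_tens lins lf linear_comp[OF w] mult.commute)
  qed
  then show "extA H R w t = (w \<circ> Q2) t" by simp
qed

text \<open>The inverse of v_A is the pullback of the inverse of v.\<close>

lemma inv_AA: "conv_inv (comultDD S) (counitDD S) (v \<circ> Q2) = g \<circ> Q2" "conv_invertible (comultDD S) (counitDD S) (v \<circ> Q2)"
  unfolding smash_co
  by (rule conv_inv_eq(1)[OF cogs(7)] conv_inv_eq(2)[OF cogs(7), where g="g \<circ> Q2"]; simp add: linear_o[OF lin_v] linear_o[OF lin_g] lins tw.vg tw.gv)+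

lemma gauge: "gauge_transformation S (extA H R v)"
  unfolding gauge_transformation_def extA_Q2[OF lin_v] using inv_AA(2) tw.v by (simp add: smash_sel)

lemma factors:
  "(\<lambda>t. swK t (\<lambda>x u. counitD S x * (v \<circ> Q2) u)) = v \<circ> Q2 \<circ> epsL (counit A)"
  "(\<lambda>t. swK t (\<lambda>x u. (v \<circ> Q2) (x \<otimes> multD S u))) = v \<circ> Q2 \<circ> tm I mA"
  "(\<lambda>t. swK t (\<lambda>x u. swK u (\<lambda>y z. (g \<circ> Q2) (multD S (x \<otimes> y) \<otimes> z)))) = g \<circ> Q2 \<circ> tm mA I \<circ> asc"
  "(\<lambda>t. swK t (\<lambda>x u. swK u (\<lambda>y z. (g \<circ> Q2) (x \<otimes> y) * counitD S z))) = g \<circ> Q2 \<circ> epsR (counit A) \<circ> asc"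
  unfolding smash_sel
  by (rule ext, rule ext3[where s="(*)"]; simp add: lins lf Ac tens_lift_tens epsL_tens epsR_tens tm_tens asc_tens linear_scale[OF lin_v] linear_scale[OF lin_g] linear_scale[OF lin_Q(1)] mult.commute)+

lemma partial2A_eq: "partial2A S (v \<circ> Q2) = \<alpha>A"
  unfolding partial2A_def Let_def inv_AA(1) factors unfolding smash_co(2) \<alpha>A_def tw.\<alpha>_def snd_conv ..

text \<open>\<partial>_R^2(v) evaluates \<partial>_A^2(v_A) = aR o Q3 at elements x#1, where
  \<open>Q3\<close> just returns r \<otimes> s \<otimes> t.\<close>

lemma partial2R_eq: "partial2R H R e m \<xi> v = aR"
  by (rule ext, rule ext3[where s="(*)"])
   (simp_all add: partial2R_def[abs_def] extA_Q2[OF lin_v] partial2A_eq aR_hat tens_lift_tens lins lf)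

lemma inv_RR: "conv_inv (comult RR) (counit RR) v = g"
  using conv_inv_eq(1)[OF cogs(3) lin_v lin_g] vg' gv' by simp

definition "Rv = gauge_twist_yd H R e m \<xi> v"

lemma Rv_sel: "act Rv = act R" "coact Rv = coact R" "comult Rv = comult R" "counit Rv = counit R" "multQ Rv = mvR" "oneQ Rv = e" "reassQ Rv = aR"
  by (simp_all add: Rv_def gauge_twist_yd_def Let_def inv_RR partial2R_eq mvR_def)

text \<open>The products agree by \<open>mv_tens\<close>. Both reassociators equal aR o Q3: h acts
  diagonally on s \<otimes> lt and k goes to its counit, which is how \<open>Q3\<close> acts. The
  remaining structure maps are unchanged by the twist.\<close>

lemma twist_eq: "twist S (v \<circ> Q2) = bosonization H Rv"
proof -
  have 1: "multD (twist S (v \<circ> Q2)) = mvA"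
    unfolding twist_def Let_def inv_AA(1) by (simp add: smash_sel(4) smash_co(1) mvA_def tw.mv_def)
  have 2: "reassD (twist S (v \<circ> Q2)) = \<alpha>A"
    unfolding twist_def Let_def inv_AA(1) factors unfolding smash_co(2) \<alpha>A_def tw.\<alpha>_def snd_conv
    by (simp add: smash_sel(5) smash_co(2) cnv_unitL cogs linear_o[OF lin_g] lins linK_cnv)
  have 3: "multD (bosonization H Rv) = mvA"
    by (rule ext, rule ext22[where s=scl]) (simp_all add: bosonization_def Rv_sel lins lf mv_tens tens_lift_tens)
  have 4: "reassD (bosonization H Rv) = \<alpha>A"
  proof
    fix T show "reassD (bosonization H Rv) T = \<alpha>A T"
    proof (rule ext2'[where t=T and s="(*)"])
      show "linK (reassD (bosonization H Rv))" by (simp add: bosonization_def lins)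
      show "linK \<alpha>A" by (simp add: lins)
      fix r h u
      show "reassD (bosonization H Rv) ((r \<otimes> h) \<otimes> u) = \<alpha>A ((r \<otimes> h) \<otimes> u)"
      proof (rule ext22[where t=u and s="(*)"])
        show "linK (\<lambda>u. reassD (bosonization H Rv) ((r \<otimes> h) \<otimes> u))" by (simp add: bosonization_def lins)
        show "linK (\<lambda>u. \<alpha>A ((r \<otimes> h) \<otimes> u))" by (simp add: lins)
        show "reassD (bosonization H Rv) ((r \<otimes> h) \<otimes> (s \<otimes> l) \<otimes> (t \<otimes> k)) = \<alpha>A ((r \<otimes> h) \<otimes> (s \<otimes> l) \<otimes> (t \<otimes> k))" for s l t k
          by (simp add: bosonization_def Rv_sel tens_lift_tens lins lf \<alpha>_Q3 Q3_tens Q2_tens linear_scale[OF lin_aR] linear_scale[OF lin_Nmap] tens_scl2 Nmap_tens RRc(1) act_btens_tens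
            tens_lift_hom[OF lin_aR] tens_sw2 mult_swK1 mult_swK2 mult.commute)
      qed
    qed
  qed
  have 5: "oneD (twist S (v \<circ> Q2)) = oneD (bosonization H Rv)" "comultD (twist S (v \<circ> Q2)) = comultD (bosonization H Rv)" "counitD (twist S (v \<circ> Q2)) = counitD (bosonization H Rv)"
    by (simp_all add: twist_def Let_def bosonization_def Rv_sel smash_def)
  show ?thesis using 1 2 3 4 5 by (intro dqb.equality) simp_all
qed

lemma btens_Rv: "btens H Rv Rv = RR" "btens H Rv RR = RRR" "btens H Rv RRR = RRRR"
  unfolding btens_def by (simp_all add: Rv_sel)

lemma Rv_yd: "yd_coalgebra H Rv" "coaugmentation H Rv e"
  using R pre unfolding yd_coalgebra_def coaugmentation_def pre_bialgebra_def yd_module_def H_linear_def H_colinear_def H_linearK_def H_colinearK_def btens_Rv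
  by (simp_all add: Rv_sel)

lemma dqb_Rv: "dual_quasi_bialgebra_yd H Rv"
proof -
  note l = lins lf tens_lift_tens tm_tens asc_tens epsL_tens epsR_tens
  \<comment> \<open>\<open>p\<close> and \<open>q\<close> turn the Sweedler sums of the axioms into
    the composites for which pentagon and quasi-associativity were proved.\<close>
  have p: "(\<lambda>t. swK t (\<lambda>x t'. swK t' (\<lambda>y u. aR (x \<otimes> y \<otimes> mvR u)))) = aR \<circ> tm I (tm I mvR)"
    "(\<lambda>t. swK t (\<lambda>x t'. swK t' (\<lambda>y u. aR (mvR (x \<otimes> y) \<otimes> u)))) = aR \<circ> (tm mvR I \<circ> asc)"
    "(\<lambda>t. swK t (\<lambda>x t'. counit R x * aR t')) = aR \<circ> epsL (counit R)"
    "(\<lambda>t. swK t (\<lambda>x t'. swK t' (\<lambda>y u. swK u (\<lambda>z w. aR (x \<otimes> mvR (y \<otimes> z) \<otimes> w))))) = aR \<circ> tm I (tm mvR I \<circ> asc)"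
    "(\<lambda>t. swK t (\<lambda>x t'. swK t' (\<lambda>y u. swK u (\<lambda>z w. aR (x \<otimes> y \<otimes> z) * counit R w)))) = aR \<circ> tm I (tm I (epsR (counit R)))"
    by (rule ext, rule ext4[where s="(*)"]; simp add: l linear_o tens_scl2 linear_scale[OF lin_aR] mult.commute)+
  have q: "(\<lambda>t. sw t (\<lambda>x u. mvR (x \<otimes> mvR u))) = mvR \<circ> tm I mvR"
    "(\<lambda>t. sw t (\<lambda>x u. sw u (\<lambda>y z. mvR (mvR (x \<otimes> y) \<otimes> z)))) = mvR \<circ> (tm mvR I \<circ> asc)"
    by (rule ext, rule ext3[where s=scl]; simp add: l)+
  have qa: "convR (comult RRR) (mvR \<circ> tm I mvR) aR = convL (comult RRR) aR (mvR \<circ> (tm mvR I \<circ> asc))"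
  proof (rule ext, rule vec_eqI)
    fix x and w :: "('r \<Rightarrow>\<^sub>0 'k) \<Rightarrow> 'k" assume w: "linK w"
    from fun_cong[OF aR_quasi_assoc[OF w], of x]
    show "w (convR (comult RRR) (mvR \<circ> tm I mvR) aR x) = w (convL (comult RRR) aR (mvR \<circ> (tm mvR I \<circ> asc)) x)"
      by (simp add: convR_def convL_def convK_def tens_lift_hom[OF w] linear_scale[OF w] mult.commute)
  qed
  show ?thesis
    unfolding dual_quasi_bialgebra_yd_def Let_def Rv_sel btens_Rv p q
    using Rv_yd aR_pentagon qa aR_inv aR_one aR_colinear aR_act mvR_one cmap_mvR mvR_act mvR_colinear
    by (simp add: H_linear_def H_colinear_def coalgebra_hom_def H_linearK_def H_colinearK_def lins Rv_sel cmap_def)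
qed

lemma final:
  "H_linearK H RR v" "gauge_transformation S (extA H R v)" "dual_quasi_bialgebra_yd H (gauge_twist_yd H R e m \<xi> v)"
  "twist S (extA H R v) = bosonization H (gauge_twist_yd H R e m \<xi> v)"
  using gauge dqb_Rv twist_eq v_act by (simp_all add: H_linearK_def lin_v extA_Q2[OF lin_v] Rv_def)

end

section \<open>Finite-dimensional subspaces and separating functionals\<close>

interpretation vsp: vector_space "scl :: 'k::field \<Rightarrow> ('c \<Rightarrow>\<^sub>0 'k) \<Rightarrow> ('c \<Rightarrow>\<^sub>0 'k)" by (rule vector_space_scl)
declare vsp.scale_scale [simp del]

lemma subspace_basis:
  fixes U :: "('c \<Rightarrow>\<^sub>0 'k::field) set"
  assumes "vsp.subspace U" "U \<subseteq> vsp.span T" "finite T"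
  obtains B where "finite B" "vsp.independent B" "vsp.span B = U" "card B \<le> card T"
proof -
  obtain B where B: "B \<subseteq> U" "vsp.independent B" "U \<subseteq> vsp.span B" by (rule vsp.maximal_independent_subset)
  have "finite B \<and> card B \<le> card T" by (rule vsp.independent_span_bound) (use assms B in auto)
  moreover have "vsp.span B = U" using B assms(1) vsp.span_minimal by blast
  ultimately show ?thesis using that B by blast
qed

text \<open>Take a subspace with the property of least dimension inside U; a proper subspace of it
  would have smaller dimension.\<close>

lemma fd_minimal:
  fixes U :: "('c \<Rightarrow>\<^sub>0 'k::field) set"
  assumes "P U" "\<And>U. P U \<Longrightarrow> vsp.subspace U" "U \<subseteq> vsp.span T" "finite T"
  obtains M where "P M" "M \<subseteq> U" "\<And>N. P N \<Longrightarrow> N \<subseteq> M \<Longrightarrow> N = M"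
proof -
  let ?Q = "\<lambda>n. \<exists>B. P (vsp.span B) \<and> vsp.span B \<subseteq> U \<and> finite B \<and> vsp.independent B \<and> card B = n"
  have "\<exists>n. ?Q n"
    using subspace_basis[OF assms(2)[OF assms(1)] assms(3,4)] assms(1) by (metis order_refl)
  then have Q: "?Q (LEAST n. ?Q n)" by (rule LeastI_ex)
  then obtain B where B: "P (vsp.span B)" "vsp.span B \<subseteq> U" "finite B" "vsp.independent B" "card B = (LEAST n. ?Q n)" by blast
  have "N = vsp.span B" if N: "P N" "N \<subseteq> vsp.span B" for N
  proof (rule ccontr)
    assume "N \<noteq> vsp.span B"
    then obtain u where u: "u \<in> vsp.span B" "u \<notin> N" using N(2) by auto
    obtain C where C: "finite C" "vsp.independent C" "vsp.span C = N"
      by (rule subspace_basis[OF assms(2)[OF N(1)] N(2) B(3)])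
    have i: "vsp.independent (insert u C)" using u C by (intro vsp.independent_insertI) auto
    have "card (insert u C) \<le> card B"
      by (rule conjunct2, rule vsp.independent_span_bound[OF B(3) i]) (use u N C vsp.span_superset[of C] in auto)
    moreover have "card (insert u C) = Suc (card C)" using C u vsp.span_superset[of C] by (subst card_insert_disjoint) auto
    moreover have "?Q (card C)" using C N B(2) by blast
    then have "card B \<le> card C" unfolding B(5) by (rule Least_le)
    ultimately show False by simp
  qed
  then show ?thesis using that B(1,2) by blast
qed

lemma functional_extend:
  fixes U :: "('c \<Rightarrow>\<^sub>0 'k::field) set"
  assumes "vsp.subspace U" "u \<notin> U"
  obtains f where "linK f" "\<And>x. x \<in> U \<Longrightarrow> f x = 0" "f u = 1"
proof -
  interpret vp: vector_space_pair "scl :: 'k \<Rightarrow> ('c \<Rightarrow>\<^sub>0 'k) \<Rightarrow> _" "(*) :: 'k \<Rightarrow> 'k \<Rightarrow> 'k"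
    by (simp add: vector_space_pair_def vector_space_scl vector_space_field)
  obtain B where B: "B \<subseteq> U" "vsp.independent B" "U \<subseteq> vsp.span B" by (rule vsp.maximal_independent_subset)
  have sB: "vsp.span B = U" using B assms(1) vsp.span_minimal by blast
  have "vsp.independent (insert u B)" using assms B sB by (intro vsp.independent_insertI) auto
  then obtain f where f: "linK f" "\<forall>x\<in>insert u B. f x = (if x = u then 1 else 0)"
    using vp.linear_independent_extend[of "insert u B" "\<lambda>x. if x = u then 1 else 0"] by blast
  have "f x = 0" if "x \<in> U" for x
  proof -
    have "x \<in> vsp.span B" using that sB by simp
    then show ?thesis
    proof (induction rule: vsp.span_induct_alt)
      case base then show ?case by (rule linear_zero[OF f(1)])
    next
      case (step c x y)
      then show ?case using f(2) B(1) assms(2) by (auto simp: linear_add[OF f(1)] linear_scale[OF f(1)])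
    qed
  qed
  then show ?thesis using that f by auto
qed

section \<open>The dual algebra acting on a coalgebra\<close>

lemma linK_lookup: "linK (\<lambda>x. Poly_Mapping.lookup x c)"
  by (rule linearI[OF vector_space_field]) (simp_all add: lookup_add lookup_scl)

lemma linK_add: "linK f \<Longrightarrow> linK g \<Longrightarrow> linK (\<lambda>x. f x + g x)"
  by (rule linearI[OF vector_space_field]) (simp_all add: linear_add linear_scale algebra_simps)
lemma linK_diff: "linK f \<Longrightarrow> linK g \<Longrightarrow> linK (\<lambda>x. f x - g x)"
  by (rule linearI[OF vector_space_field]) (simp_all add: linear_add linear_scale algebra_simps)

text \<open>\<open>hit\<close> and \<open>hitL\<close> are the left and the right action of the
  convolution algebra of functionals, x1 q(x2) and q(x1) x2. By coassociativity they commute with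
  each other.\<close>

definition hit :: "('c, 'k::field) coalg \<Rightarrow> (('c \<Rightarrow>\<^sub>0 'k) \<Rightarrow> 'k) \<Rightarrow> ('c \<Rightarrow>\<^sub>0 'k) \<Rightarrow> ('c \<Rightarrow>\<^sub>0 'k)" where
  "hit X q x = sw (fst X x) (\<lambda>x1 x2. scl (q x2) x1)"
definition hitL :: "('c, 'k::field) coalg \<Rightarrow> (('c \<Rightarrow>\<^sub>0 'k) \<Rightarrow> 'k) \<Rightarrow> ('c \<Rightarrow>\<^sub>0 'k) \<Rightarrow> ('c \<Rightarrow>\<^sub>0 'k)" where
  "hitL X q x = sw (fst X x) (\<lambda>x1 x2. scl (q x1) x2)"

lemma lin_hit: "cog X \<Longrightarrow> lin (hit X q)" "cog X \<Longrightarrow> lin (hitL X q)"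
  unfolding hit_def[abs_def] hitL_def[abs_def] by (simp_all add: lins cogD)

lemma hit_hit:
  assumes X: "cog X" and q: "linK q" "linK q'"
  shows "hit X q (hit X q' x) = hit X (cnv X q q') x"
proof -
  note l = q q[THEN linear_comp] cogD[OF X] cogD'[OF X]
  have "hit X q (hit X q' x) = sw (fst X x) (\<lambda>x1 x2. sw (fst X x1) (\<lambda>a b. scl (q' x2) (scl (q b) a)))"
    unfolding hit_def by (simp add: tens_lift_hom[OF cogD(1)[OF X]] linear_scale[OF cogD(1)[OF X]] pushs vector_space_scl)
  also have "\<dots> = sw (fst X x) (\<lambda>x1 x2. sw (fst X x2) (\<lambda>a b. scl (q' b) (scl (q a) x1)))"
    by (rule cog_coassoc[OF X]) (simp_all add: lins l)
  also have "\<dots> = hit X (cnv X q q') x"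
    unfolding hit_def convK_def by (simp add: scl_swK scl_scl mult.commute)
  finally show ?thesis .
qed

lemma hit_hitL:
  assumes X: "cog X" and q: "linK q" "linK f"
  shows "hit X q (hitL X f x) = hitL X f (hit X q x)"
proof -
  note l = q q[THEN linear_comp] cogD[OF X] cogD'[OF X]
  have "hitL X f (hit X q x) = sw (fst X x) (\<lambda>x1 x2. sw (fst X x1) (\<lambda>a b. scl (q x2) (scl (f a) b)))"
    unfolding hit_def hitL_def by (simp add: tens_lift_hom[OF cogD(1)[OF X]] linear_scale[OF cogD(1)[OF X]] pushs vector_space_scl)
  also have "\<dots> = sw (fst X x) (\<lambda>x1 x2. sw (fst X x2) (\<lambda>a b. scl (q b) (scl (f x1) a)))"
    by (rule cog_coassoc[OF X]) (simp_all add: lins l)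
  also have "\<dots> = hit X q (hitL X f x)"
    unfolding hit_def hitL_def
    by (simp add: tens_lift_hom[OF cogD(1)[OF X]] linear_scale[OF cogD(1)[OF X]] pushs vector_space_scl) (simp add: scl_scl mult.commute)
  finally show ?thesis ..
qed

lemma hitL_hitL:
  assumes X: "cog X" and q: "linK q" "linK f"
  shows "hitL X q (hitL X f x) = hitL X (cnv X f q) x"
proof -
  note l = q q[THEN linear_comp] cogD[OF X] cogD'[OF X]
  have "hitL X (cnv X f q) x = sw (fst X x) (\<lambda>x1 x2. sw (fst X x1) (\<lambda>a b. scl (f a) (scl (q b) x2)))"
    unfolding hitL_def convK_def by (simp add: scl_swK[symmetric] scl_scl)
  also have "\<dots> = sw (fst X x) (\<lambda>x1 x2. sw (fst X x2) (\<lambda>a b. scl (f x1) (scl (q a) b)))"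
    by (rule cog_coassoc[OF X]) (simp_all add: lins l)
  also have "\<dots> = hitL X q (hitL X f x)"
    unfolding hitL_def by (simp add: tens_lift_hom[OF cogD(1)[OF X]] linear_scale[OF cogD(1)[OF X]] pushs vector_space_scl)
  finally show ?thesis ..
qed

lemma cnv_hit: "linK f \<Longrightarrow> cnv X f q w = f (hit X q w)"
  unfolding hit_def convK_def by (simp add: tens_lift_hom linear_scale mult.commute)

lemma hit_add: "cog X \<Longrightarrow> hit X q (x + y) = hit X q x + hit X q y"
  and hit_scl: "cog X \<Longrightarrow> hit X q (scl c x) = scl c (hit X q x)"
  by (rule linear_add[OF lin_hit(1)], simp) (rule linear_scale[OF lin_hit(1)], simp)

lemma hit_eps: "cog X \<Longrightarrow> hit X (snd X) x = x"
  unfolding hit_def by (simp add: cog_counits lins)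

lemma hit_add1: "hit X (\<lambda>x. p x + q x) x = hit X p x + hit X q x"
  and hit_scl1: "hit X (\<lambda>x. c * q x) x = scl c (hit X q x)"
  and hit_zero1: "hit X (\<lambda>x. 0) x = 0"
  unfolding hit_def tens_lift_def
  by (simp_all add: vsp.scale_right_distrib vsp.scale_left_distrib sum.distrib split_def vsp.scale_sum_right scl_scl mult_ac)

text \<open>Slicing t along the coordinates of the second factor: t is the sum over basis elements b
  of (id \<otimes> b-coordinate)(t) \<otimes> b.\<close>

lemma tens_expand:
  fixes t :: "'a \<times> 'b \<Rightarrow>\<^sub>0 'k::field"
  assumes s: "vector_space s" and l: "\<And>b. Vector_Spaces.linear scl s (\<lambda>a. F a b)" "\<And>a. Vector_Spaces.linear scl s (F a)" and S: "finite S" "snd ` Poly_Mapping.keys t \<subseteq> S"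
  shows "tens_lift s t F = (\<Sum>b\<in>S. F (sw t (\<lambda>x y. scl (Poly_Mapping.lookup y b) x)) (Poly_Mapping.single b 1))"
proof -
  interpret vector_space s by (rule s)
  have *: "(\<Sum>b\<in>S. s (Poly_Mapping.lookup (Poly_Mapping.single b' (1::'k)) b) (G b)) = G b'" if "b' \<in> S" for b' and G :: "'b \<Rightarrow> 'c"
  proof -
    have "(\<Sum>b\<in>S. s (Poly_Mapping.lookup (Poly_Mapping.single b' (1::'k)) b) (G b)) = (\<Sum>b\<in>S. if b = b' then G b else 0)"
      by (rule sum.cong) (auto simp: lookup_single when_def)
    then show ?thesis using that S by simp
  qed
  have "(\<Sum>b\<in>S. F (sw t (\<lambda>x y. scl (Poly_Mapping.lookup y b) x)) (Poly_Mapping.single b 1))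
     = tens_lift s t (\<lambda>x y. \<Sum>b\<in>S. s (Poly_Mapping.lookup y b) (F x (Poly_Mapping.single b 1)))"
    by (simp only: tens_lift_hom[OF l(1)] linear_scale[OF l(1)]) (simp add: tens_lift_def split_def scale_sum_right, rule sum.swap)
  also have "\<dots> = tens_lift s t F"
    unfolding tens_lift_def by (rule sum.cong) (use S in \<open>auto simp: *\<close>)
  finally show ?thesis ..
qed

lemma hit_expand: "finite S \<Longrightarrow> snd ` Poly_Mapping.keys (fst X x) \<subseteq> S \<Longrightarrow> vector_space s \<Longrightarrow> (\<And>b. Vector_Spaces.linear scl s (\<lambda>a. F a b)) \<Longrightarrow> (\<And>a. Vector_Spaces.linear scl s (F a)) \<Longrightarrow>
   tens_lift s (fst X x) F = (\<Sum>b\<in>S. F (hit X (\<lambda>y. Poly_Mapping.lookup y b) x) (Poly_Mapping.single b 1))"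
  unfolding hit_def by (rule tens_expand)

text \<open>Stability under one action puts the coproduct of E into E \<otimes> C, under the other
  into C \<otimes> E; a linear projection \<open>p\<close> onto E shows that it then lies in E
  \<otimes> E.\<close>

lemma subcoalgebraI:
  assumes X: "cog X" and E: "vsp.subspace E" and h: "\<And>q x. linK q \<Longrightarrow> x \<in> E \<Longrightarrow> hit X q x \<in> E" and hL: "\<And>q x. linK q \<Longrightarrow> x \<in> E \<Longrightarrow> hitL X q x \<in> E"
  shows "subcoalgebra (fst X) E"
  unfolding subcoalgebra_def
proof (intro conjI E subsetI)
  interpret vp: vector_space_pair "scl :: 'b \<Rightarrow> ('a \<Rightarrow>\<^sub>0 'b) \<Rightarrow> _" "scl :: 'b \<Rightarrow> ('a \<Rightarrow>\<^sub>0 'b) \<Rightarrow> _"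
    by (simp add: vector_space_pair_def vector_space_scl)
  obtain p where p: "lin p" "p ` UNIV \<subseteq> E" "\<And>x. x \<in> E \<Longrightarrow> p x = x"
    using vp.linear_exists_left_inverse_on[OF linear_ident E] by (auto simp: inj_on_def)
  fix t assume "t \<in> fst X ` E"
  then obtain x where x: "x \<in> E" "t = fst X x" by auto
  let ?S = "snd ` Poly_Mapping.keys t"
  have "t = sw t (\<lambda>a b. a \<otimes> b)" by (simp add: sw_tens)
  also have "\<dots> = (\<Sum>b\<in>?S. hit X (\<lambda>y. Poly_Mapping.lookup y b) x \<otimes> Poly_Mapping.single b 1)"
    unfolding x(2) by (rule hit_expand) (simp_all add: lins)
  also have "\<dots> = (\<Sum>b\<in>?S. p (hit X (\<lambda>y. Poly_Mapping.lookup y b) x) \<otimes> Poly_Mapping.single b 1)"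
    using h[OF linK_lookup x(1)] p(3) by simp
  also have "\<dots> = sw t (\<lambda>a b. p a \<otimes> b)"
    unfolding x(2) by (rule hit_expand[symmetric]) (simp_all add: lins p)
  finally have 1: "t = sw t (\<lambda>a b. p a \<otimes> b)" .
  have 2: "sw t (\<lambda>a b. p a \<otimes> b) = sw t (\<lambda>a b. p a \<otimes> p b)"
  proof (rule tens_eqI)
    fix f q :: "('a \<Rightarrow>\<^sub>0 'b) \<Rightarrow> 'b" assume f: "linK f" "linK q"
    note l = f f(1)[THEN linear_comp] f(2)[THEN linear_comp] p(1) p(1)[THEN linear_comp]
    have fr: "linK (\<lambda>x. f (p x))" by (simp add: l)
    have "swK (sw t (\<lambda>a b. p a \<otimes> b)) (\<lambda>x y. f x * q y) = q (hitL X (\<lambda>x. f (p x)) x)"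
      unfolding hitL_def x(2) by (simp add: pushs lins l tens_lift_hom[OF f(2)] linear_scale[OF f(2)])
    also have "\<dots> = q (p (hitL X (\<lambda>x. f (p x)) x))"
      using hL[OF fr x(1)] p(3) by simp
    also have "\<dots> = swK (sw t (\<lambda>a b. p a \<otimes> p b)) (\<lambda>x y. f x * q y)"
      unfolding hitL_def x(2) by (simp add: pushs lins l tens_lift_hom[OF f(2)] linear_scale[OF f(2)] tens_lift_hom[OF p(1)] linear_scale[OF p(1)])
    finally show "swK (sw t (\<lambda>a b. p a \<otimes> b)) (\<lambda>x y. f x * q y) = swK (sw t (\<lambda>a b. p a \<otimes> p b)) (\<lambda>x y. f x * q y)" .
  qed
  have "t = sw t (\<lambda>a b. p a \<otimes> p b)" using 1 2 by simp
  also have "\<dots> \<in> vsp.span {x \<otimes> y |x y. x \<in> E \<and> y \<in> E}"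
  proof -
    have "p z \<in> E" for z using p(2) by auto
    then show ?thesis unfolding tens_lift_def split_def by (intro vsp.span_sum vsp.span_scale vsp.span_base) auto
  qed
  finally show "t \<in> vsp.span {x \<otimes> y |x y. x \<in> E \<and> y \<in> E}" .
qed

lemma hitL_add: "cog X \<Longrightarrow> hitL X q (x + y) = hitL X q x + hitL X q y"
  and hitL_scl: "cog X \<Longrightarrow> hitL X q (scl c x) = scl c (hitL X q x)"
  and hitL_diff: "cog X \<Longrightarrow> hitL X q (x - y) = hitL X q x - hitL X q y"
  and hitL_zero: "cog X \<Longrightarrow> hitL X q 0 = 0"
proof -
  assume X: "cog X"
  interpret Vector_Spaces.linear scl scl "hitL X q" by (rule lin_hit(2)[OF X])
  show "hitL X q (x + y) = hitL X q x + hitL X q y" "hitL X q (scl c x) = scl c (hitL X q x)"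
    "hitL X q (x - y) = hitL X q x - hitL X q y" "hitL X q 0 = 0"
    by (rule add scale diff zero)+
qed

lemma hit_zero: "cog X \<Longrightarrow> hit X q 0 = 0"
  by (rule linear_zero[OF lin_hit(1)])

section \<open>Right coideals and the coradical filtration at a group-like element\<close>

lemma functional_hitL: "linK g \<Longrightarrow> linK f \<Longrightarrow> g (hitL X f u) = f (hit X g u)"
  unfolding hit_def hitL_def by (simp add: tens_lift_hom linear_scale mult.commute)

text \<open>In terms of comodules these are the right coideals, \<Delta>(U) contained in U \<otimes>
  C.\<close>

definition hitmod :: "('c, 'k::field) coalg \<Rightarrow> ('c \<Rightarrow>\<^sub>0 'k) set \<Rightarrow> bool" where
  "hitmod X U \<longleftrightarrow> vsp.subspace U \<and> (\<forall>q. linK q \<longrightarrow> hit X q ` U \<subseteq> U)"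

lemma hitmodD: "hitmod X U \<Longrightarrow> vsp.subspace U" "hitmod X U \<Longrightarrow> linK q \<Longrightarrow> x \<in> U \<Longrightarrow> hit X q x \<in> U"
  by (auto simp: hitmod_def)

lemma subcoalgebraD:
  assumes X: "cog X" and D: "subcoalgebra (fst X) D" and q: "linK q" and x: "x \<in> D"
  shows "hit X q x \<in> D" "hitL X q x \<in> D"
proof -
  have D': "vsp.subspace D" and t: "fst X x \<in> vsp.span {x \<otimes> y |x y. x \<in> D \<and> y \<in> D}"
    using D x by (auto simp: subcoalgebra_def)
  have "sw (fst X x) (\<lambda>x1 x2. scl (q x2) x1) \<in> D \<and> sw (fst X x) (\<lambda>x1 x2. scl (q x1) x2) \<in> D"
    using t
  proof (induction rule: vsp.span_induct_alt)
    case base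
    then show ?case using vsp.subspace_0[OF D'] by (simp add: tens_lift_def)
  next
    case (step c t u)
    have *: "sw (scl c t + u) F = scl c (sw t F) + sw u F" for F :: "('a \<Rightarrow>\<^sub>0 'b) \<Rightarrow> ('a \<Rightarrow>\<^sub>0 'b) \<Rightarrow> ('a \<Rightarrow>\<^sub>0 'b)"
      by (simp add: linear_add[OF lin_sw] sw_scl)
    show ?case using step D' q unfolding *
      by (auto simp: tens_lift_tens lins intro!: vsp.subspace_add vsp.subspace_scale)
  qed
  then show "hit X q x \<in> D" "hitL X q x \<in> D" by (simp_all add: hit_def hitL_def)
qed

text \<open>Iterated wedges with K e: x lies in stage i+1 iff \<Delta>(x) lies in (stage i)
  \<otimes> C + C \<otimes> K e. The index is shifted by one from the usual filtration: stage 0 is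
  zero and stage 1 is K e.\<close>

primrec filt :: "('c, 'k::field) coalg \<Rightarrow> ('c \<Rightarrow>\<^sub>0 'k) \<Rightarrow> nat \<Rightarrow> ('c \<Rightarrow>\<^sub>0 'k) set" where
  "filt X e 0 = {0}"
| "filt X e (Suc i) = {x. \<forall>q. linK q \<and> q e = 0 \<longrightarrow> hit X q x \<in> filt X e i}"

locale coaug =
  fixes X :: "('c, 'k::field) coalg" and e :: "'c \<Rightarrow>\<^sub>0 'k"
  assumes X: "cog X" and e: "fst X e = e \<otimes> e" "snd X e = 1"
begin

lemma hit_e: "linK q \<Longrightarrow> hit X q e = scl (q e) e"
  unfolding hit_def e by (simp add: tens_lift_tens lins)

lemma cnv_e: "linK q \<Longrightarrow> linK p \<Longrightarrow> cnv X q p e = q e * p e"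
  unfolding convK_def e by (simp add: tens_lift_tens lins)

lemma filt_subspace: "vsp.subspace (filt X e i)"
  by (induction i) (auto simp: vsp.subspace_def hit_add[OF X] hit_scl[OF X] hit_zero[OF X])

lemma filt_hit:
  assumes q: "linK q" and x: "x \<in> filt X e i" shows "hit X q x \<in> filt X e i"
proof (cases i)
  case (Suc j)
  have "hit X q' (hit X q x) \<in> filt X e j" if "linK q'" "q' e = 0" for q'
  proof -
    have "cnv X q' q e = 0" by (simp only: cnv_e[OF that(1) q] that(2) mult_zero_left)
    then have "hit X (cnv X q' q) x \<in> filt X e j" using x linK_cnv[OF X, of q' q] by (simp only: Suc filt.simps mem_Collect_eq)
    then show ?thesis by (simp only: hit_hit[OF X that(1) q])
  qed
  then show ?thesis by (simp add: Suc)
qed (use x in \<open>simp add: hit_zero[OF X]\<close>)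

lemma filt_Suc: "filt X e i \<subseteq> filt X e (Suc i)"
  by (auto intro: filt_hit)

lemma filt_mono: "i \<le> j \<Longrightarrow> filt X e i \<subseteq> filt X e j"
  by (rule lift_Suc_mono_le[of "filt X e", OF filt_Suc])

lemma Un_filtI: "x \<in> filt X e i \<Longrightarrow> x \<in> (\<Union>i. filt X e i)"
  by (rule UN_I[OF UNIV_I])

lemma Un_filt_hitmod: "hitmod X (\<Union>i. filt X e i)"
  unfolding hitmod_def
proof (intro conjI allI impI image_subsetI vsp.subspaceI)
  show "0 \<in> (\<Union>i. filt X e i)" by (rule Un_filtI[OF vsp.subspace_0[OF filt_subspace]])
next
  fix x y assume "x \<in> (\<Union>i. filt X e i)" "y \<in> (\<Union>i. filt X e i)"
  then obtain i j where "x \<in> filt X e i" "y \<in> filt X e j" by (elim UN_E)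
  then have "x \<in> filt X e (max i j)" "y \<in> filt X e (max i j)"
    using filt_mono[of i "max i j"] filt_mono[of j "max i j"] by (simp_all add: subsetD)
  then show "x + y \<in> (\<Union>i. filt X e i)" by (rule Un_filtI[OF vsp.subspace_add[OF filt_subspace]])
next
  fix c x assume "x \<in> (\<Union>i. filt X e i)"
  then obtain i where "x \<in> filt X e i" by (elim UN_E)
  then show "scl c x \<in> (\<Union>i. filt X e i)" by (rule Un_filtI[OF vsp.subspace_scale[OF filt_subspace]])
next
  fix q :: "('c \<Rightarrow>\<^sub>0 'k) \<Rightarrow> 'k" and x assume q: "linK q" and "x \<in> (\<Union>i. filt X e i)"
  then obtain i where "x \<in> filt X e i" by (elim UN_E)
  then show "hit X q x \<in> (\<Union>i. filt X e i)" by (rule Un_filtI[OF filt_hit[OF q]])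
qed

lemma fd_filt:
  assumes "U \<subseteq> (\<Union>i. filt X e i)" "vsp.subspace U" "U \<subseteq> vsp.span T" "finite T"
  obtains i where "U \<subseteq> filt X e i"
proof -
  obtain B where B: "finite B" "vsp.independent B" "vsp.span B = U"
    by (rule subspace_basis[OF assms(2-4)])
  have "B \<subseteq> (\<Union>i. filt X e i)" by (rule order_trans[OF vsp.span_superset]) (simp only: B assms(1))
  with B(1) have "\<exists>i. B \<subseteq> filt X e i"
  proof (induction B rule: finite_induct)
    case (insert b B)
    then obtain i where "B \<subseteq> filt X e i" by auto
    moreover obtain j where "b \<in> filt X e j" using insert.prems by auto
    ultimately have j: "B \<subseteq> filt X e i" "b \<in> filt X e j" .
    have "B \<subseteq> filt X e (max i j)" by (rule order_trans[OF j(1) filt_mono]) simp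
    moreover have "b \<in> filt X e (max i j)" by (rule subsetD[OF filt_mono j(2)]) simp
    ultimately have "insert b B \<subseteq> filt X e (max i j)" by simp
    then show ?case by (rule exI)
  qed simp
  then obtain i where "B \<subseteq> filt X e i" by blast
  then have "U \<subseteq> filt X e i" using vsp.span_minimal[OF _ filt_subspace] by (simp only: B(3)[symmetric])
  then show ?thesis by (rule that)
qed

end

lemma hit_span: "hit X q x \<in> vsp.span ((\<lambda>a. Poly_Mapping.single a 1) ` fst ` Poly_Mapping.keys (fst X x))"
  and hitL_span: "hitL X q x \<in> vsp.span ((\<lambda>a. Poly_Mapping.single a 1) ` snd ` Poly_Mapping.keys (fst X x))"
  unfolding hit_def hitL_def tens_lift_def split_def by (intro vsp.span_sum vsp.span_scale vsp.span_base, force)+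

context coaug
begin

text \<open>A minimal nonzero bi-stable subspace of E is a simple subcoalgebra, hence lies in the
  coradical K e and must be all of it.\<close>

lemma coradical_hitmod:
  assumes cr: "coradical (fst X) = vsp.span {e}"
    and E: "hitmod X E" "\<And>q x. linK q \<Longrightarrow> x \<in> E \<Longrightarrow> hitL X q x \<in> E" "E \<noteq> {0}" "E \<subseteq> vsp.span T" "finite T"
  shows "e \<in> E"
proof -
  define P where "P N \<longleftrightarrow> hitmod X N \<and> (\<forall>q x. linK q \<longrightarrow> x \<in> N \<longrightarrow> hitL X q x \<in> N) \<and> N \<noteq> {0}" for N
  obtain M where M: "P M" "M \<subseteq> E" "\<And>N. P N \<Longrightarrow> N \<subseteq> M \<Longrightarrow> N = M"
    by (rule fd_minimal[of P E T]) (use E in \<open>simp_all add: P_def hitmod_def\<close>)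
  have "subcoalgebra (fst X) M"
    using M(1) by (intro subcoalgebraI[OF X]) (auto simp: P_def hitmod_def)
  moreover have "N = {0} \<or> N = M" if N: "subcoalgebra (fst X) N" "N \<subseteq> M" for N
  proof -
    have "vsp.subspace N" using N by (simp add: subcoalgebra_def)
    then have "P N" if "N \<noteq> {0}"
      using subcoalgebraD[OF X N(1)] that unfolding P_def hitmod_def by blast
    then show ?thesis using M(3)[OF _ N(2)] by blast
  qed
  ultimately have "simple_subcoalgebra (fst X) M"
    using M(1) unfolding simple_subcoalgebra_def P_def by blast
  then have "M \<subseteq> coradical (fst X)"
    unfolding coradical_def by (intro order_trans[OF Union_upper vsp.span_superset] CollectI)
  then have sub: "M \<subseteq> vsp.span {e}" by (simp only: cr)
  have sM: "vsp.subspace M" using M(1) by (auto simp: P_def hitmod_def)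
  then obtain y where y: "y \<in> M" "y \<noteq> 0" using M(1) vsp.subspace_0[OF sM] by (auto simp: P_def)
  then obtain c where c: "y = scl c e" using sub by (auto simp: vsp.span_singleton)
  then have "scl (1 / c) y = e" using y by (auto simp: scl_scl scl_one)
  then show ?thesis using vsp.subspace_scale[OF sM y(1), of "1 / c"] M(2) by auto
qed

text \<open>U/U0 is a simple comodule if U is not inside the filtration, and \<open>sum\<close> says
  that its matrix coefficients span e. Then K e is the image of part of a power of U, so simplicity
  makes U/U0 look like K e, which puts U one stage above U0. The proof is an induction on the number
  n of coefficients.\<close>

lemma coradical_filtration_step:
  fixes U and n :: nat defines "U0 \<equiv> U \<inter> (\<Union>i. filt X e i)"
  assumes U: "hitmod X U" "U \<subseteq> vsp.span T" "finite T"
    and min: "\<And>N. hitmod X N \<Longrightarrow> N \<subseteq> U \<Longrightarrow> N \<noteq> U \<Longrightarrow> N \<subseteq> (\<Union>i. filt X e i)"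
    and f: "\<And>i. linK (f i)" "\<And>i x. x \<in> U0 \<Longrightarrow> f i x = 0" and u: "\<And>i. u i \<in> U"
    and sum: "(\<Sum>i<n. hitL X (f i) (u i)) = e"
  shows "U \<subseteq> (\<Union>i. filt X e i)"
  using u sum
proof (induction n arbitrary: u)
  case 0
  then show ?case using e(2) linear_zero[OF cogD(2)[OF X]] by auto
next
  case (Suc n)
  note sU = hitmodD(1)[OF U(1)]
  \<comment> \<open>As the two actions commute, \<open>S\<close> is a module map from the (n+1)-fold
    power of U to C.\<close>
  define S where "S w = (\<Sum>i<Suc n. hitL X (f i) (w i))" for w :: "nat \<Rightarrow> 'c \<Rightarrow>\<^sub>0 'k"
  have S_add: "S (\<lambda>i. w i + w' i) = S w + S w'" for w w'
    unfolding S_def by (simp add: hitL_add[OF X] sum.distrib del: sum.lessThan_Suc)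
  have S_scl: "S (\<lambda>i. scl c (w i)) = scl c (S w)" for c w
    unfolding S_def by (simp add: hitL_scl[OF X] vsp.scale_sum_right del: sum.lessThan_Suc)
  have S_hit: "S (\<lambda>i. hit X q (w i)) = hit X q (S w)" if "linK q" for q w
    unfolding S_def by (simp add: hit_hitL[OF X that f(1)] linear_sum[OF lin_hit(1)[OF X]] del: sum.lessThan_Suc)
  have mod: "hitmod X {w n | w. (\<forall>i. w i \<in> U) \<and> S w \<in> V}" if V: "hitmod X V" for V
  proof -
    note sV = hitmodD(1)[OF V]
    have 0: "S (\<lambda>_. 0) = 0" using S_scl[of 0 "\<lambda>_. 0"] by simp
    show ?thesis unfolding hitmod_def vsp.subspace_def
    proof (intro conjI ballI allI impI subsetI)
      show "0 \<in> {w n | w. (\<forall>i. w i \<in> U) \<and> S w \<in> V}"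
        using vsp.subspace_0[OF sU] vsp.subspace_0[OF sV] 0 by (intro CollectI exI[of _ "\<lambda>_. 0"]) simp
    next
      fix x y assume "x \<in> {w n | w. (\<forall>i. w i \<in> U) \<and> S w \<in> V}" "y \<in> {w n | w. (\<forall>i. w i \<in> U) \<and> S w \<in> V}"
      then obtain w w' where "x = w n" "y = w' n" "\<forall>i. w i \<in> U" "\<forall>i. w' i \<in> U" "S w \<in> V" "S w' \<in> V" by blast
      then show "x + y \<in> {w n | w. (\<forall>i. w i \<in> U) \<and> S w \<in> V}"
        using vsp.subspace_add[OF sU] vsp.subspace_add[OF sV] by (intro CollectI exI[of _ "\<lambda>i. w i + w' i"]) (simp add: S_add)
    next
      fix c x assume "x \<in> {w n | w. (\<forall>i. w i \<in> U) \<and> S w \<in> V}"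
      then obtain w where "x = w n" "\<forall>i. w i \<in> U" "S w \<in> V" by blast
      then show "scl c x \<in> {w n | w. (\<forall>i. w i \<in> U) \<and> S w \<in> V}"
        using vsp.subspace_scale[OF sU] vsp.subspace_scale[OF sV] by (intro CollectI exI[of _ "\<lambda>i. scl c (w i)"]) (simp add: S_scl)
    next
      fix q :: "('c \<Rightarrow>\<^sub>0 'k) \<Rightarrow> 'k" and x assume q: "linK q" and "x \<in> hit X q ` {w n | w. (\<forall>i. w i \<in> U) \<and> S w \<in> V}"
      then obtain w where "x = hit X q (w n)" "\<forall>i. w i \<in> U" "S w \<in> V" by blast
      then show "x \<in> {w n | w. (\<forall>i. w i \<in> U) \<and> S w \<in> V}"
        using hitmodD(2)[OF U(1) q] hitmodD(2)[OF V q] by (intro CollectI exI[of _ "\<lambda>i. hit X q (w i)"]) (simp add: S_hit[OF q])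
    qed
  qed
  \<comment> \<open>Last coordinates of the preimage under \<open>S\<close> of K e, and of the
    kernel of \<open>S\<close>. Both are right coideals inside U, so each is U itself or lies in the
    filtration.\<close>
  define N where "N = {w n | w. (\<forall>i. w i \<in> U) \<and> S w \<in> vsp.span {e}}"
  define K where "K = {w n | w. (\<forall>i. w i \<in> U) \<and> S w \<in> {0}}"
  have "hitmod X (vsp.span {e})"
    by (auto simp: hitmod_def vsp.span_singleton hit_scl[OF X] hit_e scl_scl vsp.subspace_def vsp.scale_left_distrib[symmetric])
  then have N: "hitmod X N" "N \<subseteq> U" unfolding N_def by (rule mod) auto
  have "hitmod X {0}" by (auto simp: hitmod_def hit_zero[OF X] vsp.subspace_def)
  then have K: "hitmod X K" "K \<subseteq> U" unfolding K_def by (rule mod) auto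
  have Su: "S u = e" using Suc.prems(2) by (simp add: S_def)
  have uN: "u n \<in> N" unfolding N_def using Suc.prems(1) Su vsp.span_base[of e "{e}"] by (intro CollectI exI[of _ u]) simp
  show ?case
  proof (cases "N = U")
    case False
    then have "u n \<in> U0" using uN min[OF N] N(2) by (auto simp: U0_def)
    then have "hit X q (u n) \<in> U0" if "linK q" for q
      using that hitmodD(2)[OF U(1)] hitmodD(2)[OF Un_filt_hitmod] by (auto simp: U0_def simp del: UN_iff)
    then have "hitL X (f n) (u n) = 0"
      by (intro vec_eqI) (simp add: functional_hitL f linear_zero)
    then show ?thesis using Suc.prems by (intro Suc.IH[of u]) simp_all
  next
    case True
    show ?thesis
    proof (cases "K = U")
      case True
      then have "u n \<in> K" using Suc.prems(1) by simp
      then obtain w where w: "u n = w n" "\<And>i. w i \<in> U" "S w = 0" by (auto simp: K_def)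
      \<comment> \<open>Subtracting a relation with the same last entry also eliminates the last
        coefficient.\<close>
      have "(\<Sum>i<n. hitL X (f i) (u i - w i)) = S u - S w"
        by (simp add: S_def hitL_diff[OF X] sum_subtractf w(1))
      then show ?thesis using w(2,3) Su Suc.prems(1) by (intro Suc.IH[of "\<lambda>i. u i - w i"] vsp.subspace_diff[OF sU]) simp_all
    next
      case False
      \<comment> \<open>Remaining case: every y in U is the last entry of some w with S(w) in K e. A
        functional q with q(e) = 0 sends S(w) to 0, so it moves y into \<open>K\<close>, which is
        proper and thus inside U0. By finite dimension U0 lies in a single stage i, so y lies in
        stage i+1.\<close>
      have "U0 \<subseteq> (\<Union>i. filt X e i)" "vsp.subspace U0" "U0 \<subseteq> vsp.span T"
        using U(2) vsp.subspace_inter[OF sU hitmodD(1)[OF Un_filt_hitmod]] by (auto simp: U0_def)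
      then obtain i where i: "U0 \<subseteq> filt X e i" using U(3) by (rule fd_filt)
      have "y \<in> filt X e (Suc i)" if y: "y \<in> U" for y
      proof -
        have "y \<in> N" using y True by simp
        then obtain w where w: "y = w n" "\<And>i. w i \<in> U" "S w \<in> vsp.span {e}" by (auto simp: N_def)
        have "hit X q y \<in> filt X e i" if q: "linK q" "q e = 0" for q
        proof -
          obtain c where "S w = scl c e" using w(3) by (auto simp: vsp.span_singleton)
          then have "hit X q (S w) = 0" by (simp add: hit_scl[OF X] hit_e q)
          then have "hit X q y \<in> K" unfolding K_def
            using w hitmodD(2)[OF U(1) q(1)] by (intro CollectI exI[of _ "\<lambda>i. hit X q (w i)"]) (simp add: S_hit[OF q(1)])
          then show ?thesis using min[OF K False] K(2) i by (auto simp: U0_def)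
        qed
        then show ?thesis by simp
      qed
      then show ?thesis by blast
    qed
  qed
qed

text \<open>If some x were missed, the finite-dimensional coideal generated by x would contain a
  minimal coideal U not inside the filtration. The matrix coefficients of U modulo its filtered part
  U0 span a nonzero finite-dimensional subcoalgebra, which contains e, contradicting
  \<open>coradical_filtration_step\<close>.\<close>

theorem coradical_filtration_exhaustive:
  assumes cr: "coradical (fst X) = vsp.span {e}"
  shows "\<exists>i. x \<in> filt X e i"
proof (rule ccontr)
  let ?F = "\<Union>i. filt X e i"
  assume x: "\<not> (\<exists>i. x \<in> filt X e i)"
  \<comment> \<open>The right coideal generated by x. It is finite-dimensional, being spanned inside
    the left tensor legs of the coproduct of x.\<close>
  define U1 where "U1 = {hit X q x | q. linK q}"
  define T where "T = (\<lambda>a. Poly_Mapping.single a (1::'k)) ` fst ` Poly_Mapping.keys (fst X x)"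
  have "linK (\<lambda>y. c * q y)" "linK (\<lambda>y. q y + p y)" if "linK q" "linK p" for c :: 'k and p q :: "('c \<Rightarrow>\<^sub>0 'k) \<Rightarrow> 'k"
    using that by (simp_all add: linK_add lins)
  moreover have "linK (\<lambda>y::'c \<Rightarrow>\<^sub>0 'k. 0)" by (rule linearI[OF vector_space_field]) simp_all
  ultimately have "vsp.subspace U1" unfolding U1_def vsp.subspace_def
    by (auto simp: hit_add1[symmetric] hit_scl1[symmetric]) (metis hit_zero1)+
  moreover have "hit X q y \<in> U1" if "linK q" "y \<in> U1" for q y
    using that by (auto simp: U1_def hit_hit[OF X] intro: linK_cnv[OF X])
  moreover have "x \<in> U1" unfolding U1_def using hit_eps[OF X, of x, symmetric] cogD(2)[OF X] by blast
  ultimately have U1: "hitmod X U1 \<and> \<not> U1 \<subseteq> ?F" using x by (auto simp: hitmod_def)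
  have T: "U1 \<subseteq> vsp.span T" "finite T" unfolding U1_def T_def by (auto intro: hit_span)
  obtain U where U: "hitmod X U \<and> \<not> U \<subseteq> ?F" "U \<subseteq> U1" "\<And>N. hitmod X N \<and> \<not> N \<subseteq> ?F \<Longrightarrow> N \<subseteq> U \<Longrightarrow> N = U"
    by (rule fd_minimal[of "\<lambda>U. hitmod X U \<and> \<not> U \<subseteq> ?F", OF U1 _ T]) (auto simp: hitmod_def simp del: UN_iff)
  define U0 where "U0 = U \<inter> ?F"
  have mU: "hitmod X U" and nU: "\<not> U \<subseteq> ?F" using U(1) by (rule conjunct1, rule conjunct2)
  note sU = hitmodD(1)[OF mU]
  have sU0: "vsp.subspace U0"
    unfolding U0_def by (rule vsp.subspace_inter[OF sU hitmodD(1)[OF Un_filt_hitmod]])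
  have U0hit: "hit X q y \<in> U0" if "linK q" "y \<in> U0" for q y
    using that(2) hitmodD(2)[OF mU that(1)] hitmodD(2)[OF Un_filt_hitmod that(1)] unfolding U0_def by (simp del: UN_iff)
  have UT: "U \<subseteq> vsp.span T" using U(2) T(1) by blast
  obtain u0 where u0: "u0 \<in> U" "u0 \<notin> U0" using nU unfolding U0_def by blast
  obtain f0 where f0: "linK f0" "\<And>y. y \<in> U0 \<Longrightarrow> f0 y = 0" "f0 u0 = 1"
    by (rule functional_extend[OF sU0 u0(2)]) blast
  \<comment> \<open>Matrix coefficients f(u1) u2 of the quotient U/U0. Vanishing on U0 is preserved
    by both actions because U0 is a coideal.\<close>
  define G where "G = {hitL X f u | f u. linK f \<and> (\<forall>y\<in>U0. f y = 0) \<and> u \<in> U}"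
  have Ghit: "hit X q y \<in> G" if q: "linK q" and y: "y \<in> G" for q y
  proof -
    obtain f u where f: "y = hitL X f u" "linK f" "\<forall>y\<in>U0. f y = 0" "u \<in> U" using y by (auto simp: G_def)
    then have "hit X q y = hitL X f (hit X q u)" by (simp add: hit_hitL[OF X q])
    then show ?thesis using f(2,3) hitmodD(2)[OF mU q f(4)] unfolding G_def by blast
  qed
  have GhitL: "hitL X q y \<in> G" if q: "linK q" and y: "y \<in> G" for q y
  proof -
    obtain f u where f: "y = hitL X f u" "linK f" "\<forall>y\<in>U0. f y = 0" "u \<in> U" using y by (auto simp: G_def)
    have "\<forall>y\<in>U0. cnv X f q y = 0" using f U0hit[OF q] by (simp add: cnv_hit)
    moreover have "hitL X q y = hitL X (cnv X f q) u" by (simp add: f(1) hitL_hitL[OF X q f(2)])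
    ultimately show ?thesis using f(4) linK_cnv[OF X] unfolding G_def by blast
  qed
  have span_closed: "L y \<in> vsp.span G" if "lin L" "\<And>y. y \<in> G \<Longrightarrow> L y \<in> G" "y \<in> vsp.span G" for L y
    using that(3)
  proof (induction rule: vsp.span_induct_alt)
    case base then show ?case by (simp add: linear_zero[OF that(1)] vsp.span_zero)
  next
    case (step c x z)
    show ?case unfolding linear_add[OF that(1)] linear_scale[OF that(1)]
      by (rule vsp.span_add[OF vsp.span_scale[OF vsp.span_base[OF that(2)[OF step(1)]]] step(2)])
  qed
  define T' where "T' = (\<Union>b\<in>T. (\<lambda>a. Poly_Mapping.single a (1::'k)) ` snd ` Poly_Mapping.keys (fst X b))"
  have "hitL X f u \<in> vsp.span T'" if "u \<in> vsp.span T" for f u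
    using that
  proof (induction rule: vsp.span_induct_alt)
    case (step c b y)
    have "hitL X f b \<in> vsp.span T'"
      using hitL_span[of X f b] vsp.span_mono[of _ T'] step(1) unfolding T'_def by blast
    then show ?case using step(2) by (simp add: hitL_add[OF X] hitL_scl[OF X] vsp.span_add vsp.span_scale)
  qed (simp add: hitL_zero[OF X] vsp.span_zero)
  then have "G \<subseteq> vsp.span T'" using UT by (auto simp: G_def)
  then have T': "vsp.span G \<subseteq> vsp.span T'" "finite T'"
    using vsp.span_minimal[OF _ vsp.subspace_span] T(2) by (auto simp: T'_def)
  have "hitL X f0 u0 \<in> G" using f0 u0 by (auto simp: G_def)
  moreover have "snd X (hitL X f0 u0) = 1"
    by (simp add: functional_hitL cogD(2)[OF X] f0(1) hit_eps[OF X] f0(3))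
  then have "hitL X f0 u0 \<noteq> 0" using linear_zero[OF cogD(2)[OF X]] by auto
  ultimately have "vsp.span G \<noteq> {0}" using vsp.span_base by blast
  then have "e \<in> vsp.span G"
    using span_closed[OF lin_hit(1)[OF X] Ghit] span_closed[OF lin_hit(2)[OF X] GhitL] T'
    by (intro coradical_hitmod[OF cr, of "vsp.span G" T']) (auto simp: hitmod_def)
  then have "\<exists>(n::nat) f u. (\<forall>i. linK (f i) \<and> (\<forall>y\<in>U0. f i y = 0) \<and> u i \<in> U) \<and> (\<Sum>i<n. hitL X (f i) (u i)) = e"
  proof (induction rule: vsp.span_induct_alt)
    case base
    then show ?case using f0 u0 by (intro exI[of _ 0] exI[of _ "\<lambda>_. f0"] exI[of _ "\<lambda>_. u0"]) simp
  next
    case (step c x y)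
    obtain n :: nat and f u where y: "\<And>i. linK (f i)" "\<And>i y. y \<in> U0 \<Longrightarrow> f i y = 0" "\<And>i. u i \<in> U" "(\<Sum>i<n. hitL X (f i) (u i)) = y"
      using step(2) by blast
    obtain f' u' where x: "x = hitL X f' u'" "linK f'" "\<And>y. y \<in> U0 \<Longrightarrow> f' y = 0" "u' \<in> U" using step(1) by (auto simp: G_def)
    have "(\<Sum>i<Suc n. hitL X ((f(n := f')) i) ((u(n := scl c u')) i)) = scl c x + y"
      by (simp add: hitL_scl[OF X] x(1) y(4) add.commute)
    moreover have "\<forall>i. linK ((f(n := f')) i) \<and> (\<forall>y\<in>U0. (f(n := f')) i y = 0) \<and> (u(n := scl c u')) i \<in> U"
      using x(2-4) y(1-3) vsp.subspace_scale[OF sU x(4)] by simp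
    ultimately show ?case by blast
  qed
  then obtain n :: nat and f u where fu: "\<And>i. linK (f i)" "\<And>i y. y \<in> U0 \<Longrightarrow> f i y = 0" "\<And>i. u i \<in> U" "(\<Sum>i<n. hitL X (f i) (u i)) = e"
    by blast
  have "N \<subseteq> ?F" if "hitmod X N" "N \<subseteq> U" "N \<noteq> U" for N
    using U(3)[of N] that by blast
  then have "U \<subseteq> ?F"
    by (rule coradical_filtration_step[OF mU UT T(2) _ fu(1) fu(2)[unfolded U0_def] fu(3,4)])
  then show False using nU by contradiction
qed

end

section \<open>Geometric series and invertibility of lam o \<xi>\<close>

primrec cpow :: "('c, 'k::field) coalg \<Rightarrow> (('c \<Rightarrow>\<^sub>0 'k) \<Rightarrow> 'k) \<Rightarrow> nat \<Rightarrow> ('c \<Rightarrow>\<^sub>0 'k) \<Rightarrow> 'k" where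
  "cpow X n 0 = snd X"
| "cpow X n (Suc k) = cnv X (cpow X n k) n"

lemma linK_cpow: "cog X \<Longrightarrow> linK (cpow X n k)"
  by (cases k) (simp_all add: cogD linK_cnv)

lemma cpow_Suc_left:
  assumes X: "cog X" and n: "linK n"
  shows "cpow X n (Suc k) = cnv X n (cpow X n k)"
proof (induction k)
  case 0 then show ?case by (simp add: cnv_unitL[OF X n] cnv_unitR[OF X n])
next
  case (Suc k)
  have "cpow X n (Suc (Suc k)) = cnv X (cpow X n (Suc k)) n" by simp
  also have "\<dots> = cnv X n (cpow X n (Suc k))"
    by (subst Suc.IH) (simp add: cnv_assoc[OF X n linK_cpow[OF X] n])
  finally show ?case .
qed

lemma cnv_sum_left: "cnv X (\<lambda>z. \<Sum>k\<in>K. p k z) g z = (\<Sum>k\<in>K. cnv X (p k) g z)"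
  and cnv_sum_right: "cnv X g (\<lambda>z. \<Sum>k\<in>K. p k z) z = (\<Sum>k\<in>K. cnv X g (p k) z)"
  unfolding convK_def tens_lift_def split_def
  by (simp_all only: sum_distrib_left sum_distrib_right) (rule sum.swap)+

lemma cnv_diff_left: "cnv X (\<lambda>z. p z - q z) g z = cnv X p g z - cnv X q g z"
  and cnv_diff_right: "cnv X g (\<lambda>z. p z - q z) z = cnv X g p z - cnv X g q z"
  unfolding convK_def tens_lift_def split_def by (simp_all add: algebra_simps sum_subtractf)

text \<open>The inverse of \<epsilon> - n is the sum of all powers of n. At each element only
  finitely many powers contribute, although no bound need hold uniformly.\<close>

lemma geometric_conv_inverse:
  assumes X: "cog X" and n: "linK n" and nil: "\<And>z. \<exists>K. \<forall>k\<ge>K. cpow X n k z = 0"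
  obtains v where "linK v" "cnv X v (\<lambda>z. snd X z - n z) = snd X" "cnv X (\<lambda>z. snd X z - n z) v = snd X"
proof -
  define D where "D z = (LEAST K. \<forall>k\<ge>K. cpow X n k z = 0)" for z
  define vK where "vK K z = (\<Sum>k<K. cpow X n k z)" for K z
  define v where "v z = vK (D z) z" for z
  have D: "cpow X n k z = 0" if "k \<ge> D z" for k z
    using LeastI_ex[OF nil[of z]] that unfolding D_def by blast
  have v: "v z = vK K z" if "K \<ge> D z" for z K
    unfolding v_def vK_def by (rule sum.mono_neutral_left) (use that D in \<open>auto simp: not_less\<close>)
  have lin_vK: "linK (vK K)" for K
    by (rule linearI[OF vector_space_field])
      (simp_all add: vK_def linear_add[OF linK_cpow[OF X]] linear_scale[OF linK_cpow[OF X]] sum.distrib sum_distrib_left)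
  have lv: "linK v"
  proof (rule linearI[OF vector_space_field])
    fix x y
    let ?K = "max (D (x + y)) (max (D x) (D y))"
    show "v (x + y) = v x + v y" by (simp add: v[of _ ?K] linear_add[OF lin_vK])
  next
    fix c x
    let ?K = "max (D (scl c x)) (D x)"
    show "v (scl c x) = c * v x" by (simp add: v[of _ ?K] linear_scale[OF lin_vK])
  qed
  have bound: "\<exists>K. \<forall>x\<in>S. K \<ge> D x" if "finite S" for S
    using that by (intro exI[of _ "Max (D ` S)"]) simp
  have 1: "cnv X v (\<lambda>z. snd X z - n z) z = snd X z" for z
  proof -
    \<comment> \<open>One truncation that is valid at z and at the finitely many basis elements in
      the first leg of its coproduct; the truncated series then telescopes.\<close>
    obtain K where K: "\<forall>x\<in>insert z ((\<lambda>p. Poly_Mapping.single (fst p) 1) ` Poly_Mapping.keys (fst X z)). K \<ge> D x"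
      using bound[of "insert z ((\<lambda>p. Poly_Mapping.single (fst p) 1) ` Poly_Mapping.keys (fst X z))"] by auto
    have "cnv X v (\<lambda>z. snd X z - n z) z = cnv X (vK K) (\<lambda>z. snd X z - n z) z"
      unfolding convK_def tens_lift_def by (rule sum.cong) (use K in \<open>auto simp: v[of _ K]\<close>)
    also have "\<dots> = (\<Sum>k<K. cpow X n k z - cpow X n (Suc k) z)"
      unfolding vK_def cnv_sum_left by (simp add: cnv_diff_right cnv_unitR[OF X linK_cpow[OF X]])
    also have "\<dots> = snd X z" using D[of z K] K sum_lessThan_telescope'[of "\<lambda>k. cpow X n k z" K] by simp
    finally show ?thesis .
  qed
  have 2: "cnv X (\<lambda>z. snd X z - n z) v z = snd X z" for z
  proof -
    obtain K where K: "\<forall>x\<in>insert z ((\<lambda>p. Poly_Mapping.single (snd p) 1) ` Poly_Mapping.keys (fst X z)). K \<ge> D x"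
      using bound[of "insert z ((\<lambda>p. Poly_Mapping.single (snd p) 1) ` Poly_Mapping.keys (fst X z))"] by auto
    have "cnv X (\<lambda>z. snd X z - n z) v z = cnv X (\<lambda>z. snd X z - n z) (vK K) z"
      unfolding convK_def tens_lift_def by (rule sum.cong) (use K in \<open>auto simp: v[of _ K]\<close>)
    also have "\<dots> = (\<Sum>k<K. cpow X n k z - cpow X n (Suc k) z)"
      unfolding vK_def cnv_sum_right cpow_Suc_left[OF X n] by (simp add: cnv_diff_left cnv_unitL[OF X linK_cpow[OF X]])
    also have "\<dots> = snd X z" using D[of z K] K sum_lessThan_telescope'[of "\<lambda>k. cpow X n k z" K] by simp
    finally show ?thesis .
  qed
  show ?thesis using that[OF lv] 1 2 by (simp add: fun_eq_iff)
qed

context pbc begin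

text \<open>With n = \<epsilon> - lam o \<xi>, convolving with n on the right raises by one the
  stage of the first factor on which a functional vanishes. So the i-th power of n vanishes on stage
  i tensored with R, and the geometric series applies.\<close>

lemma conv_inverse_lam_\<xi>:
  assumes lam: "ad_invariant_integral H lam" and conn: "connected_coalg R e"
  obtains v where "linK v" "cnv (co RR) v (lam \<circ> \<xi>) = counit RR" "cnv (co RR) (lam \<circ> \<xi>) v = counit RR"
proof -
  interpret coaug "co R" e
    by unfold_locales (simp_all add: cogs e_facts)
  have lin_lam: "linK lam" "lam (oneH H) = 1"
    using lam unfolding ad_invariant_integral_def by blast+
  define n where "n z = counit RR z - lam (\<xi> z)" for z
  have lin_n: "linK n" unfolding n_def[abs_def]
    by (intro linK_diff linear_comp[OF lin_lam(1)]) (simp_all add: lins lf)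
  note nl = lin_n lin_n[THEN linear_comp]
  have n_e: "n (e \<otimes> y) = 0" for y
    by (simp add: n_def \<xi>_one linear_scale[OF lin_lam(1)] lin_lam(2) counit_btens_tens lins lf e_facts)
  have vanish: "cnv (co RR) p n (x \<otimes> y) = 0"
    if p: "linK p" "\<And>x y. x \<in> filt (co R) e i \<Longrightarrow> p (x \<otimes> y) = 0" and x: "x \<in> filt (co R) e (Suc i)" for p i x y
  proof -
    note pl = p(1) p(1)[THEN linear_comp]
    \<comment> \<open>G(x1, x2) is the part of (p*n)(x \<otimes> y) contributed by a splitting of x,
      with the coproduct of y and the braiding already carried out.\<close>
    define G where "G x1 x2 = swK (comult R y) (\<lambda>y1 y2. swK (coact R x2) (\<lambda>a x20. p (x1 \<otimes> act R (a \<otimes> y1)) * n (x20 \<otimes> y2)))" for x1 x2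
    have lin_G: "linK (\<lambda>a. G a b)" "linK (G a)" for a b
      unfolding G_def[abs_def] by (simp_all add: lins lf pl nl)
    let ?q = "\<lambda>b y. Poly_Mapping.lookup y b"
    let ?S = "snd ` Poly_Mapping.keys (comult R x) \<union> Poly_Mapping.keys e"
    have Gq: "G (hit (co R) (?q b) x) c = ?q b e * G x c" for b c
    proof -
      \<comment> \<open>Subtracting q(e) \<epsilon> gives a functional that kills e, so its action
        lowers x by one stage, where p vanishes. Hence modulo terms killed by G the second leg of x
        may be replaced by e, and n(e \<otimes> y) = 0.\<close>
      let ?q' = "\<lambda>y. ?q b y + - ?q b e * counit R y"
      have lq: "linK ?q'" by (intro linK_add linK_lookup) (simp add: lins lf del: mult_minus_left)
      have "?q' e = 0" by (simp add: e_facts)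
      then have "hit (co R) ?q' x \<in> filt (co R) e i" using x lq by simp
      then have "G (hit (co R) ?q' x) c = 0"
        unfolding G_def by (simp add: p(2) tens_lift_def)
      moreover have "hit (co R) (counit R) x = x" using hit_eps[OF X] by simp
      then have "hit (co R) ?q' x = hit (co R) (?q b) x + scl (- ?q b e) x"
        by (simp only: hit_add1 hit_scl1)
      ultimately have "G (hit (co R) (?q b) x + scl (- ?q b e) x) c = 0" by (simp only:)
      then show ?thesis unfolding linear_add[OF lin_G(1)] linear_scale[OF lin_G(1)] by simp
    qed
    have e_sum: "e = (\<Sum>b\<in>?S. scl (?q b e) (Poly_Mapping.single b 1))"
      by (subst single_sum, rule sum.mono_neutral_left) (auto simp: not_in_keys_iff_lookup_eq_zero)
    have "cnv (co RR) p n (x \<otimes> y) = swK (comult R x) G"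
      unfolding G_def[abs_def] convK_def by (simp add: comult_btens_tens lins lf pushs tens_lift_tens pl nl)
    also have "\<dots> = (\<Sum>b\<in>?S. G (hit (co R) (?q b) x) (Poly_Mapping.single b 1))"
      using hit_expand[of ?S "co R" x "(*)" G] by (simp add: lin_G vector_space_field)
    also have "\<dots> = (\<Sum>b\<in>?S. G x (scl (?q b e) (Poly_Mapping.single b 1)))"
      by (simp add: Gq linear_scale[OF lin_G(2)])
    also have "\<dots> = G x e"
      by (subst (2) e_sum) (simp add: linear_sum[OF lin_G(2)])
    also have "\<dots> = 0"
      by (simp add: G_def e_facts tens_lift_tens lins lf pl nl n_e) (simp add: tens_lift_def)
    finally show ?thesis .
  qed
  have pow: "cpow (co RR) n i (x \<otimes> y) = 0" if "x \<in> filt (co R) e i" for i x y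
    using that
  proof (induction i arbitrary: x y)
    case 0
    have "linK (counit R)" by (simp add: lf)
    then have "counit R 0 = 0" by (rule linear_zero)
    then show ?case using 0 by (simp add: counit_btens_tens lins lf)
  next
    case (Suc i)
    show ?case unfolding cpow.simps
      by (rule vanish[OF linK_cpow[OF cogs(3)] Suc.IH Suc.prems])
  qed
  have tens: "\<exists>K. \<forall>k\<ge>K. cpow (co RR) n k (x \<otimes> y) = 0" for x y
  proof -
    obtain i where i: "x \<in> filt (co R) e i"
      using coradical_filtration_exhaustive conn unfolding connected_coalg_def by auto
    then have "cpow (co RR) n k (x \<otimes> y) = 0" if "k \<ge> i" for k
      \<comment> \<open>The stages increase, so x lies in stage k as well, where the k-th power
        vanishes.\<close>
      using pow subsetD[OF filt_mono[OF that] i] by simp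
    then show ?thesis by blast
  qed
  have nil: "\<exists>K. \<forall>k\<ge>K. cpow (co RR) n k z = 0" for z
  proof -
    have "\<exists>K. \<forall>k\<ge>K. cpow (co RR) n k (Poly_Mapping.single p 1) = 0" for p
      using tens[of "Poly_Mapping.single (fst p) 1" "Poly_Mapping.single (snd p) 1"] by (simp add: single_tens)
    then obtain K where K: "\<And>p k. k \<ge> K p \<Longrightarrow> cpow (co RR) n k (Poly_Mapping.single p 1) = 0" by metis
    have "cpow (co RR) n k z = 0" if "k \<ge> Max (K ` Poly_Mapping.keys z)" for k
    proof -
      have "cpow (co RR) n k z = (\<Sum>p\<in>Poly_Mapping.keys z. Poly_Mapping.lookup z p * cpow (co RR) n k (Poly_Mapping.single p 1))"
        by (subst single_sum[of z]) (simp add: linear_sum[OF linK_cpow[OF cogs(3)]] linear_scale[OF linK_cpow[OF cogs(3)]])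
      also have "\<dots> = 0"
      proof (rule sum.neutral, rule ballI)
        fix p assume "p \<in> Poly_Mapping.keys z"
        then have "K p \<le> k" using that by (meson Max_ge finite_imageI finite_keys imageI order_trans)
        then show "Poly_Mapping.lookup z p * cpow (co RR) n k (Poly_Mapping.single p 1) = 0"
          using K[of p k] by simp
      qed
      finally show ?thesis .
    qed
    then show ?thesis by blast
  qed
  obtain v where v: "linK v" "cnv (co RR) v (\<lambda>z. snd (co RR) z - n z) = snd (co RR)" "cnv (co RR) (\<lambda>z. snd (co RR) z - n z) v = snd (co RR)"
    by (rule geometric_conv_inverse[OF cogs(3) lin_n nil])
  have "(\<lambda>z. snd (co RR) z - n z) = lam \<circ> \<xi>" by (simp add: n_def fun_eq_iff)
  then show ?thesis using that v by simp
qed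

end

theorem proposition5p7:
  fixes H :: "('h, 'k::field_char_0) hopf"
    and lam :: "('h \<Rightarrow>\<^sub>0 'k) \<Rightarrow> 'k"
    and R :: "('h, 'r, 'k) ydcoalg"
    and e :: "'r \<Rightarrow>\<^sub>0 'k"
    and m :: "('r \<times> 'r \<Rightarrow>\<^sub>0 'k) \<Rightarrow> ('r \<Rightarrow>\<^sub>0 'k)"
    and \<xi> :: "('r \<times> 'r \<Rightarrow>\<^sub>0 'k) \<Rightarrow> ('h \<Rightarrow>\<^sub>0 'k)"
    and RR :: "('h, 'r \<times> 'r, 'k) ydcoalg"
    and A :: "('r \<times> 'h, 'k) dqb"
    and v :: "('r \<times> 'r \<Rightarrow>\<^sub>0 'k) \<Rightarrow> 'k"
    and v\<^sub>A :: "(('r \<times> 'h) \<times> ('r \<times> 'h) \<Rightarrow>\<^sub>0 'k) \<Rightarrow> 'k"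
    and Rv :: "('h, 'r, 'k) ydqb"
  assumes "hopf_algebra H"
    and "ad_invariant_integral H lam"
    and "pre_bialgebra_with_cocycle H R e m \<xi>"
    and "connected_coalg R e"
    and "RR = btens H R R"
    and "A = smash H R e m \<xi>"
    and "v = conv_inv (comult RR) (counit RR) (lam \<circ> \<xi>)"
    and "v\<^sub>A = extA H R v"
    and "Rv = gauge_twist_yd H R e m \<xi> v"
  shows "conv_invertible (comult RR) (counit RR) (lam \<circ> \<xi>)
    \<and> H_linearK H RR v
    \<and> gauge_transformation A v\<^sub>A
    \<and> dual_quasi_bialgebra_yd H Rv
    \<and> twist A v\<^sub>A = bosonization H Rv"
proof -
  interpret pbc H R e m \<xi>
    using assms(1,3) by unfold_locales (simp_all add: pre_bialgebra_with_cocycle_def)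
  obtain w where w: "linK w" "cnv (co RR) w (lam \<circ> \<xi>) = counit RR" "cnv (co RR) (lam \<circ> \<xi>) w = counit RR"
    unfolding assms(5) by (rule conv_inverse_lam_\<xi>[OF assms(2,4)])
  have "linK lam" using assms(2) unfolding ad_invariant_integral_def by blast
  then have g: "linK (lam \<circ> \<xi>)" by (rule linear_o) (simp add: lf)
  note inv = conv_inv_eq[OF cogs(3) g w(1)[unfolded assms(5)], unfolded fst_conv snd_conv]
  \<comment> \<open>The \<open>conv_inv\<close> in the definition of v is the inverse obtained from
    connectedness, by uniqueness.\<close>
  have v: "v = w" unfolding assms(7) using inv(1) w assms(5) by simp
  interpret pbcv H R e m \<xi> lam v
    by (intro pbcv.intro pbcv_axioms.intro pbc_axioms) (use assms(2) w in \<open>simp_all add: v flip: assms(5)\<close>)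
  show ?thesis
    using final inv(2) w assms by simp
qed

end
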